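(* There exists a universal constant $C>0$ such that the following hold for all $p\in[2,\infty]$ and $n\in\mathbb{N}$, where $q\in[1,2]$ is the Hölder-conjugate of $p$. (Circle) For every Borel probability measure $\mu$ on $\mathbb{T}=\mathbb{R}/\mathbb{Z}$, $$\|\mu-\lambda\|_{\dot W^{-1,p}(\mathbb{T})}\le\frac Cn+C\left(\sum_{k=1}^{n-1}\frac{|\hat\mu(k)|^q}{k^q}\right)^{1/q}.$$ (Interval) For every Borel probability measure $\mu$ on $I=[0,1)$, letting $\bar D=\int_0^1 D(x)\,dx$ denote the mean of its discrepancy function $D(x)=\mu([0,x))-x$, $$\|\mu-\lambda\|_{\dot W^{-1,p}(I)}\le\frac Cn+C\left(\sum_{k=1}^{n-1}\frac{|\hat\mu(k)|^q}{k^q}+|\bar D|^q\right)^{1/q}.$$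
   Context: $\lambda$ is the uniform probability measure on $X\in\{I,\mathbb{T}\}$. Fourier coefficients are $\hat\mu(k)=\int e^{-2\pi i kx}\,d\mu(x)$. For $q\in[1,\infty]$ and $f\colon X\to\mathbb{R}$ with weak derivative $f'$, set $\|f\|_{\dot W^{1,q}(X)}=\|f'\|_{L^q(X)}$; such $f$ with $f'\in L^q(X)$ is identified with its (absolutely) continuous representative. For Hölder-conjugate $(p,q)$ (i.e. $\frac1p+\frac1q=1$), $$\|\mu-\lambda\|_{\dot W^{-1,p}(X)}=\sup\Big\{\int_X f\,d(\mu-\lambda)\ :\ \|f\|_{\dot W^{1,q}(X)}\le 1\Big\}.$$ *)

theory Defs
  imports "HOL-Probability.Probability"
begin

subsection \<open>The circle R/Z\<close>

quotient_type circle = real / "\<lambda>x y :: real. x - y \<in> \<int>"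
  morphisms rep_circle to_circle
proof (rule equivpI)
  show "reflp (\<lambda>x y :: real. x - y \<in> \<int>)"
    by (simp add: reflp_def)
  show "symp (\<lambda>x y :: real. x - y \<in> \<int>)"
    unfolding symp_def by (metis Ints_minus minus_diff_eq)
  show "transp (\<lambda>x y :: real. x - y \<in> \<int>)"
    unfolding transp_def by (metis Ints_add diff_add_cancel add_diff_eq)
qed

text \<open>The quotient topology.\<close>

instantiation circle :: topological_space
begin

definition open_circle :: "circle set \<Rightarrow> bool" where
  "open_circle U \<longleftrightarrow> open (to_circle -` U)"

instance
proof
  show "open (UNIV :: circle set)"
    by (simp add: open_circle_def)
  show "open (S \<inter> T)" if "open S" "open T" for S T :: "circle set"
    using that by (simp add: open_circle_def vimage_Int open_Int)
  show "open (\<Union>K)" if "\<forall>S\<in>K. open S" for K :: "circle set set"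
    using that by (auto simp add: open_circle_def vimage_Union)
qed

end

lemma continuous_on_to_circle: "continuous_on UNIV to_circle"
  by (simp add: continuous_on_open_vimage open_circle_def)

lemma measurable_to_circle [measurable]: "to_circle \<in> borel_measurable borel"
  by (rule borel_measurable_continuous_onI[OF continuous_on_to_circle])

subsection \<open>Uniform measures and Fourier coefficients\<close>

definition unif_interval :: "real measure" where
  "unif_interval = restrict_space lborel {0..<1}"

definition unif_circle :: "circle measure" where
  "unif_circle = distr unif_interval borel to_circle"

lemma prob_space_unif_interval: "prob_space unif_interval"
  by (rule prob_spaceI)
    (simp add: unif_interval_def space_restrict_space emeasure_restrict_space)

lemma prob_space_unif_circle: "prob_space unif_circle"
proof -
  have "to_circle \<in> measurable unif_interval borel"
    unfolding unif_interval_def by (rule measurable_restrict_space1) simp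
  then show ?thesis
    unfolding unif_circle_def
    by (rule prob_space.prob_space_distr[OF prob_space_unif_interval])
qed

lift_definition circle_char :: "int \<Rightarrow> circle \<Rightarrow> complex"
  is "\<lambda>k x. exp (- 2 * complex_of_real pi * \<i> * of_int k * complex_of_real x)"
proof -
  fix k :: int and x y :: real
  assume "x - y \<in> \<int>"
  then obtain m where "x - y = of_int m"
    by (elim Ints_cases)
  then have x: "x = y + of_int m"
    by simp
  have "- 2 * complex_of_real pi * \<i> * of_int k * complex_of_real x
      = - 2 * complex_of_real pi * \<i> * of_int k * complex_of_real y
        + complex_of_real (real_of_int (2 * (- k * m)) * pi) * \<i>"
    by (simp add: x algebra_simps)
  then show "exp (- 2 * complex_of_real pi * \<i> * of_int k * complex_of_real x)
      = exp (- 2 * complex_of_real pi * \<i> * of_int k * complex_of_real y)"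
    unfolding exp_eq by blast
qed

definition fourier_circle :: "circle measure \<Rightarrow> int \<Rightarrow> complex" where
  "fourier_circle \<mu> k = (LINT z|\<mu>. circle_char k z)"

definition fourier_interval :: "real measure \<Rightarrow> int \<Rightarrow> complex" where
  "fourier_interval \<mu> k =
    (LINT x|\<mu>. exp (- 2 * complex_of_real pi * \<i> * of_int k * complex_of_real x))"

definition discrepancy :: "real measure \<Rightarrow> real \<Rightarrow> real" where
  "discrepancy \<mu> x = measure \<mu> {0..<x} - x"

definition mean_discrepancy :: "real measure \<Rightarrow> real" where
  "mean_discrepancy \<mu> = (LINT x|unif_interval. discrepancy \<mu> x)"

subsection \<open>Weak derivatives\<close>

definition smooth :: "(real \<Rightarrow> real) \<Rightarrow> bool" where
  "smooth \<phi> \<longleftrightarrow> (\<forall>n x. (deriv ^^ n) \<phi> field_differentiable at x)"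

text \<open>On the interval, test functions are smooth with compact support in (0,1), and weakly
  differentiable functions and their weak derivatives are locally integrable there.\<close>

definition weak_deriv_interval :: "(real \<Rightarrow> real) \<Rightarrow> (real \<Rightarrow> real) \<Rightarrow> bool" where
  "weak_deriv_interval f f' \<longleftrightarrow>
    (\<forall>a b. 0 < a \<and> b < 1 \<longrightarrow>
       set_integrable lborel {a..b} f \<and> set_integrable lborel {a..b} f') \<and>
    (\<forall>\<phi>. smooth \<phi> \<and> (\<exists>a b. 0 < a \<and> b < 1 \<and> (\<forall>x. x \<notin> {a..b} \<longrightarrow> \<phi> x = 0)) \<longrightarrow>
       (LINT x|unif_interval. f x * deriv \<phi> x) = - (LINT x|unif_interval. f' x * \<phi> x))"

text \<open>The circle is compact, so there all smooth functions are test functions. Smoothness and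
  derivatives of functions on the circle are those of their 1-periodic lifts to the line.\<close>

definition weak_deriv_circle :: "(circle \<Rightarrow> real) \<Rightarrow> (circle \<Rightarrow> real) \<Rightarrow> bool" where
  "weak_deriv_circle f f' \<longleftrightarrow>
    integrable unif_circle f \<and> integrable unif_circle f' \<and>
    (\<forall>\<phi> \<phi>'. smooth (\<phi> \<circ> to_circle) \<and> \<phi>' \<circ> to_circle = deriv (\<phi> \<circ> to_circle) \<longrightarrow>
       (LINT z|unif_circle. f z * \<phi>' z) = - (LINT z|unif_circle. f' z * \<phi> z))"

subsection \<open>Norms\<close>

text \<open>The \<open>L\<^sup>q\<close> norm for q in [1,\<open>\<infinity>\<close>]; the inner case distinction extends the real power
  to an infinite integral.\<close>

definition Lq_norm :: "'a measure \<Rightarrow> ennreal \<Rightarrow> ('a \<Rightarrow> real) \<Rightarrow> ennreal" where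
  "Lq_norm M q g =
    (if q = \<infinity> then esssup M (\<lambda>x. ennreal \<bar>g x\<bar>)
     else let J = (\<integral>\<^sup>+x. ennreal (\<bar>g x\<bar> powr enn2real q) \<partial>M)
          in if J = \<infinity> then \<infinity> else ennreal (enn2real J powr (1 / enn2real q)))"

definition holder_conjugate :: "ennreal \<Rightarrow> ennreal \<Rightarrow> bool" where
  "holder_conjugate p q \<longleftrightarrow> 1 \<le> p \<and> 1 \<le> q \<and> 1 / p + 1 / q = 1"

text \<open>In the suprema, f is the continuous representative. Such an f is bounded, so that all
  integrals exist; the suprema are taken in the extended reals.\<close>

definition neg_sobolev_circle :: "ennreal \<Rightarrow> circle measure \<Rightarrow> ereal" where
  "neg_sobolev_circle p \<mu> =
    (SUP f\<in>{f. continuous_on UNIV f \<and>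
              (\<exists>q f'. holder_conjugate p q \<and> weak_deriv_circle f f' \<and>
                      Lq_norm unif_circle q f' \<le> 1)}.
      ereal ((LINT z|\<mu>. f z) - (LINT z|unif_circle. f z)))"

definition neg_sobolev_interval :: "ennreal \<Rightarrow> real measure \<Rightarrow> ereal" where
  "neg_sobolev_interval p \<mu> =
    (SUP f\<in>{f. continuous_on {0..<1} f \<and>
              (\<exists>q f'. holder_conjugate p q \<and> weak_deriv_interval f f' \<and>
                      Lq_norm unif_interval q f' \<le> 1)}.
      ereal ((LINT x|\<mu>. f x) - (LINT x|unif_interval. f x)))"

end

(*
  Integrating by parts, the integral of f against mu - lambda is minus the integral of f' D, so by
  Hoelder everything reduces to bounding the L^p norm of D minus its mean, where D is the
  discrepancy function and mu^(k) = 2 pi i k D^(k).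

  D is not close to its Fejer means in L^p for large p (mu may have atoms), but D(x + h) >= D(x) - h.
  Hence D(x) is at most the Fejer mean at a point shifted to the right by a multiple of 1/n, plus
  O(1/n), plus the contribution of the tail of the kernel, which is a small multiple of the L^p norm
  of D and is absorbed; the lower bound follows by reflection. The Fejer mean is a trigonometric
  polynomial of degree < n, whose L^p norm is controlled by the Hausdorff-Young inequality.

  All of this is carried out for averages of D over the cells of a grid of step 1/N, so that the
  harmonic analysis takes place on Z/N, and Riesz-Thorin only needs the three lines theorem for
  finite exponential sums. Letting N tend to infinity gives the bound for D; p = infinity is
  obtained on the grid by letting p tend to infinity. On the circle f' has mean 0, which removes
  the mean of D.
*)
theory Submission
  imports Defs "HOL-Complex_Analysis.Complex_Analysis"
begin

subsection \<open>Riesz-Thorin interpolation for finite sums\<close>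

text \<open>The constant has to be the same for every p, so inequalities are kept between p-th
  powers with factors of the form c^p, which cost only c once the root is taken: sums are split
  crudely by maxima (3^p) and recombined by superadditivity of t^p. The absorption must win in this
  form. The window is therefore so wide that the kernel has mass at most 1/12 outside it: 3^p
  (1/12)^p = (1/4)^p is, for p \<ge> 2, at most a quarter of the (1/2)^p that stands on the left.

  Cell averages suit the argument because the bound on the fall of D survives averaging, with 1/N
  per cell, and because it also gives the way back: D at a point lies, up to 2/N, between the
  averages over the previous and the next cell. With N fixed, a single value costs only the factor
  N^(1/p) against the p-th mean, and this tends to 1 as p grows; hence p tends to infinity before N
  does.

  The test function f enters only as a primitive of f', a fact that first has to be extracted from
  the definition of weak derivatives by test functions.\<close>

lemma three_lines_entire_bounded:
  fixes F :: "complex \<Rightarrow> complex"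
  assumes hol: "F holomorphic_on UNIV"
    and bound: "\<And>z. 0 \<le> Re z \<Longrightarrow> Re z \<le> 1 \<Longrightarrow> cmod (F z) \<le> B"
    and left: "\<And>z. Re z = 0 \<Longrightarrow> cmod (F z) \<le> 1"
    and right: "\<And>z. Re z = 1 \<Longrightarrow> cmod (F z) \<le> 1"
    and t: "0 \<le> t" "t \<le> 1"
  shows "cmod (F (of_real t)) \<le> 1"
proof -
  \<comment> \<open>The factor exp(\<delta> (z^2 - 1)) has modulus at most 1 on the strip and decays
    as |Im z| grows, so the maximum principle on a tall rectangle applies; letting \<delta> tend to
    0 removes the factor.\<close>
  have damped: "cmod (F (of_real t)) * exp (\<delta> * (t\<^sup>2 - 1)) \<le> 1" if "\<delta> > 0" for \<delta>
  proof -
    define G where "G = (\<lambda>z. F z * exp (of_real \<delta> * (z\<^sup>2 - 1)))"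
    have cG: "cmod (G z) = cmod (F z) * exp (\<delta> * ((Re z)\<^sup>2 - (Im z)\<^sup>2 - 1))" for z
      by (simp add: G_def norm_mult Re_power2)
    \<comment> \<open>This height makes \<delta> R^2 at least |B|, so on the horizontal sides the
      damping exp(-|B|) beats the bound B, because |B| \<le> exp |B|.\<close>
    define R where "R = 1 + \<bar>B\<bar> / \<delta>"
    have R: "R \<ge> 1" "\<bar>B\<bar> \<le> \<delta> * R\<^sup>2"
    proof -
      show "R \<ge> 1" using that by (simp add: R_def)
      then have "\<delta> * R \<le> \<delta> * R\<^sup>2"
        using that by (simp add: power2_eq_square)
      moreover have "\<bar>B\<bar> \<le> \<delta> * R" using that by (simp add: R_def field_simps)
      ultimately show "\<bar>B\<bar> \<le> \<delta> * R\<^sup>2" by linarith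
    qed
    define S where "S = cbox (Complex 0 (-R)) (Complex 1 R)"
    have S: "z \<in> S \<longleftrightarrow> 0 \<le> Re z \<and> Re z \<le> 1 \<and> -R \<le> Im z \<and> Im z \<le> R" for z
      by (simp add: S_def in_cbox_complex_iff)
    have intS: "interior S = box (Complex 0 (-R)) (Complex 1 R)"
      unfolding S_def by (rule interior_cbox)
    have "cmod (G (of_real t)) \<le> 1"
    proof (rule maximum_modulus_frontier[of G S])
      show "G holomorphic_on interior S"
        unfolding G_def by (intro holomorphic_intros holomorphic_on_subset[OF hol]) auto
      show "continuous_on (closure S) G"
        unfolding G_def
        by (intro holomorphic_on_imp_continuous_on holomorphic_intros holomorphic_on_subset[OF hol]) auto
      show "bounded S" by (simp add: S_def)
      show "of_real t \<in> S" using t R by (simp add: S)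
      show "cmod (G z) \<le> 1" if z: "z \<in> frontier S" for z
      proof -
        have "closed S" unfolding S_def by (rule closed_cbox)
        then have "z \<in> S" "z \<notin> box (Complex 0 (-R)) (Complex 1 R)"
          using z intS by (auto simp: frontier_def)
        then have zS: "0 \<le> Re z" "Re z \<le> 1" "-R \<le> Im z" "Im z \<le> R"
          and "Re z = 0 \<or> Re z = 1 \<or> \<bar>Im z\<bar> = R"
          by (auto simp: S in_box_complex_iff)
        then consider "Re z = 0 \<or> Re z = 1" | "\<bar>Im z\<bar> = R" by blast
        then show ?thesis
        proof cases
          case 1
          then have "cmod (F z) \<le> 1" using left right by blast
          moreover have "(Re z)\<^sup>2 - (Im z)\<^sup>2 - 1 \<le> 0"
            using zero_le_power2[of "Im z"] power_le_one[OF zS(1,2), of 2] by linarith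
          then have "exp (\<delta> * ((Re z)\<^sup>2 - (Im z)\<^sup>2 - 1)) \<le> 1"
            using \<open>\<delta> > 0\<close> by (simp add: mult_nonneg_nonpos)
          ultimately show ?thesis unfolding cG by (simp add: mult_le_one)
        next
          case 2
          then have im: "(Im z)\<^sup>2 = R\<^sup>2" by (metis power2_abs)
          have "(Re z)\<^sup>2 \<le> 1" using zS by (simp add: power_le_one)
          then have "\<delta> * ((Re z)\<^sup>2 - (Im z)\<^sup>2 - 1) \<le> \<delta> * (- R\<^sup>2)"
            using \<open>\<delta> > 0\<close> im by (intro mult_left_mono) auto
          also have "\<dots> \<le> - \<bar>B\<bar>" using R by simp
          finally have e: "exp (\<delta> * ((Re z)\<^sup>2 - (Im z)\<^sup>2 - 1)) \<le> exp (- \<bar>B\<bar>)" by simp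
          have "cmod (G z) \<le> \<bar>B\<bar> * exp (- \<bar>B\<bar>)"
            unfolding cG using bound[OF zS(1,2)] by (intro mult_mono e) auto
          also have "\<dots> \<le> exp \<bar>B\<bar> * exp (- \<bar>B\<bar>)"
            using exp_ge_add_one_self[of "\<bar>B\<bar>"] by (intro mult_right_mono) (linarith, simp)
          also have "\<dots> = 1" by (simp flip: exp_add)
          finally show ?thesis .
        qed
      qed
    qed
    then show ?thesis by (simp add: cG)
  qed
  have "((\<lambda>\<delta>. cmod (F (of_real t)) * exp (\<delta> * (t\<^sup>2 - 1))) \<longlongrightarrow>
      cmod (F (of_real t)) * exp (0 * (t\<^sup>2 - 1))) (at_right 0)"
    by (intro tendsto_intros)
  then have "((\<lambda>\<delta>. cmod (F (of_real t)) * exp (\<delta> * (t\<^sup>2 - 1))) \<longlongrightarrow>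
      cmod (F (of_real t))) (at_right 0)"
    by simp
  then show ?thesis
    by (rule tendsto_upperbound)
      (auto simp: eventually_at_right_field intro!: exI[of _ 1] damped)
qed

text \<open>The hypotheses \<open>u\<close> and \<open>l2\<close> are the endpoints (1,\<open>\<infinity>\<close>) and (2,2) of the interpolation; the
  given vectors are the members of the analytic families \<open>X\<close>, \<open>Y\<close> at \<open>\<theta> = 2 - 2 / q\<close>.\<close>

lemma riesz_thorin_bilinear:
  fixes u :: "'j \<Rightarrow> 'k \<Rightarrow> complex" and q :: real
  assumes u: "\<And>j k. j \<in> J \<Longrightarrow> k \<in> K \<Longrightarrow> cmod (u j k) \<le> 1"
    and N: "N > 0"
    and l2: "\<And>x. (\<Sum>j\<in>J. (cmod (\<Sum>k\<in>K. u j k * x k))\<^sup>2) \<le> N * (\<Sum>k\<in>K. (cmod (x k))\<^sup>2)"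
    and q: "1 \<le> q" "q \<le> 2"
    and x: "(\<Sum>k\<in>K. cmod (x k) powr q) \<le> 1"
    and y: "(\<Sum>j\<in>J. cmod (y j) powr q) \<le> N"
  shows "cmod (\<Sum>j\<in>J. \<Sum>k\<in>K. u j k * x k * y j) \<le> N"
proof -
  \<comment> \<open>The modulus of \<open>X z k\<close> is |x k| to the power q (1 - Re z / 2): the
    power q on the line Re z = 0, where the l^1 norm is needed, and q / 2 on Re z = 1, where the l^2
    norm is. Zero entries are kept apart because of the logarithm; every entry is entire in
    z.\<close>
  define X where "X = (\<lambda>z k. if x k = 0 then 0 else
     sgn (x k) * exp (of_real (q * ln (cmod (x k))) * (1 - z / 2)))"
  define Y where "Y = (\<lambda>z j. if y j = 0 then 0 else
     sgn (y j) * exp (of_real (q * ln (cmod (y j))) * (1 - z / 2)))"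
  have normX: "cmod (X z k) = cmod (x k) powr (q * (1 - Re z / 2))" for z k
    by (simp add: X_def norm_mult norm_sgn powr_def mult_ac)
  have normY: "cmod (Y z j) = cmod (y j) powr (q * (1 - Re z / 2))" for z j
    by (simp add: Y_def norm_mult norm_sgn powr_def mult_ac)
  define \<theta> where "\<theta> = 2 - 2 / q"
  have \<theta>: "0 \<le> \<theta>" "\<theta> \<le> 1" "q * (1 - \<theta> / 2) = 1"
    using q by (auto simp: \<theta>_def field_simps)
  have eX: "X (of_real \<theta>) k = x k" for k
  proof (cases "x k = 0")
    case False
    have "of_real (q * ln (cmod (x k))) * (1 - of_real \<theta> / 2)
       = complex_of_real ((q * (1 - \<theta> / 2)) * ln (cmod (x k)))"
      by (simp add: algebra_simps)
    also have "\<dots> = of_real (ln (cmod (x k)))" by (simp only: \<theta> mult_1)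
    finally show ?thesis using False
      unfolding X_def by (simp only: if_False exp_of_real) (simp add: sgn_div_norm scaleR_conv_of_real)
  qed (simp add: X_def)
  have eY: "Y (of_real \<theta>) j = y j" for j
  proof (cases "y j = 0")
    case False
    have "of_real (q * ln (cmod (y j))) * (1 - of_real \<theta> / 2)
       = complex_of_real ((q * (1 - \<theta> / 2)) * ln (cmod (y j)))"
      by (simp add: algebra_simps)
    also have "\<dots> = of_real (ln (cmod (y j)))" by (simp only: \<theta> mult_1)
    finally show ?thesis using False
      unfolding Y_def by (simp only: if_False exp_of_real) (simp add: sgn_div_norm scaleR_conv_of_real)
  qed (simp add: Y_def)
  define F where "F = (\<lambda>z. (\<Sum>j\<in>J. \<Sum>k\<in>K. u j k * X z k * Y z j) / of_real N)"
  have "cmod (F (of_real \<theta>)) \<le> 1"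
  \<comment> \<open>Any bound on the strip will do. Replacing |x| by 1 + |x| \<ge> 1 makes the power
    monotone in the exponent, which varies between q / 2 and q.\<close>
  proof (rule three_lines_entire_bounded[where B = "(\<Sum>j\<in>J. \<Sum>k\<in>K. cmod (u j k) *
        (1 + cmod (x k)) powr q * (1 + cmod (y j)) powr q) / N"])
    have "(\<lambda>z. X z k) holomorphic_on UNIV" for k
      unfolding X_def by (cases "x k = 0") (auto intro!: holomorphic_intros)
    moreover have "(\<lambda>z. Y z j) holomorphic_on UNIV" for j
      unfolding Y_def by (cases "y j = 0") (auto intro!: holomorphic_intros)
    ultimately show "F holomorphic_on UNIV"
      unfolding F_def using N by (intro holomorphic_intros) auto
  next
    fix z :: complex assume z: "0 \<le> Re z" "Re z \<le> 1"
    have le: "a powr (q * (1 - Re z / 2)) \<le> (1 + a) powr q" if "0 \<le> a" for a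
    proof -
      have e: "0 \<le> q * (1 - Re z / 2)" "q * (1 - Re z / 2) \<le> q"
        using z q by (auto simp: field_simps)
      have "a powr (q * (1 - Re z / 2)) \<le> (1 + a) powr (q * (1 - Re z / 2))"
        using that e by (intro powr_mono2) auto
      also have "\<dots> \<le> (1 + a) powr q" using that e by (intro powr_mono) auto
      finally show ?thesis .
    qed
    have "cmod (\<Sum>j\<in>J. \<Sum>k\<in>K. u j k * X z k * Y z j)
       \<le> (\<Sum>j\<in>J. \<Sum>k\<in>K. cmod (u j k * X z k * Y z j))"
      by (rule order.trans[OF norm_sum]) (intro sum_mono norm_sum)
    also have "\<dots> \<le> (\<Sum>j\<in>J. \<Sum>k\<in>K. cmod (u j k) *
        (1 + cmod (x k)) powr q * (1 + cmod (y j)) powr q)"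
      unfolding norm_mult normX normY by (intro sum_mono mult_mono le) auto
    finally show "cmod (F z) \<le> (\<Sum>j\<in>J. \<Sum>k\<in>K. cmod (u j k) *
        (1 + cmod (x k)) powr q * (1 + cmod (y j)) powr q) / N"
      using N by (simp add: F_def norm_divide divide_right_mono)
  next
    fix z :: complex assume z: "Re z = 0"
    have "cmod (\<Sum>j\<in>J. \<Sum>k\<in>K. u j k * X z k * Y z j)
       \<le> (\<Sum>j\<in>J. \<Sum>k\<in>K. cmod (u j k * X z k * Y z j))"
      by (rule order.trans[OF norm_sum]) (intro sum_mono norm_sum)
    also have "\<dots> \<le> (\<Sum>j\<in>J. \<Sum>k\<in>K. 1 * cmod (x k) powr q * cmod (y j) powr q)"
      unfolding norm_mult normX normY z using u by (intro sum_mono mult_mono) auto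
    also have "\<dots> = (\<Sum>k\<in>K. cmod (x k) powr q) * (\<Sum>j\<in>J. cmod (y j) powr q)"
      by (subst sum.swap) (simp add: sum_product)
    also have "\<dots> \<le> 1 * N"
      using N by (intro mult_mono x y sum_nonneg) auto
    finally show "cmod (F z) \<le> 1" using N by (simp add: F_def norm_divide)
  next
    fix z :: complex assume z: "Re z = 1"
    have sq: "(a powr (q * (1 - Re z / 2)))\<^sup>2 = a powr q" if "a \<ge> 0" for a
      using that by (simp add: z power2_eq_square flip: powr_add)
    \<comment> \<open>The squares of |X| and |Y| are now |x|^q and |y|^q. Cauchy-Schwarz over j
      followed by \<open>l2\<close> bounds the square of the form by (N * 1) * N.\<close>
    have "cmod (\<Sum>j\<in>J. \<Sum>k\<in>K. u j k * X z k * Y z j)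
       = cmod (\<Sum>j\<in>J. (\<Sum>k\<in>K. u j k * X z k) * Y z j)"
      by (simp add: sum_distrib_right)
    also have "\<dots> \<le> (\<Sum>j\<in>J. cmod (\<Sum>k\<in>K. u j k * X z k) * cmod (Y z j))"
      by (rule order.trans[OF norm_sum]) (simp add: norm_mult)
    finally have "(cmod (\<Sum>j\<in>J. \<Sum>k\<in>K. u j k * X z k * Y z j))\<^sup>2
        \<le> (\<Sum>j\<in>J. cmod (\<Sum>k\<in>K. u j k * X z k) * cmod (Y z j))\<^sup>2"
      by (intro power_mono) auto
    also have "\<dots> \<le> (\<Sum>j\<in>J. (cmod (\<Sum>k\<in>K. u j k * X z k))\<^sup>2) * (\<Sum>j\<in>J. (cmod (Y z j))\<^sup>2)"
      by (rule Cauchy_Schwarz_ineq_sum)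
    also have "\<dots> \<le> (N * (\<Sum>k\<in>K. (cmod (X z k))\<^sup>2)) * (\<Sum>j\<in>J. (cmod (Y z j))\<^sup>2)"
      by (intro mult_right_mono l2 sum_nonneg) auto
    also have "\<dots> = (N * (\<Sum>k\<in>K. cmod (x k) powr q)) * (\<Sum>j\<in>J. cmod (y j) powr q)"
      by (simp add: normX normY sq)
    also have "\<dots> \<le> (N * 1) * N"
      using N by (intro mult_mono mult_left_mono x y sum_nonneg mult_nonneg_nonneg) auto
    finally have "cmod (\<Sum>j\<in>J. \<Sum>k\<in>K. u j k * X z k * Y z j) \<le> N"
      using N by (simp add: power2_le_imp_le power2_eq_square[of N])
    then show "cmod (F z) \<le> 1" using N by (simp add: F_def norm_divide)
  qed (use \<theta> in auto)
  then show ?thesis using N by (simp add: F_def norm_divide eX eY)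
qed

lemma conjugate_exponent:
  fixes p q :: real
  assumes "2 \<le> p" "1 / p + 1 / q = 1"
  shows "q = p / (p - 1)" "1 < q" "q \<le> 2"
proof -
  have "1 / q = (p - 1) / p" using assms by (simp add: field_simps)
  then show qq: "q = p / (p - 1)" by (metis inverse_divide inverse_eq_divide inverse_inverse_eq)
  show "1 < q" "q \<le> 2" unfolding qq using assms(1) by (simp_all add: field_simps)
qed

text \<open>Duality: the bilinear bound is tested against the vector that is extremal in Hoelder's
  inequality for f. On J the sum is divided by N, so that the operator has norm at most 1 at both
  endpoints and no constant appears.\<close>

lemma riesz_thorin_finite:
  fixes u :: "'j \<Rightarrow> 'k \<Rightarrow> complex" and p q :: real
  assumes fin: "finite K"
    and u: "\<And>j k. j \<in> J \<Longrightarrow> k \<in> K \<Longrightarrow> cmod (u j k) \<le> 1"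
    and N: "N > 0"
    and l2: "\<And>x. (\<Sum>j\<in>J. (cmod (\<Sum>k\<in>K. u j k * x k))\<^sup>2) \<le> N * (\<Sum>k\<in>K. (cmod (x k))\<^sup>2)"
    and p: "2 \<le> p" "1 / p + 1 / q = 1"
  shows "(\<Sum>j\<in>J. cmod (\<Sum>k\<in>K. u j k * c k) powr p) / N
      \<le> ((\<Sum>k\<in>K. cmod (c k) powr q) powr (1 / q)) powr p"
proof -
  define f where "f = (\<lambda>j. \<Sum>k\<in>K. u j k * c k)"
  define A where "A = (\<Sum>j\<in>J. cmod (f j) powr p) / N"
  define S where "S = (\<Sum>k\<in>K. cmod (c k) powr q) powr (1 / q)"
  have q: "1 < q" "q \<le> 2" "q = p / (p - 1)"
    using conjugate_exponent[OF p] by auto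
  have A0: "A \<ge> 0" using N by (simp add: A_def sum_nonneg)
  have "A \<le> S powr p"
  proof (cases "A = 0 \<or> S = 0")
    case True
    then show ?thesis
    proof
      assume "S = 0"
      then have "(\<Sum>k\<in>K. cmod (c k) powr q) = 0" by (simp add: S_def)
      then have "\<forall>k\<in>K. c k = 0" using fin by (simp add: sum_nonneg_eq_0_iff)
      then show ?thesis by (simp add: A_def f_def)
    qed simp
  next
    case False
    then have AS: "A > 0" "S > 0" using A0 by (auto simp: S_def)
    \<comment> \<open>Since (p - 1) q = p, the q-th powers of these entries sum to exactly N, while
      pairing with f gives N A^(1 - 1/q) = N A^(1/p).\<close>
    define y where "y = (\<lambda>j. of_real (cmod (f j) powr (p - 2) / A powr (1 / q)) * cnj (f j))"
    have ny: "cmod (y j) = cmod (f j) powr (p - 1) / A powr (1 / q)" for j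
    proof (cases "f j = 0")
      case False
      have "cmod (f j) powr (p - 1) = cmod (f j) powr (p - 2) * cmod (f j) powr 1"
        by (subst powr_add[symmetric]) simp
      then show ?thesis using False by (simp add: y_def norm_mult norm_divide)
    qed (simp add: y_def)
    have pq: "(p - 1) * q = p" using q p by (simp add: field_simps)
    have "cmod (\<Sum>j\<in>J. \<Sum>k\<in>K. u j k * (c k / of_real S) * y j) \<le> N"
    proof (rule riesz_thorin_bilinear[OF u N l2])
      have "(\<Sum>k\<in>K. cmod (c k / of_real S) powr q) = (\<Sum>k\<in>K. cmod (c k) powr q) / S powr q"
        using AS by (simp add: norm_divide powr_divide sum_divide_distrib)
      also have "S powr q = (\<Sum>k\<in>K. cmod (c k) powr q)"
        using q(1) by (simp add: S_def powr_powr sum_nonneg)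
      finally show "(\<Sum>k\<in>K. cmod (c k / of_real S) powr q) \<le> 1" by simp
      have "(\<Sum>j\<in>J. cmod (y j) powr q) = (\<Sum>j\<in>J. cmod (f j) powr p) / A"
        using AS q(1) by (simp add: ny powr_divide powr_powr pq sum_divide_distrib)
      also have "(\<Sum>j\<in>J. cmod (f j) powr p) / A = N"
      proof -
        have "(\<Sum>j\<in>J. cmod (f j) powr p) = N * A" using N by (simp add: A_def)
        then show ?thesis using AS by simp
      qed
      finally show "(\<Sum>j\<in>J. cmod (y j) powr q) \<le> N" by simp
    qed (use q in auto)
    also have "(\<Sum>j\<in>J. \<Sum>k\<in>K. u j k * (c k / of_real S) * y j) = (\<Sum>j\<in>J. f j * y j) / of_real S"
      by (simp add: f_def sum_distrib_right sum_divide_distrib)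
    also have "(\<Sum>j\<in>J. f j * y j) = of_real ((\<Sum>j\<in>J. cmod (f j) powr p) / A powr (1 / q))"
    proof -
      have "f j * y j = of_real (cmod (f j) powr p / A powr (1 / q))" for j
      proof (cases "f j = 0")
        case False
        have "cmod (f j) powr p = cmod (f j) powr (p - 2) * cmod (f j) powr 2"
          by (subst powr_add[symmetric]) simp
        moreover have "f j * cnj (f j) = of_real (cmod (f j) powr 2)"
          using complex_norm_square[of "f j"] by (simp add: powr_numeral)
        ultimately show ?thesis by (simp add: y_def mult_ac)
      qed (simp add: y_def)
      then show ?thesis by (simp add: sum_divide_distrib)
    qed
    also have "(\<Sum>j\<in>J. cmod (f j) powr p) = N * A" using N by (simp add: A_def)
    finally have "N * A / A powr (1 / q) / S \<le> N"
      using AS N by (simp add: norm_divide norm_mult)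
    then have "A powr 1 / A powr (1 / q) \<le> S" using AS N by (simp add: field_simps)
    have "A powr (1 / p) \<le> S"
    proof -
      have "1 / p = 1 - 1 / q" using p by simp
      moreover have "A powr (1 - 1 / q) = A powr 1 / A powr (1 / q)" by (rule powr_diff)
      ultimately show ?thesis using \<open>A powr 1 / A powr (1 / q) \<le> S\<close> by metis
    qed
    then have "(A powr (1 / p)) powr p \<le> S powr p" using p by (intro powr_mono2) auto
    then show ?thesis using AS p by (simp add: powr_powr)
  qed
  then show ?thesis by (simp add: A_def S_def f_def)
qed

subsection \<open>Fourier analysis on Z/N\<close>

definition unity_root :: "nat \<Rightarrow> int \<Rightarrow> complex" where
  "unity_root N k = cis (2 * pi * of_int k / real N)"

lemma unity_root_0 [simp]: "unity_root N 0 = 1"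
  by (simp add: unity_root_def)

lemma unity_root_add: "unity_root N (a + b) = unity_root N a * unity_root N b"
  by (simp add: unity_root_def cis_mult algebra_simps add_divide_distrib)

lemma unity_root_minus: "unity_root N (- a) = cnj (unity_root N a)"
  by (simp add: unity_root_def cis_cnj)

lemma unity_root_diff: "unity_root N (a - b) = unity_root N a * cnj (unity_root N b)"
  using unity_root_add[of N a "-b"] by (simp add: unity_root_minus)

lemma cmod_unity_root [simp]: "cmod (unity_root N k) = 1"
  by (simp add: unity_root_def)

lemma unity_root_power: "unity_root N (int j * k) = unity_root N k ^ j"
  by (induction j) (simp_all add: distrib_right unity_root_add)

lemma unity_root_multiple [simp]: "N > 0 \<Longrightarrow> unity_root N (int N * k) = 1"
  using cis_multiple_2pi[of "of_int k"] by (simp add: unity_root_def mult.assoc)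

lemma unity_root_mod: "N > 0 \<Longrightarrow> unity_root N (k * (j mod int N)) = unity_root N (k * j)"
proof -
  assume N: "N > 0"
  have "k * j = k * (j mod int N) + int N * (k * (j div int N))"
    by (metis distrib_left mod_mult_div_eq mult.left_commute)
  then show ?thesis by (simp add: unity_root_add N)
qed

lemma unity_root_eq_1: "N > 0 \<Longrightarrow> unity_root N k = 1 \<Longrightarrow> int N dvd k"
proof -
  assume N: "N > 0" and "unity_root N k = 1"
  then have "cos (2 * pi * of_int k / real N) = 1"
    by (metis cis.simps(1) one_complex.simps(1) unity_root_def)
  then obtain m :: int where "2 * pi * of_int k / real N = of_int m * 2 * pi"
    by (auto simp: cos_one_2pi_int)
  then have "of_int k = real_of_int (m * int N)"
    using N by (simp add: field_simps)
  then show "int N dvd k" by (metis dvd_triv_right of_int_eq_iff)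
qed

lemma sum_unity_root:
  assumes "N > 0"
  shows "(\<Sum>j<N. unity_root N (int j * k)) = (if int N dvd k then of_nat N else 0)"
proof (cases "int N dvd k")
  case True
  then obtain m where "k = int N * m" by (elim dvdE)
  then have "int j * k = int N * (int j * m)" for j by simp
  then have "unity_root N (int j * k) = 1" for j
    using assms by (simp only: unity_root_multiple)
  then show ?thesis using True by simp
next
  case False
  then have ne: "unity_root N k \<noteq> 1" using unity_root_eq_1 assms by blast
  have "unity_root N k ^ N = 1"
    using assms by (simp flip: unity_root_power)
  then show ?thesis using False
    by (simp add: unity_root_power geometric_sum[OF ne])
qed

lemma sum_atLeast0LessThan_int:
  "(\<Sum>j\<in>{0..<int N}. f j) = (\<Sum>j<N. f (int j))"
  by (rule sum.reindex_bij_witness[of _ int nat]) auto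

text \<open>Periodicity is phrased as invariance under \<open>mod\<close>, so the shifted index can
  be reduced at once, and the shift then permutes the residues.\<close>

lemma sum_periodic_shift:
  fixes g :: "int \<Rightarrow> 'a::comm_monoid_add"
  assumes "N > 0" "\<And>j. g (j mod int N) = g j"
  shows "(\<Sum>j\<in>{0..<int N}. g (j + s)) = (\<Sum>j\<in>{0..<int N}. g j)"
proof -
  have "(\<Sum>j\<in>{0..<int N}. g (j + s)) = (\<Sum>j\<in>{0..<int N}. g ((j + s) mod int N))"
    by (simp add: assms)
  also have "\<dots> = (\<Sum>j\<in>{0..<int N}. g j)"
    using \<open>N > 0\<close>
    by (intro sum.reindex_bij_witness[of _ "\<lambda>j. (j - s) mod int N" "\<lambda>j. (j + s) mod int N"])
      (auto simp: mod_simps)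
  finally show ?thesis .
qed

lemma sum_periodic_reflect:
  fixes g :: "int \<Rightarrow> 'a::comm_monoid_add"
  assumes "N > 0" "\<And>j. g (j mod int N) = g j"
  shows "(\<Sum>j\<in>{0..<int N}. g (s - j)) = (\<Sum>j\<in>{0..<int N}. g j)"
proof -
  have "(\<Sum>j\<in>{0..<int N}. g (s - j)) = (\<Sum>j\<in>{0..<int N}. g ((s - j) mod int N))"
    by (simp add: assms)
  also have "\<dots> = (\<Sum>j\<in>{0..<int N}. g j)"
    using \<open>N > 0\<close>
    by (intro sum.reindex_bij_witness[of _ "\<lambda>j. (s - j) mod int N" "\<lambda>j. (s - j) mod int N"])
      (auto simp: mod_simps)
  finally show ?thesis .
qed

text \<open>The endpoint (2,2) is Parseval on Z/N: by orthogonality of the characters only k = l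
  survives, because the frequencies in K are distinct modulo N. They are integers rather than
  residues so that K can be a range symmetric about 0.\<close>

lemma discrete_hausdorff_young:
  fixes c :: "int \<Rightarrow> complex"
  assumes N: "N > 0" and K: "finite K" "\<And>k l. k \<in> K \<Longrightarrow> l \<in> K \<Longrightarrow> int N dvd k - l \<Longrightarrow> k = l"
    and p: "2 \<le> p" "1 / p + 1 / q = 1"
  shows "(\<Sum>j<N. cmod (\<Sum>k\<in>K. unity_root N (int j * k) * c k) powr p) / real N
      \<le> ((\<Sum>k\<in>K. cmod (c k) powr q) powr (1 / q)) powr p"
proof (rule riesz_thorin_finite[OF K(1) _ _ _ p])
  fix x :: "int \<Rightarrow> complex"
  have "complex_of_real (\<Sum>j<N. (cmod (\<Sum>k\<in>K. unity_root N (int j * k) * x k))\<^sup>2)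
     = (\<Sum>j<N. \<Sum>k\<in>K. \<Sum>l\<in>K. unity_root N (int j * (k - l)) * (x k * cnj (x l)))"
    by (simp add: complex_norm_square sum_product right_diff_distrib unity_root_diff
        mult_ac del: of_real_power)
  also have "\<dots> = (\<Sum>k\<in>K. \<Sum>l\<in>K. \<Sum>j<N. unity_root N (int j * (k - l)) * (x k * cnj (x l)))"
    by (subst sum.swap) (intro sum.cong refl sum.swap)
  also have "\<dots> = (\<Sum>k\<in>K. \<Sum>l\<in>K. (if l = k then of_nat N * (x k * cnj (x l)) else 0))"
    unfolding sum_distrib_right[symmetric] sum_unity_root[OF N]
    using K(2) by (intro sum.cong refl) auto
  also have "\<dots> = (\<Sum>k\<in>K. of_nat N * (x k * cnj (x k)))"
    using K(1) by (intro sum.cong refl) (simp add: sum.delta)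
  also have "\<dots> = complex_of_real (real N * (\<Sum>k\<in>K. (cmod (x k))\<^sup>2))"
    by (simp add: sum_distrib_left complex_norm_square del: of_real_power)
  finally have "(\<Sum>j<N. (cmod (\<Sum>k\<in>K. unity_root N (int j * k) * x k))\<^sup>2)
      = real N * (\<Sum>k\<in>K. (cmod (x k))\<^sup>2)"
    by (simp only: of_real_eq_iff)
  then show "(\<Sum>j<N. (cmod (\<Sum>k\<in>K. unity_root N (int j * k) * x k))\<^sup>2)
      \<le> real N * (\<Sum>k\<in>K. (cmod (x k))\<^sup>2)"
    by simp
qed (use N in auto)

text \<open>Normalised as a mean, so that for averages of a function over a fine grid it
  approximates the Fourier integral.\<close>

definition discrete_fourier :: "nat \<Rightarrow> (int \<Rightarrow> real) \<Rightarrow> int \<Rightarrow> complex" where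
  "discrete_fourier N d k = (\<Sum>j\<in>{0..<int N}. of_real (d j) * unity_root N (- (k * j))) / of_nat N"

text \<open>The Fejer kernel at i / N, divided by N so that the weights sum to 1 over a period.\<close>

definition fejer_weight :: "nat \<Rightarrow> nat \<Rightarrow> int \<Rightarrow> real" where
  "fejer_weight n N i = (cmod (\<Sum>m<n. unity_root N (int m * i)))\<^sup>2 / (real n * real N)"

text \<open>For |k| < n this is 1 - |k| / n. The number of pairs with difference k is what squaring
  the exponential sum produces, and the bounds and the value at 0 can be read off from it.\<close>

definition fejer_coeff :: "nat \<Rightarrow> int \<Rightarrow> real" where
  "fejer_coeff n k = real (card {x \<in> {..<n} \<times> {..<n}. int (fst x) - int (snd x) = k}) / real n"

lemma fejer_coeff_bounds: "0 \<le> fejer_coeff n k" "fejer_coeff n k \<le> 1"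
proof -
  have "card {x \<in> {..<n} \<times> {..<n}. int (fst x) - int (snd x) = k} \<le> card {..<n}"
    by (rule card_inj_on_le[where f = fst]) (auto simp: inj_on_def)
  then show "fejer_coeff n k \<le> 1" by (cases "n = 0") (auto simp: fejer_coeff_def)
qed (simp add: fejer_coeff_def)

lemma fejer_coeff_0: "n > 0 \<Longrightarrow> fejer_coeff n 0 = 1"
proof -
  have "bij_betw (\<lambda>i. (i, i)) {..<n} {x \<in> {..<n} \<times> {..<n}. int (fst x) - int (snd x) = 0}"
    by (auto simp: bij_betw_def inj_on_def image_iff)
  from bij_betw_same_card[OF this]
  have "card {x \<in> {..<n} \<times> {..<n}. int (fst x) - int (snd x) = 0} = n"
    by (simp only: card_lessThan)
  then show "n > 0 \<Longrightarrow> fejer_coeff n 0 = 1" by (simp only: fejer_coeff_def) simp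
qed

lemma fejer_weight_nonneg: "0 \<le> fejer_weight n N i"
  by (simp add: fejer_weight_def)

text \<open>Squaring the sum gives one term for each pair (a, b), depending only on a - b; the pairs
  are grouped by this difference.\<close>

lemma fejer_weight_expand:
  assumes "n > 0"
  shows "of_real (fejer_weight n N i) =
    (\<Sum>k\<in>{- int n<..<int n}. of_real (fejer_coeff n k) * unity_root N (k * i)) / of_nat N"
proof -
  let ?S = "{..<n} \<times> {..<n}" and ?T = "{- int n<..<int n}"
  let ?g = "\<lambda>x :: nat \<times> nat. int (fst x) - int (snd x)"
  have "complex_of_real ((cmod (\<Sum>m<n. unity_root N (int m * i)))\<^sup>2)
      = (\<Sum>x\<in>?S. unity_root N (?g x * i))"
    by (simp add: complex_norm_square sum_product left_diff_distrib unity_root_diff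
        sum.cartesian_product case_prod_beta del: of_real_power)
  also have "\<dots> = (\<Sum>k\<in>?T. \<Sum>x\<in>{x \<in> ?S. ?g x = k}. unity_root N (?g x * i))"
    by (rule sum.group[symmetric]) auto
  also have "\<dots> = (\<Sum>k\<in>?T. of_nat n * (of_real (fejer_coeff n k) * unity_root N (k * i)))"
  proof (rule sum.cong[OF refl])
    fix k
    have "(\<Sum>x\<in>{x \<in> ?S. ?g x = k}. unity_root N (?g x * i))
       = (\<Sum>x\<in>{x \<in> ?S. ?g x = k}. unity_root N (k * i))"
      by (rule sum.cong) auto
    then show "(\<Sum>x\<in>{x \<in> ?S. ?g x = k}. unity_root N (?g x * i))
       = of_nat n * (of_real (fejer_coeff n k) * unity_root N (k * i))"
      using assms by (simp add: fejer_coeff_def)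
  qed
  finally show ?thesis
    using assms by (simp add: fejer_weight_def sum_distrib_left[symmetric])
qed

text \<open>Orthogonality leaves the frequencies divisible by N, and n \<le> N makes 0 the only one
  in the range.\<close>

lemma fejer_weight_sum:
  assumes "0 < n" "n \<le> N"
  shows "(\<Sum>i\<in>{0..<int N}. fejer_weight n N i) = 1"
proof -
  let ?T = "{- int n<..<int n}"
  have N: "N > 0" using assms by simp
  have "complex_of_real (\<Sum>i\<in>{0..<int N}. fejer_weight n N i)
     = (\<Sum>k\<in>?T. of_real (fejer_coeff n k) * (\<Sum>i<N. unity_root N (int i * k))) / of_nat N"
    unfolding sum_atLeast0LessThan_int of_real_sum fejer_weight_expand[OF assms(1)]
      sum_divide_distrib[symmetric] sum_distrib_left
    by (subst sum.swap) (simp add: mult.commute)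
  also have "\<dots> = (\<Sum>k\<in>?T. if k = 0 then of_real (fejer_coeff n k) * of_nat N else 0) / of_nat N"
  proof -
    have "k = 0" if "k \<in> ?T" "int N dvd k" for k
    proof (rule ccontr)
      assume "k \<noteq> 0"
      then have "int N \<le> \<bar>k\<bar>" using dvd_imp_le_int[of k "int N"] that by simp
      then show False using that assms by (simp add: abs_if split: if_splits)
    qed
    then show ?thesis
      unfolding sum_unity_root[OF N] by (intro arg_cong2[where f = "(/)"] sum.cong refl) auto
  qed
  also have "\<dots> = 1"
    using assms N by (simp add: sum.delta fejer_coeff_0)
  finally show ?thesis by (metis of_real_eq_1_iff)
qed

lemma fejer_convolution:
  assumes "n > 0" "N > 0" and per: "\<And>j. d (j mod int N) = d j"
  shows "of_real (\<Sum>i\<in>{0..<int N}. fejer_weight n N i * d (t - i)) =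
    (\<Sum>k\<in>{- int n<..<int n}. unity_root N (t * k) *
        (of_real (fejer_coeff n k) * discrete_fourier N d k))"
proof -
  let ?T = "{- int n<..<int n}"
  have inner: "(\<Sum>i\<in>{0..<int N}. unity_root N (k * i) * of_real (d (t - i)))
      = unity_root N (t * k) * (of_nat N * discrete_fourier N d k)" for k
  proof -
    have "unity_root N (k * i) = unity_root N (t * k) * unity_root N (- (k * (t - i)))" for i
      by (simp add: algebra_simps flip: unity_root_add)
    then have "(\<Sum>i\<in>{0..<int N}. unity_root N (k * i) * of_real (d (t - i)))
      = unity_root N (t * k) * (\<Sum>i\<in>{0..<int N}. of_real (d (t - i)) * unity_root N (- (k * (t - i))))"
      by (simp add: sum_distrib_left mult_ac)
    also have "(\<Sum>i\<in>{0..<int N}. complex_of_real (d (t - i)) * unity_root N (- (k * (t - i))))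
       = (\<Sum>i\<in>{0..<int N}. of_real (d i) * unity_root N (- (k * i)))"
      using unity_root_mod[OF assms(2)] assms(2)
      by (intro sum_periodic_reflect[where g = "\<lambda>i. of_real (d i) * unity_root N (- (k * i))"])
        (auto simp: per unity_root_minus)
    also have "\<dots> = of_nat N * discrete_fourier N d k"
      using assms by (simp add: discrete_fourier_def)
    finally show ?thesis .
  qed
  have "complex_of_real (\<Sum>i\<in>{0..<int N}. fejer_weight n N i * d (t - i))
    = (\<Sum>i\<in>{0..<int N}. \<Sum>k\<in>?T. of_real (fejer_coeff n k) / of_nat N *
        (unity_root N (k * i) * of_real (d (t - i))))"
    by (simp add: fejer_weight_expand[OF assms(1)] sum_distrib_right sum_divide_distrib mult.assoc)
  also have "\<dots> = (\<Sum>k\<in>?T. of_real (fejer_coeff n k) / of_nat N *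
      (\<Sum>i\<in>{0..<int N}. unity_root N (k * i) * of_real (d (t - i))))"
    by (subst sum.swap) (simp add: sum_distrib_left)
  also have "\<dots> = (\<Sum>k\<in>?T. unity_root N (t * k) *
        (of_real (fejer_coeff n k) * discrete_fourier N d k))"
    unfolding inner using assms by (intro sum.cong refl) simp
  finally show ?thesis .
qed

lemma discrete_fourier_minus: "discrete_fourier N d (- k) = cnj (discrete_fourier N d k)"
  by (simp add: discrete_fourier_def unity_root_minus)

lemma discrete_fourier_reflect:
  assumes "N > 0" "\<And>j. d (j mod int N) = d j"
  shows "discrete_fourier N (\<lambda>j. - d (- j)) k = - cnj (discrete_fourier N d k)"
proof -
  have "(\<Sum>j\<in>{0..<int N}. of_real (d (0 - j)) * unity_root N ((k * (0 - j))))
     = (\<Sum>j\<in>{0..<int N}. of_real (d j) * unity_root N ((k * j)))"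
    using unity_root_mod[OF assms(1)] assms
    by (intro sum_periodic_reflect[where g = "\<lambda>j. of_real (d j) * unity_root N ((k * j))"]) auto
  then show ?thesis
    by (simp add: discrete_fourier_def unity_root_minus sum_negf)
qed

text \<open>The condition 2 n \<le> N separates the frequencies -n < k < n modulo N, as
  Hausdorff-Young requires. Frequency 0 drops out by \<open>d0\<close>, negative frequencies carry
  conjugate coefficients, and doubling the sum costs 2^(1/q) \<le> 2; the multipliers
  \<open>fejer_coeff\<close> are at most 1.\<close>

lemma fejer_convolution_Lp:
  assumes n: "n > 0" "2 * n \<le> N" and per: "\<And>j. d (j mod int N) = d j"
    and d0: "discrete_fourier N d 0 = 0" and p: "2 \<le> p" "1 / p + 1 / q = 1"
  shows "(\<Sum>j\<in>{0..<int N}. \<bar>\<Sum>i\<in>{0..<int N}. fejer_weight n N i * d (j - i)\<bar> powr p) / real N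
    \<le> (2 * (\<Sum>k\<in>{1..<n}. cmod (discrete_fourier N d (int k)) powr q) powr (1 / q)) powr p"
proof -
  let ?T = "{- int n<..<int n}" and ?h = "\<lambda>k. cmod (discrete_fourier N d k) powr q"
  have q: "q \<ge> 1" using conjugate_exponent[OF p] by simp
  have N: "N > 0" using n by simp
  have "(\<Sum>j\<in>{0..<int N}. \<bar>\<Sum>i\<in>{0..<int N}. fejer_weight n N i * d (j - i)\<bar> powr p) / real N
    = (\<Sum>j<N. cmod (\<Sum>k\<in>?T. unity_root N (int j * k) *
        (of_real (fejer_coeff n k) * discrete_fourier N d k)) powr p) / real N"
    unfolding sum_atLeast0LessThan_int[where f = "\<lambda>j. \<bar>\<Sum>i\<in>{0..<int N}. fejer_weight n N i * d (j - i)\<bar> powr p"]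
      fejer_convolution[where d = d, OF n(1) N per, symmetric] norm_of_real ..
  also have "\<dots> \<le> ((\<Sum>k\<in>?T. cmod (of_real (fejer_coeff n k) * discrete_fourier N d k) powr q) powr (1 / q)) powr p"
  proof (rule discrete_hausdorff_young[OF N _ _ p])
    fix k l assume "k \<in> ?T" "l \<in> ?T" "int N dvd k - l"
    then show "k = l"
      using dvd_imp_le_int[of "k - l" "int N"] n
      by (cases "k = l") (auto simp: abs_if split: if_splits)
  qed simp
  also have "\<dots> \<le> (2 * (\<Sum>k\<in>{1..<n}. ?h (int k)) powr (1 / q)) powr p"
  proof (intro powr_mono2)
    have T: "?T = {0} \<union> (int ` {1..<n} \<union> (\<lambda>k. - int k) ` {1..<n})"
    proof (intro equalityI subsetI)
      fix k assume "k \<in> ?T"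
      then have "k = 0 \<or> k = int (nat k) \<and> nat k \<in> {1..<n}
          \<or> k = - int (nat (-k)) \<and> nat (-k) \<in> {1..<n}"
        unfolding greaterThanLessThan_iff atLeastLessThan_iff by arith
      then consider "k = 0" | "k = int (nat k)" "nat k \<in> {1..<n}"
        | "k = - int (nat (-k))" "nat (-k) \<in> {1..<n}" by blast
      then show "k \<in> {0} \<union> (int ` {1..<n} \<union> (\<lambda>k. - int k) ` {1..<n})"
        by cases blast+
    qed (use n in auto)
    have "(\<Sum>k\<in>?T. cmod (of_real (fejer_coeff n k) * discrete_fourier N d k) powr q) \<le> (\<Sum>k\<in>?T. ?h k)"
      using fejer_coeff_bounds[of n] q
      by (intro sum_mono powr_mono2) (auto simp: norm_mult mult_left_le_one_le)
    also have "(\<Sum>k\<in>?T. ?h k) = (\<Sum>k\<in>{0} \<union> (int ` {1..<n} \<union> (\<lambda>k. - int k) ` {1..<n}). ?h k)"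
      by (simp only: T)
    also have "(\<Sum>k\<in>{0} \<union> (int ` {1..<n} \<union> (\<lambda>k. - int k) ` {1..<n}). ?h k)
       = (\<Sum>k\<in>{0}. ?h k) + ((\<Sum>k\<in>int ` {1..<n}. ?h k) + (\<Sum>k\<in>(\<lambda>k. - int k) ` {1..<n}. ?h k))"
      by (subst sum.union_disjoint; (subst sum.union_disjoint)?) auto
    also have "\<dots> = 2 * (\<Sum>k\<in>{1..<n}. ?h (int k))"
      using d0 by (subst (1 2) sum.reindex) (auto simp: inj_on_def discrete_fourier_minus)
    finally have "(\<Sum>k\<in>?T. cmod (of_real (fejer_coeff n k) * discrete_fourier N d k) powr q) powr (1 / q)
       \<le> (2 * (\<Sum>k\<in>{1..<n}. ?h (int k))) powr (1 / q)"
      using q by (intro powr_mono2 sum_nonneg) auto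
    also have "\<dots> = 2 powr (1 / q) * (\<Sum>k\<in>{1..<n}. ?h (int k)) powr (1 / q)"
      by (intro powr_mult)
    also have "\<dots> \<le> 2 powr 1 * (\<Sum>k\<in>{1..<n}. ?h (int k)) powr (1 / q)"
      using q by (intro mult_right_mono powr_mono) auto
    finally show "(\<Sum>k\<in>?T. cmod (of_real (fejer_coeff n k) * discrete_fourier N d k) powr q) powr (1 / q)
       \<le> 2 * (\<Sum>k\<in>{1..<n}. ?h (int k)) powr (1 / q)" by simp
  qed (use p in auto)
  finally show ?thesis .
qed

subsection \<open>A discrete Erdos-Turan inequality\<close>

text \<open>Bounding each term by the maximum loses 3^p, which is harmless after the p-th
  root.\<close>

lemma powr_add3_le:
  fixes a b c p :: real
  assumes "0 \<le> a" "0 \<le> b" "0 \<le> c" "0 \<le> p"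
  shows "(a + b + c) powr p \<le> 3 powr p * (a powr p + b powr p + c powr p)"
proof -
  define m where "m = max a (max b c)"
  have "(a + b + c) powr p \<le> (3 * m) powr p"
    using assms by (intro powr_mono2) (auto simp: m_def)
  also have "\<dots> = 3 powr p * m powr p" by (rule powr_mult)
  also have "m powr p \<le> a powr p + b powr p + c powr p"
    by (auto simp: m_def max_def)
  finally show ?thesis by simp
qed

text \<open>Jensen's inequality for weights of total mass at most \<epsilon>. The gain \<epsilon>^(p
  - 1) is what makes the tail of the kernel absorbable.\<close>

lemma weighted_sum_powr_le:
  fixes w a :: "'i \<Rightarrow> real"
  assumes w: "\<And>i. i \<in> S \<Longrightarrow> 0 \<le> w i" "sum w S \<le> \<epsilon>" and a: "\<And>i. i \<in> S \<Longrightarrow> 0 \<le> a i"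
    and "\<epsilon> > 0" "p > 1"
  shows "(\<Sum>i\<in>S. w i * a i) powr p \<le> \<epsilon> powr (p - 1) * (\<Sum>i\<in>S. w i * a i powr p)"
proof (cases "(\<Sum>i\<in>S. w i * a i) = 0")
  case True
  then show ?thesis using w by (auto intro!: mult_nonneg_nonneg sum_nonneg)
next
  case False
  define s where "s = (\<Sum>i\<in>S. w i * a i)"
  have "0 \<le> s" unfolding s_def using w a by (intro sum_nonneg mult_nonneg_nonneg)
  then have s: "s > 0" using False by (simp add: s_def)
  \<comment> \<open>Young's inequality is applied to \<open>a i\<close> and m^(p - 1), where it is
    sharp at \<open>a i\<close> = m. With m = s / \<epsilon> the summed inequality closes up, since
    s m^(p - 1) = \<epsilon> m^p.\<close>
  define m where "m = s / \<epsilon>"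
  have m: "m > 0" using s assms by (simp add: m_def)
  define q where "q = p / (p - 1)"
  have q: "q > 1" "1 / p + 1 / q = 1" "(p - 1) * q = p"
    using \<open>p > 1\<close> by (simp_all add: q_def field_simps)
  have "w i * a i * m powr (p - 1) \<le> w i * a i powr p / p + w i * m powr p / q" if "i \<in> S" for i
  proof -
    have "a i * m powr (p - 1) \<le> a i powr p / p + (m powr (p - 1)) powr q / q"
      by (rule Youngs_inequality) (use q \<open>p > 1\<close> a that in auto)
    then have "w i * (a i * m powr (p - 1)) \<le> w i * (a i powr p / p + m powr p / q)"
      using w that by (intro mult_left_mono) (auto simp: powr_powr q)
    then show ?thesis by (simp add: algebra_simps)
  qed
  then have "(\<Sum>i\<in>S. w i * a i * m powr (p - 1)) \<le> (\<Sum>i\<in>S. w i * a i powr p / p + w i * m powr p / q)"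
    by (rule sum_mono)
  then have "s * m powr (p - 1) \<le> (\<Sum>i\<in>S. w i * a i powr p) / p + sum w S * (m powr p / q)"
    by (simp add: s_def sum.distrib sum_divide_distrib sum_distrib_right)
  also have "sum w S * (m powr p / q) \<le> \<epsilon> * (m powr p / q)"
    using w q by (intro mult_right_mono) auto
  also have "s * m powr (p - 1) = \<epsilon> * m powr p"
  proof -
    have "m powr p = m powr 1 * m powr (p - 1)" by (subst powr_add[symmetric]) simp
    then show ?thesis using s \<open>\<epsilon> > 0\<close> by (simp add: m_def)
  qed
  finally have "\<epsilon> * m powr p * (1 - 1 / q) \<le> (\<Sum>i\<in>S. w i * a i powr p) / p"
    by (simp add: algebra_simps)
  also have "1 - 1 / q = 1 / p" using q by simp
  finally have "\<epsilon> * m powr p \<le> (\<Sum>i\<in>S. w i * a i powr p)"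
    using \<open>p > 1\<close> by (simp add: field_simps)
  then have "\<epsilon> powr (p - 1) * (\<epsilon> * m powr p) \<le> \<epsilon> powr (p - 1) * (\<Sum>i\<in>S. w i * a i powr p)"
    by (intro mult_left_mono) auto
  moreover have "\<epsilon> powr (p - 1) * (\<epsilon> * m powr p) = s powr p"
  proof -
    have "\<epsilon> powr p = \<epsilon> powr (p - 1) * \<epsilon> powr 1" by (subst powr_add[symmetric]) simp
    then have "\<epsilon> powr (p - 1) * (\<epsilon> * m powr p) = (\<epsilon> * m) powr p"
      using \<open>\<epsilon> > 0\<close> by (simp add: powr_mult)
    then show ?thesis using \<open>\<epsilon> > 0\<close> by (simp add: m_def)
  qed
  ultimately show ?thesis by (simp add: s_def)
qed

text \<open>A weak form of Jordan's inequality: up to pi / 3 the slope of sin is at least 1 / 2, and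
  from there on sin is at least sqrt 3 / 2, which exceeds pi / 4.\<close>

lemma sin_ge_half:
  assumes "0 \<le> x" "x \<le> pi / 2"
  shows "x / 2 \<le> sin x"
proof (cases "x \<le> pi / 3")
  case True
  show ?thesis
  proof (cases "x = 0")
    case False
    then have x: "x > 0" using assms by simp
    obtain z where z: "0 < z" "z < x" "sin x - sin 0 = (x - 0) * cos z"
      using MVT2[of 0 x sin cos] x by (auto intro: derivative_eq_intros)
    have "cos (pi / 3) \<le> cos z"
      using z True by (intro cos_monotone_0_pi_le) auto
    then have "x * (1 / 2) \<le> x * cos z"
      using x by (intro mult_left_mono) (auto simp: cos_60)
    then show ?thesis using z by simp
  qed simp
next
  case False
  have "sin (pi / 3) \<le> sin x"
    using assms False by (intro sin_monotone_2pi_le) auto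
  moreover have "sin (pi / 3) = sqrt 3 / 2" by (rule sin_60)
  moreover have "sqrt 3 \<ge> 1.7" by (rule real_le_rsqrt) (simp add: power2_eq_square)
  moreover have "x / 2 \<le> 1.7 / 2" using assms pi_approx by simp
  ultimately show ?thesis by simp
qed

text \<open>Near each end of (0, pi) sin is at least half the distance to that end; adding the two
  bounds gives one formula for the whole range.\<close>

lemma inverse_sin_squared_le:
  assumes "0 < x" "x < pi"
  shows "1 / (sin x)\<^sup>2 \<le> 4 / x\<^sup>2 + 4 / (pi - x)\<^sup>2"
proof -
  have *: "1 / (sin y)\<^sup>2 \<le> 4 / y\<^sup>2" if "0 < y" "y \<le> pi / 2" for y
  proof -
    have "(y / 2)\<^sup>2 \<le> (sin y)\<^sup>2"
      using sin_ge_half[of y] that by (intro power_mono) auto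
    then have "1 / (sin y)\<^sup>2 \<le> 1 / (y / 2)\<^sup>2"
      using that by (intro divide_left_mono) (auto simp: power2_eq_square sin_gt_zero)
    then show ?thesis by (simp add: power_divide)
  qed
  show ?thesis
  proof (cases "x \<le> pi / 2")
    case True
    then show ?thesis using *[of x] assms by (simp add: add_increasing2)
  next
    case False
    then show ?thesis using *[of "pi - x"] assms by (simp add: add_increasing)
  qed
qed

text \<open>Summing the geometric series bounds the exponential sum by 2 / |1 - z| = 1 / sin x with
  x = pi i / N. Both ends appear because the kernel is periodic, with peaks at 0 and at N.\<close>

lemma fejer_weight_decay:
  assumes "0 < i" "i < int N" "n > 0"
  shows "fejer_weight n N i \<le> real N / (2 * real n) * (1 / (of_int i)\<^sup>2 + 1 / (of_int (int N - i))\<^sup>2)"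
proof -
  define x where "x = pi * of_int i / real N"
  have N: "real N > 0" "real_of_int i < real N" "real_of_int i > 0" using assms by linarith+
  have x: "0 < x" "x < pi" "pi - x = pi * of_int (int N - i) / real N"
    using N by (auto simp: x_def field_simps)
  have sx: "sin x > 0" using x sin_gt_zero by blast
  define z where "z = unity_root N i"
  have nz: "cmod (1 - z) = 2 * sin x"
  proof -
    have z: "z = cis (2 * x)" by (simp add: z_def unity_root_def x_def mult.assoc)
    have "(cmod (1 - z))\<^sup>2 = (1 - cos (2 * x))\<^sup>2 + (sin (2 * x))\<^sup>2"
      by (simp add: z cmod_power2)
    also have "\<dots> = 2 - 2 * cos (2 * x)"
      using sin_cos_squared_add[of "2 * x"] by (simp add: power2_diff)
    also have "\<dots> = (2 * sin x)\<^sup>2"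
      using cos_double_sin[of x] by (simp add: power_mult_distrib)
    finally show ?thesis by (rule power2_eq_imp_eq) (use sx in auto)
  qed
  then have z1: "z \<noteq> 1" using sx by auto
  have "(\<Sum>m<n. unity_root N (int m * i)) = (z ^ n - 1) / (z - 1)"
    by (simp add: unity_root_power z_def[symmetric] geometric_sum[OF z1])
  then have "cmod (\<Sum>m<n. unity_root N (int m * i)) = cmod (z ^ n - 1) / (2 * sin x)"
    by (simp add: norm_divide norm_minus_commute[of z] nz)
  also have "\<dots> \<le> 2 / (2 * sin x)"
    using norm_triangle_ineq4[of "z ^ n" 1] sx
    by (intro divide_right_mono) (auto simp: norm_power z_def)
  finally have "(cmod (\<Sum>m<n. unity_root N (int m * i)))\<^sup>2 \<le> (1 / sin x)\<^sup>2"
    by (intro power_mono) auto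
  also have "\<dots> \<le> 4 / x\<^sup>2 + 4 / (pi - x)\<^sup>2"
    using inverse_sin_squared_le[OF x(1,2)] by (simp add: power_divide)
  also have "\<dots> = 4 * (real N)\<^sup>2 / pi\<^sup>2 * (1 / (of_int i)\<^sup>2 + 1 / (of_int (int N - i))\<^sup>2)"
    unfolding x(3) unfolding x_def by (simp add: power_divide power_mult_distrib distrib_left del: of_int_diff)
  also have "\<dots> \<le> (real N)\<^sup>2 / 2 * (1 / (of_int i)\<^sup>2 + 1 / (of_int (int N - i))\<^sup>2)"
  proof (intro mult_right_mono)
    \<comment> \<open>8 \<le> pi^2 turns the factor 4 / pi^2 into the round 1 / 2.\<close>
    have "3\<^sup>2 \<le> pi\<^sup>2" using pi_gt3 by (intro power_mono) auto
    then have "8 \<le> pi\<^sup>2" by simp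
    then show "4 * (real N)\<^sup>2 / pi\<^sup>2 \<le> (real N)\<^sup>2 / 2"
      using mult_right_mono[of 8 "pi\<^sup>2" "(real N)\<^sup>2"] by (simp add: field_simps)
  qed auto
  finally have "fejer_weight n N i \<le>
      (real N)\<^sup>2 / 2 * (1 / (of_int i)\<^sup>2 + 1 / (of_int (int N - i))\<^sup>2) / (real n * real N)"
    unfolding fejer_weight_def by (intro divide_right_mono) auto
  also have "\<dots> = real N / (2 * real n) * (1 / (of_int i)\<^sup>2 + 1 / (of_int (int N - i))\<^sup>2)"
    using N by (simp add: power2_eq_square)
  finally show ?thesis .
qed

text \<open>Telescoping: 1 / L^2 \<le> 1 / (L - 1) - 1 / L.\<close>

lemma sum_inverse_squares_tail:
  assumes "b > 0"
  shows "(\<Sum>i\<in>{b<..<L}. 1 / (real_of_int i)\<^sup>2) \<le> 1 / real_of_int b"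
proof (cases "b < L")
  case True
  have "(\<Sum>i\<in>{b<..<L}. 1 / (real_of_int i)\<^sup>2) \<le> 1 / real_of_int b - 1 / real_of_int (L - 1)"
    using True
  proof (induction L rule: int_gr_induct)
    case base
    have "{b<..<b + 1} = {}" by auto
    then show ?case by simp
  next
    case (step L)
    have "{b<..<L + 1} = insert L {b<..<L}" using step by auto
    then have "(\<Sum>i\<in>{b<..<L + 1}. 1 / (real_of_int i)\<^sup>2)
       = 1 / (real_of_int L)\<^sup>2 + (\<Sum>i\<in>{b<..<L}. 1 / (real_of_int i)\<^sup>2)"
      by simp
    also have "1 / (real_of_int L)\<^sup>2 \<le> 1 / (real_of_int (L - 1) * real_of_int L)"
      using step assms by (intro divide_left_mono) (auto simp: power2_eq_square)
    also have "\<dots> = 1 / real_of_int (L - 1) - 1 / real_of_int L"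
      using step assms by (simp add: field_simps)
    finally show ?case using step by simp
  qed
  also have "\<dots> \<le> 1 / real_of_int b" using True assms by simp
  finally show ?thesis .
qed (use assms in simp)

text \<open>With N = n M the factor in the decay bound is M / 2, and each of the two inverse square
  sums is at most 1 / (12 M). The half width 12 M, a distance 12 / n on the circle, is chosen to
  make the total 1 / 12.\<close>

lemma fejer_weight_tail:
  assumes "n > 0" "M > 0"
  shows "(\<Sum>i\<in>{12 * int M<..<int (n * M) - 12 * int M}. fejer_weight n (n * M) i) \<le> 1 / 12"
proof -
  let ?N = "n * M" and ?b = "12 * int M"
  let ?F = "{?b<..<int ?N - ?b}"
  have "(\<Sum>i\<in>?F. fejer_weight n ?N i) \<le>
     (\<Sum>i\<in>?F. real M / 2 * (1 / (of_int i)\<^sup>2 + 1 / (of_int (int ?N - i))\<^sup>2))"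
    using fejer_weight_decay[of _ ?N n] assms by (intro sum_mono) auto
  also have "\<dots> = real M / 2 * ((\<Sum>i\<in>?F. 1 / (of_int i)\<^sup>2) + (\<Sum>i\<in>?F. 1 / (of_int (int ?N - i))\<^sup>2))"
    unfolding sum_distrib_left[symmetric] sum.distrib ..
  also have "(\<Sum>i\<in>?F. 1 / (real_of_int (int ?N - i))\<^sup>2) = (\<Sum>i\<in>?F. 1 / (real_of_int i)\<^sup>2)"
    by (rule sum.reindex_bij_witness[of _ "\<lambda>i. int ?N - i" "\<lambda>i. int ?N - i"]) auto
  also have "real M / 2 * ((\<Sum>i\<in>?F. 1 / (real_of_int i)\<^sup>2) + (\<Sum>i\<in>?F. 1 / (real_of_int i)\<^sup>2))
     \<le> real M / 2 * (1 / real_of_int ?b + 1 / real_of_int ?b)"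
    using assms by (intro mult_left_mono add_mono sum_inverse_squares_tail) auto
  also have "\<dots> = 1 / 12" using assms by simp
  finally show ?thesis .
qed

text \<open>\<open>d\<close> falls at rate at most 1, so each value of \<open>d\<close> is controlled from above by the values
  just to the right; this replaces a bound on \<open>d\<close> minus its Fejer mean, which fails for large p.\<close>

lemma one_sided_pointwise:
  assumes n: "n > 0" "M > 0" and per: "\<And>j. d (j mod int (n * M)) = d j"
    and mono: "\<And>j. d (j + 1) \<ge> d j - 1 / real (n * M)"
  defines "N \<equiv> n * M" and "F \<equiv> {12 * int M<..<int (n * M) - 12 * int M}"
  shows "max (d j) 0 / 2 \<le> 24 / real n
     + \<bar>\<Sum>i\<in>{0..<int N}. fejer_weight n N i * d (j + 12 * int M - i)\<bar>
     + (\<Sum>i\<in>F. fejer_weight n N i * \<bar>d (j + 12 * int M - i)\<bar>)"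
    (is "_ \<le> _ + \<bar>?P\<bar> + ?E")
proof -
  have N: "N > 0" using n by (simp add: N_def)
  have steps: "d (j + int m) \<ge> d j - real m / real N" for j m
  proof (induction m)
    case (Suc m)
    have "real (Suc m) / real N = real m / real N + 1 / real N"
      by (simp add: add_divide_distrib)
    moreover have "d (j + int (Suc m)) = d (j + int m + 1)" by (simp add: ac_simps)
    ultimately show ?case using mono[of "j + int m"] Suc unfolding N_def by linarith
  qed simp
  \<comment> \<open>The shift by 12 M carries the window of half width 12 M to the range from 0 to
    24 M on the right of j, where the bound on the fall of d limits the loss to 24 M / N = 24 /
    n.\<close>
  have near: "d (j + 12 * int M - i) \<ge> d j - 24 / real n" if "i \<in> {0..<int N} - F" for i
  proof -
    \<comment> \<open>Residues close to N stand for small negative i, hence the extra N; l is the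
      number of steps to the right of j.\<close>
    define l where "l = (if i \<le> 12 * int M then 12 * int M - i else 12 * int M - i + int N)"
    have l: "0 \<le> l" "l \<le> 24 * int M" using that by (auto simp: l_def F_def N_def)
    have "d (j + l) = d (j + 12 * int M - i)"
    proof -
      have "d (k + int N) = d k" for k
        using per[of "k + int N"] per[of k] by (simp add: N_def)
      from this[of "j + 12 * int M - i"] show ?thesis by (simp add: l_def algebra_simps)
    qed
    moreover have "d (j + l) \<ge> d j - real (nat l) / real N"
      using steps[of j "nat l"] l by simp
    moreover have "real (nat l) / real N \<le> 24 / real n"
    proof -
      have "real (nat l) \<le> 24 * real M" using l by (simp add: le_nat_iff)
      then have "real (nat l) / real N \<le> 24 * real M / real N" by (rule divide_right_mono) simp
      then show ?thesis using n by (simp add: N_def)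
    qed
    ultimately show ?thesis by simp
  qed
  show ?thesis
  proof (cases "d j \<ge> 0")
    case False
    then have "max (d j) 0 = 0" by simp
    moreover have "0 \<le> ?E" by (intro sum_nonneg mult_nonneg_nonneg fejer_weight_nonneg) auto
    ultimately show ?thesis by simp
  next
    case True
    let ?w = "fejer_weight n N" and ?I = "{0..<int N}"
    have FI: "F \<subseteq> ?I" using n by (auto simp: F_def N_def)
    have sumw: "sum ?w ?I = 1" using n by (intro fejer_weight_sum) (auto simp: N_def)
    then have split: "sum ?w (?I - F) = 1 - sum ?w F"
      using FI by (simp add: sum_diff finite_subset)
    have wF: "0 \<le> sum ?w F" "sum ?w F \<le> 1 / 12"
      using fejer_weight_tail[OF n] by (auto simp: F_def N_def intro!: sum_nonneg fejer_weight_nonneg)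
    have "sum ?w (?I - F) * (d j - 24 / real n) \<le> (\<Sum>i\<in>?I - F. ?w i * d (j + 12 * int M - i))"
      unfolding sum_distrib_right by (intro sum_mono mult_left_mono near fejer_weight_nonneg)
    also have "\<dots> = ?P - (\<Sum>i\<in>F. ?w i * d (j + 12 * int M - i))"
      using FI by (simp add: sum_diff finite_subset)
    also have "\<dots> \<le> \<bar>?P\<bar> + ?E"
    proof -
      have "- (\<Sum>i\<in>F. ?w i * d (j + 12 * int M - i)) \<le> ?E"
        unfolding sum_negf[symmetric]
        by (intro sum_mono) (metis abs_ge_minus_self abs_mult abs_of_nonneg fejer_weight_nonneg)
      then show ?thesis by linarith
    qed
    finally have "sum ?w (?I - F) * d j \<le> sum ?w (?I - F) * (24 / real n) + \<bar>?P\<bar> + ?E"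
      by (simp add: algebra_simps)
    \<comment> \<open>The mass outside \<open>F\<close> is at least 11 / 12; rounding it down to 1 /
      2 keeps the constants simple.\<close>
    moreover have "1 / 2 * d j \<le> sum ?w (?I - F) * d j"
      using True wF split by (intro mult_right_mono) auto
    moreover have "sum ?w (?I - F) * (24 / real n) \<le> 1 * (24 / real n)"
      using wF split by (intro mult_right_mono) auto
    ultimately show ?thesis using True by simp
  qed
qed

text \<open>The pointwise bound is raised to the power p and averaged over a period, which removes
  the shift. The tail of the kernel sees both signs of d, hence the absolute values on the right
  although only the positive part is bounded; its factor (1/4)^p is small enough for absorption once
  both signs are combined. M > 1 supplies 2 n \<le> N for the Fejer mean.\<close>

lemma one_sided_Lp:
  assumes n: "n > 0" "M > 1" and per: "\<And>j. d (j mod int (n * M)) = d j"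
    and mono: "\<And>j. d (j + 1) \<ge> d j - 1 / real (n * M)"
    and d0: "discrete_fourier (n * M) d 0 = 0" and p: "2 \<le> p" "1 / p + 1 / q = 1"
  defines "N \<equiv> n * M"
  shows "(1 / 2) powr p * ((\<Sum>j\<in>{0..<int N}. max (d j) 0 powr p) / real N) \<le>
    3 powr p * ((24 / real n) powr p
      + (2 * (\<Sum>k\<in>{1..<n}. cmod (discrete_fourier N d (int k)) powr q) powr (1 / q)) powr p)
      + (1 / 4) powr p * ((\<Sum>j\<in>{0..<int N}. \<bar>d j\<bar> powr p) / real N)"
proof -
  let ?w = "fejer_weight n N" and ?I = "{0..<int N}" and ?b = "12 * int M"
  define F where "F = {12 * int M<..<int (n * M) - 12 * int M}"
  define P where "P = (\<lambda>j. \<bar>\<Sum>i\<in>?I. ?w i * d (j - i)\<bar> powr p)"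
  define E where "E = (\<lambda>j. \<Sum>i\<in>F. ?w i * \<bar>d (j - i)\<bar>)"
  let ?X = "\<Sum>j\<in>?I. \<bar>d j\<bar> powr p"
  have N: "N > 0" using n by (simp add: N_def)
  have wF: "sum ?w F \<le> 1 / 12"
    using fejer_weight_tail[of n M] n by (simp add: F_def N_def)
  have perN: "d (j mod int N) = d j" for j using per by (simp add: N_def)
  have dmod: "d (j mod int N - i) = d (j - i)" for i j
    by (metis mod_diff_left_eq perN)
  have E0: "E j \<ge> 0" for j
    by (auto simp: E_def intro!: sum_nonneg mult_nonneg_nonneg fejer_weight_nonneg)
  have pt: "(1 / 2) powr p * max (d j) 0 powr p
      \<le> 3 powr p * ((24 / real n) powr p + P (j + ?b) + E (j + ?b) powr p)" for j
  proof -
    have "(1 / 2) powr p * max (d j) 0 powr p = (max (d j) 0 / 2) powr p"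
      by (simp add: powr_mult powr_divide)
    also have "\<dots> \<le> (24 / real n + \<bar>\<Sum>i\<in>?I. ?w i * d (j + ?b - i)\<bar> + E (j + ?b)) powr p"
      using one_sided_pointwise[where d = d and j = j, OF n(1) _ per mono] n p
      by (intro powr_mono2) (auto simp: N_def E_def F_def)
    also have "\<dots> \<le> 3 powr p * ((24 / real n) powr p + P (j + ?b) + E (j + ?b) powr p)"
      unfolding P_def by (intro powr_add3_le E0) (use p in auto)
    finally show ?thesis .
  qed
  have "(1 / 2) powr p * (\<Sum>j\<in>?I. max (d j) 0 powr p)
      \<le> (\<Sum>j\<in>?I. 3 powr p * ((24 / real n) powr p + P (j + ?b) + E (j + ?b) powr p))"
    unfolding sum_distrib_left by (rule sum_mono) (rule pt)
  also have "\<dots> = 3 powr p * (real N * (24 / real n) powr p + (\<Sum>j\<in>?I. P (j + ?b)) + (\<Sum>j\<in>?I. E (j + ?b) powr p))"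
    by (simp add: sum_distrib_left[symmetric] sum.distrib)
  also have "(\<Sum>j\<in>?I. P (j + ?b)) = (\<Sum>j\<in>?I. P j)"
    by (rule sum_periodic_shift[OF N]) (simp add: P_def dmod)
  also have "(\<Sum>j\<in>?I. E (j + ?b) powr p) = (\<Sum>j\<in>?I. E j powr p)"
    by (rule sum_periodic_shift[OF N, where g = "\<lambda>j. E j powr p"]) (simp add: E_def dmod)
  \<comment> \<open>The tail mass \<epsilon> = 1 / 12 enters twice: \<epsilon>^(p - 1) from Jensen,
    and one more \<epsilon> from summing the weights after the sums are exchanged, so \<epsilon>^p
    in all.\<close>
  also have "(\<Sum>j\<in>?I. E j powr p) \<le> (\<Sum>j\<in>?I. (1 / 12) powr (p - 1) * (\<Sum>i\<in>F. ?w i * \<bar>d (j - i)\<bar> powr p))"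
    unfolding E_def using p
    by (intro sum_mono weighted_sum_powr_le wF fejer_weight_nonneg) auto
  also have "\<dots> = (1 / 12) powr (p - 1) * (\<Sum>i\<in>F. ?w i * (\<Sum>j\<in>?I. \<bar>d (j - i)\<bar> powr p))"
    by (simp add: sum_distrib_left[symmetric]) (subst sum.swap, simp add: sum_distrib_left)
  also have "(\<Sum>i\<in>F. ?w i * (\<Sum>j\<in>?I. \<bar>d (j - i)\<bar> powr p)) = (\<Sum>i\<in>F. ?w i * ?X)"
  proof -
    have "(\<Sum>j\<in>?I. \<bar>d (j - i)\<bar> powr p) = ?X" for i
      using sum_periodic_shift[OF N, of "\<lambda>j. \<bar>d j\<bar> powr p" "- i"] perN by simp
    then show ?thesis by simp
  qed
  also have "\<dots> \<le> 1 / 12 * ?X"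
    unfolding sum_distrib_right[symmetric] by (intro mult_right_mono wF sum_nonneg) auto
  also have "(1 / 12) powr (p - 1) * (1 / 12 * ?X) = (1 / 12) powr p * ?X"
  proof -
    have "(1 / 12) powr p = (1 / 12) powr (p - 1) * (1 / 12 :: real) powr 1"
      by (subst powr_add[symmetric]) simp
    then show ?thesis by simp
  qed
  finally have *: "(1 / 2) powr p * (\<Sum>j\<in>?I. max (d j) 0 powr p)
     \<le> 3 powr p * (real N * (24 / real n) powr p + (\<Sum>j\<in>?I. P j) + (1 / 12) powr p * ?X)"
    by simp
  have "(1 / 2) powr p * ((\<Sum>j\<in>?I. max (d j) 0 powr p) / real N)
     \<le> 3 powr p * (real N * (24 / real n) powr p + (\<Sum>j\<in>?I. P j) + (1 / 12) powr p * ?X) / real N"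
    using divide_right_mono[OF *, of "real N"] by simp
  also have "\<dots> = 3 powr p * ((24 / real n) powr p + (\<Sum>j\<in>?I. P j) / real N)
       + (3 powr p * (1 / 12) powr p) * (?X / real N)"
    using N by (simp add: field_simps)
  also have "3 powr p * (1 / 12) powr p = (1 / 4 :: real) powr p"
    by (simp flip: powr_mult)
  also have "(\<Sum>j\<in>?I. P j) / real N \<le>
    (2 * (\<Sum>k\<in>{1..<n}. cmod (discrete_fourier N d (int k)) powr q) powr (1 / q)) powr p"
    unfolding P_def
    by (rule fejer_convolution_Lp[where d = d, OF n(1) _ perN _ p]) (use n d0 in \<open>auto simp: N_def\<close>)
  finally show ?thesis by simp
qed

text \<open>Each of a and b satisfies t^p \<le> t (a + b)^(p - 1). This merges the p-th powers of
  two error terms into one without a constant.\<close>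

lemma powr_superadditive:
  fixes a b p :: real
  assumes "0 \<le> a" "0 \<le> b" "1 \<le> p"
  shows "a powr p + b powr p \<le> (a + b) powr p"
proof (cases "a + b = 0")
  case False
  have *: "x powr p \<le> x * (a + b) powr (p - 1)" if "0 \<le> x" "x \<le> a + b" for x
  proof (cases "x = 0")
    case False
    have "x powr p = x powr 1 * x powr (p - 1)" by (subst powr_add[symmetric]) simp
    also have "\<dots> \<le> x * (a + b) powr (p - 1)"
      using that assms False by (auto intro!: mult_left_mono powr_mono2)
    finally show ?thesis .
  qed simp
  have "a powr p + b powr p \<le> a * (a + b) powr (p - 1) + b * (a + b) powr (p - 1)"
    using assms by (intro add_mono *) auto
  also have "\<dots> = (a + b) powr 1 * (a + b) powr (p - 1)"
    using assms by (simp add: algebra_simps)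
  also have "\<dots> = (a + b) powr p" by (subst powr_add[symmetric]) simp
  finally show ?thesis .
qed (use assms in \<open>auto simp: add_nonneg_eq_0_iff\<close>)

theorem discrete_erdos_turan_Lp:
  assumes n: "n > 0" "M > 1" and per: "\<And>j. d (j mod int (n * M)) = d j"
    and mono: "\<And>j. d (j + 1) \<ge> d j - 1 / real (n * M)"
    and d0: "discrete_fourier (n * M) d 0 = 0" and p: "2 \<le> p" "1 / p + 1 / q = 1"
  defines "N \<equiv> n * M"
  shows "(\<Sum>j\<in>{0..<int N}. \<bar>d j\<bar> powr p) / real N \<le>
    (288 * (1 / real n + (\<Sum>k\<in>{1..<n}. cmod (discrete_fourier N d (int k)) powr q) powr (1 / q))) powr p"
proof -
  let ?I = "{0..<int N}"
  let ?S = "(\<Sum>k\<in>{1..<n}. cmod (discrete_fourier N d (int k)) powr q) powr (1 / q)"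
  define X where "X = (\<Sum>j\<in>?I. \<bar>d j\<bar> powr p) / real N"
  \<comment> \<open>This point reflection preserves periodicity and the one-sided condition,
    conjugates the Fourier coefficients up to sign, and exchanges the positive and the negative
    part.\<close>
  define d' where "d' = (\<lambda>j. - d (- j))"
  have N: "N > 0" using n by (simp add: N_def)
  have perN: "d (j mod int N) = d j" for j using per by (simp add: N_def)
  have per': "d' (j mod int (n * M)) = d' j" for j
    unfolding d'_def by (metis per mod_minus_eq)
  have mono': "d' (j + 1) \<ge> d' j - 1 / real (n * M)" for j
    using mono[of "- j - 1"] by (simp add: d'_def)
  have F': "discrete_fourier N d' k = - cnj (discrete_fourier N d k)" for k
    unfolding d'_def by (rule discrete_fourier_reflect[where d = d, OF N perN])
  have d0': "discrete_fourier (n * M) d' 0 = 0" using F'[of 0] d0 by (simp add: N_def)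
  have X': "(\<Sum>j\<in>?I. \<bar>d' j\<bar> powr p) / real N = X"
    using sum_periodic_reflect[OF N, of "\<lambda>j. \<bar>d j\<bar> powr p" 0] perN by (simp add: d'_def X_def)
  have neg: "(\<Sum>j\<in>?I. max (d' j) 0 powr p) = (\<Sum>j\<in>?I. max (- d j) 0 powr p)"
    using sum_periodic_reflect[OF N, of "\<lambda>j. max (- d j) 0 powr p" 0] perN by (simp add: d'_def)
  define B where "B = 3 powr p * ((24 / real n) powr p + (2 * ?S) powr p)"
  have 1: "(1 / 2) powr p * ((\<Sum>j\<in>?I. max (d j) 0 powr p) / real N) \<le> B + (1 / 4) powr p * X"
    using one_sided_Lp[where d = d, OF n per mono d0 p] by (simp add: N_def B_def X_def)
  have 2: "(1 / 2) powr p * ((\<Sum>j\<in>?I. max (- d j) 0 powr p) / real N) \<le> B + (1 / 4) powr p * X"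
    using one_sided_Lp[where d = d', OF n per' mono' d0' p] 
    unfolding X'[unfolded N_def] neg[unfolded N_def] F'[unfolded N_def]
    by (simp add: N_def B_def X_def)
  have "\<bar>d j\<bar> powr p = max (d j) 0 powr p + max (- d j) 0 powr p" for j
    by (cases "d j \<ge> 0") auto
  then have "X = (\<Sum>j\<in>?I. max (d j) 0 powr p) / real N + (\<Sum>j\<in>?I. max (- d j) 0 powr p) / real N"
    by (simp add: X_def sum.distrib add_divide_distrib)
  then have "(1 / 2) powr p * X = (1 / 2) powr p * ((\<Sum>j\<in>?I. max (d j) 0 powr p) / real N)
      + (1 / 2) powr p * ((\<Sum>j\<in>?I. max (- d j) 0 powr p) / real N)"
    by (simp only: distrib_left)
  then have 3: "(1 / 2) powr p * X \<le> 2 * B + 2 * ((1 / 4) powr p * X)"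
    using 1 2 by linarith
  have X0: "X \<ge> 0" by (simp add: X_def sum_nonneg)
  have p4: "4 \<le> (2::real) powr p"
    using powr_mono[of 2 p 2] p by simp
  have q4: "(1 / 4) powr p = (1 / 2) powr p * (1 / 2 :: real) powr p"
    by (simp flip: powr_mult)
  \<comment> \<open>Here p \<ge> 2 is decisive: the term 2 (1/4)^p X becomes at most half of the
    left side (1/2)^p X.\<close>
  have "(1 / 2 :: real) powr p \<le> 1 / 4"
    using p4 by (simp add: powr_divide field_simps)
  then have "2 * ((1 / 4) powr p * X) \<le> 2 * ((1 / 2) powr p * (1 / 4) * X)"
    using X0 unfolding q4 by (intro mult_left_mono mult_right_mono) auto
  then have "(1 / 2) powr p * X \<le> 4 * B" using 3 by linarith
  then have "X \<le> 4 * 2 powr p * B" by (simp add: powr_divide field_simps)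
  \<comment> \<open>Replacing 4 by 2^p collects the factors into (2 * 2 * 3)^p = 12^p, and 12 * 24 =
    288.\<close>
  also have "\<dots> \<le> (2 powr p * 2 powr p) * B"
    using p4 by (intro mult_right_mono) (auto simp: B_def)
  also have "\<dots> = (2 * 2 * 3) powr p * ((24 / real n) powr p + (2 * ?S) powr p)"
    by (simp only: B_def powr_mult mult_ac)
  also have "\<dots> \<le> 12 powr p * (24 / real n + 2 * ?S) powr p"
    using powr_superadditive[of "24 / real n" "2 * ?S" p] p by simp
  also have "\<dots> = (12 * (24 / real n + 2 * ?S)) powr p" by (rule powr_mult[symmetric])
  also have "\<dots> \<le> (288 * (1 / real n + ?S)) powr p"
    using p by (intro powr_mono2) auto
  finally show ?thesis by (simp add: X_def)
qed

text \<open>Used to free the bound from q before p tends to infinity: each q-th power is at most the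
  term itself times the (q - 1)-th power of the total.\<close>

lemma conjugate_norm_le_sum:
  fixes a :: "'i \<Rightarrow> real"
  assumes "finite S" "\<And>i. i \<in> S \<Longrightarrow> 0 \<le> a i" "1 \<le> q"
  shows "(\<Sum>i\<in>S. a i powr q) powr (1 / q) \<le> sum a S"
proof -
  have "a i powr q \<le> a i * sum a S powr (q - 1)" if "i \<in> S" for i
  proof (cases "a i = 0")
    case False
    have "a i powr q = a i powr 1 * a i powr (q - 1)" by (subst powr_add[symmetric]) simp
    also have "\<dots> = a i * a i powr (q - 1)" using assms(2)[OF that] by simp
    also have "\<dots> \<le> a i * sum a S powr (q - 1)"
      using assms that by (intro mult_left_mono powr_mono2 member_le_sum) auto
    finally show ?thesis .
  qed simp
  then have "(\<Sum>i\<in>S. a i powr q) \<le> (\<Sum>i\<in>S. a i * sum a S powr (q - 1))"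
    by (rule sum_mono)
  also have "\<dots> = sum a S * sum a S powr (q - 1)" by (simp add: sum_distrib_right)
  also have "\<dots> = sum a S powr q"
  proof (cases "sum a S = 0")
    case False
    have "sum a S powr q = sum a S powr 1 * sum a S powr (q - 1)"
      by (subst powr_add[symmetric]) simp
    then show ?thesis using assms by (simp add: sum_nonneg)
  qed simp
  finally have "(\<Sum>i\<in>S. a i powr q) powr (1 / q) \<le> (sum a S powr q) powr (1 / q)"
    using assms by (intro powr_mono2 sum_nonneg) auto
  also have "\<dots> = sum a S" using assms by (simp add: powr_powr sum_nonneg)
  finally show ?thesis .
qed

text \<open>One value is at most the p-th root of the sum over all N grid points, which costs
  N^(1/p) against the p-th mean; for fixed N this factor tends to 1.\<close>

theorem discrete_erdos_turan:
  assumes n: "n > 0" "M > 1" and per: "\<And>j. d (j mod int (n * M)) = d j"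
    and mono: "\<And>j. d (j + 1) \<ge> d j - 1 / real (n * M)"
    and d0: "discrete_fourier (n * M) d 0 = 0"
  shows "\<bar>d j\<bar> \<le> 288 * (1 / real n + (\<Sum>k\<in>{1..<n}. cmod (discrete_fourier (n * M) d (int k))))"
    (is "_ \<le> ?B")
proof -
  define N where "N = n * M"
  have N: "N > 0" using n by (simp add: N_def)
  have B: "?B \<ge> 0" by (intro mult_nonneg_nonneg add_nonneg_nonneg sum_nonneg) auto
  have bound: "\<bar>d j\<bar> \<le> real N powr (1 / p) * ?B" if p: "2 \<le> p" for p
  proof -
    define q where "q = p / (p - 1)"
    have pq: "1 / p + 1 / q = 1" using p by (simp add: q_def field_simps)
    have q: "q \<ge> 1" using conjugate_exponent[OF p pq] by simp
    have "\<bar>d j\<bar> powr p = \<bar>d (j mod int N)\<bar> powr p" using per[of j] by (simp add: N_def)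
    also have "\<dots> \<le> (\<Sum>j\<in>{0..<int N}. \<bar>d j\<bar> powr p)"
      using N by (intro member_le_sum) auto
    also have "\<dots> \<le> real N * (288 * (1 / real n +
        (\<Sum>k\<in>{1..<n}. cmod (discrete_fourier N d (int k)) powr q) powr (1 / q))) powr p"
      using discrete_erdos_turan_Lp[where d = d, OF n per mono d0 p pq] N
      by (simp add: N_def field_simps)
    also have "\<dots> \<le> real N * ?B powr p"
      unfolding N_def using q p
      by (intro mult_left_mono powr_mono2 add_left_mono conjugate_norm_le_sum mult_nonneg_nonneg) auto
    finally have "(\<bar>d j\<bar> powr p) powr (1 / p) \<le> (real N * ?B powr p) powr (1 / p)"
      using p by (intro powr_mono2) auto
    then show ?thesis using p B by (simp add: powr_mult powr_powr)
  qed
  have "((\<lambda>p. real N powr (1 / p) * ?B) \<longlongrightarrow> real N powr 0 * ?B) at_top"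
    using N by (intro tendsto_intros tendsto_divide_0[OF tendsto_const] filterlim_at_top_imp_at_infinity filterlim_ident) auto
  then have "((\<lambda>p. real N powr (1 / p) * ?B) \<longlongrightarrow> ?B) at_top"
    using N by simp
  moreover have "eventually (\<lambda>p. \<bar>d j\<bar> \<le> real N powr (1 / p) * ?B) at_top"
    using eventually_ge_at_top[of "2::real"] by eventually_elim (rule bound)
  ultimately show ?thesis
    by (rule tendsto_lowerbound) simp
qed

section \<open>Integrals over [0,1) split along a grid of step 1/N\<close>

lemma space_unif_interval: "space unif_interval = {0..<1}"
  by (simp add: unif_interval_def space_restrict_space)

lemma floor_mult_measurable: "(\<lambda>x. \<lfloor>a * x\<rfloor>) \<in> measurable borel (count_space UNIV)" for a :: real
  by (rule measurable_compose[OF _ measurable_real_floor]) simp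

lemma measurable_unif_interval:
  "f \<in> borel_measurable borel \<Longrightarrow> f \<in> borel_measurable unif_interval"
  unfolding unif_interval_def by (rule measurable_restrict_space1) simp

lemma integrable_unif_interval_bounded:
  fixes f :: "real \<Rightarrow> 'b::{banach, second_countable_topology}"
  assumes "f \<in> borel_measurable unif_interval" "\<And>x. 0 \<le> x \<Longrightarrow> x < 1 \<Longrightarrow> norm (f x) \<le> B"
  shows "integrable unif_interval f"
proof -
  interpret prob_space unif_interval by (rule prob_space_unif_interval)
  show ?thesis
    by (rule integrable_const_bound[of _ B]) (use assms in \<open>auto simp: space_unif_interval\<close>)
qed

lemma integral_unif_interval:
  fixes f :: "real \<Rightarrow> 'b::{banach, second_countable_topology}"
  shows "(LINT x|unif_interval. f x) = (LINT x|lborel. indicator {0..<1} x *\<^sub>R f x)"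
  unfolding unif_interval_def by (rule integral_restrict_space) simp

text \<open>Translating every cell to \<open>{0..<1 / real N}\<close> lets averages over different
  cells be compared pointwise under one integral.\<close>

lemma integral_cell:
  fixes f :: "real \<Rightarrow> 'b::{banach, second_countable_topology}"
  assumes j: "j \<in> {0..<int N}"
  shows "(LINT x|unif_interval. (if \<lfloor>real N * x\<rfloor> = j then f x else 0))
    = (LINT t:{0..<1 / real N}|lborel. f (of_int j / real N + t))"
proof -
  have N: "N > 0" using j by auto
  have j': "0 \<le> real_of_int j" "real_of_int j + 1 \<le> real N" using j by auto
  have "(LINT x|unif_interval. (if \<lfloor>real N * x\<rfloor> = j then f x else 0)) =
    (LINT x|lborel. indicator {0..<1} x *\<^sub>R (if \<lfloor>real N * x\<rfloor> = j then f x else 0))"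
    by (rule integral_unif_interval)
  also have "\<dots> = \<bar>1\<bar> *\<^sub>R (LINT x|lborel. indicator {0..<1} (of_int j / real N + 1 * x) *\<^sub>R
    (if \<lfloor>real N * (of_int j / real N + 1 * x)\<rfloor> = j then f (of_int j / real N + 1 * x) else 0))"
    by (rule lborel_integral_real_affine) simp
  also have "\<dots> = (LINT t:{0..<1 / real N}|lborel. f (of_int j / real N + t))"
    unfolding set_lebesgue_integral_def
  proof (simp only: abs_one scaleR_one mult_1, rule Bochner_Integration.integral_cong[OF refl])
    fix t :: real
    have 1: "\<lfloor>real N * (of_int j / real N + t)\<rfloor> = j \<longleftrightarrow> t \<in> {0..<1 / real N}"
    proof -
      have "real N * (of_int j / real N + t) = of_int j + real N * t"
        using N by (simp add: distrib_left)
      then show ?thesis using N by (simp add: floor_eq_iff pos_less_divide_eq mult.commute[of t] zero_le_mult_iff)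
    qed
    have 2: "of_int j / real N + t \<in> {0..<1}" if t: "t \<in> {0..<1 / real N}"
    proof -
      have "of_int j / real N + t < of_int j / real N + 1 / real N" using t by simp
      also have "\<dots> = (of_int j + 1) / real N" by (simp add: add_divide_distrib)
      also have "\<dots> \<le> 1" using j' N by simp
      finally show ?thesis using j' t by simp
    qed
    show "indicator {0..<1} (of_int j / real N + t) *\<^sub>R
        (if \<lfloor>real N * (of_int j / real N + t)\<rfloor> = j then f (of_int j / real N + t) else 0)
      = indicator {0..<1 / real N} t *\<^sub>R f (of_int j / real N + t)"
      unfolding 1 using 2 by (auto simp: indicator_def)
  qed
  finally show ?thesis .
qed

lemma integral_cells:
  fixes f :: "real \<Rightarrow> 'b::{banach, second_countable_topology}"
  assumes N: "N > 0" and f: "integrable unif_interval f"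
  shows "(LINT x|unif_interval. f x) = (\<Sum>j\<in>{0..<int N}. LINT x|unif_interval. (if \<lfloor>real N * x\<rfloor> = j then f x else 0))"
proof -
  have "(LINT x|unif_interval. f x) = (LINT x|unif_interval. (\<Sum>j\<in>{0..<int N}. if \<lfloor>real N * x\<rfloor> = j then f x else 0))"
  proof (rule Bochner_Integration.integral_cong[OF refl])
    fix x assume "x \<in> space unif_interval"
    then have "0 \<le> real N * x" "real N * x < real N" using N by (auto simp: space_unif_interval)
    then have "\<lfloor>real N * x\<rfloor> \<in> {0..<int N}" by (auto simp: floor_less_iff)
    then show "f x = (\<Sum>j\<in>{0..<int N}. if \<lfloor>real N * x\<rfloor> = j then f x else 0)"
      by (simp add: sum.delta)
  qed
  also have "\<dots> = (\<Sum>j\<in>{0..<int N}. LINT x|unif_interval. (if \<lfloor>real N * x\<rfloor> = j then f x else 0))"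
  proof (rule Bochner_Integration.integral_sum)
    fix j
    have "{x \<in> space unif_interval. \<lfloor>real N * x\<rfloor> = j} \<in> sets unif_interval"
      using measurable_sets[OF measurable_restrict_space1[OF floor_mult_measurable[of "real N"], of "{0..<1}"], of "{j}"]
      by (simp add: unif_interval_def vimage_def Int_def conj_commute space_restrict_space sets_restrict_space_cong[OF sets_lborel])
    from integrable_mult_indicator[OF this f]
    have "integrable unif_interval (\<lambda>x. indicator {x \<in> space unif_interval. \<lfloor>real N * x\<rfloor> = j} x *\<^sub>R f x)" .
    also have "?this \<longleftrightarrow> integrable unif_interval (\<lambda>x. if \<lfloor>real N * x\<rfloor> = j then f x else 0)"
      by (rule Bochner_Integration.integrable_cong) (simp_all add: indicator_def)
    finally show "integrable unif_interval (\<lambda>x. if \<lfloor>real N * x\<rfloor> = j then f x else 0)" .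
  qed
  finally show ?thesis .
qed

lemma integral_cell_step:
  assumes N: "N > 0"
  shows "(LINT x|unif_interval. h \<lfloor>real N * x\<rfloor>) = (\<Sum>j\<in>{0..<int N}. h j) / real N"
    and "integrable unif_interval (\<lambda>x. h \<lfloor>real N * x\<rfloor> :: real)"
proof -
  have fl: "\<lfloor>real N * x\<rfloor> \<in> {0..<int N}" if "0 \<le> x" "x < 1" for x
  proof -
    have "0 \<le> real N * x" "real N * x < real N" using N that by auto
    then show ?thesis by (auto simp: floor_less_iff)
  qed
  have m: "(\<lambda>x. h \<lfloor>real N * x\<rfloor>) \<in> borel_measurable borel"
    by (rule measurable_compose[OF floor_mult_measurable]) simp
  show int: "integrable unif_interval (\<lambda>x. h \<lfloor>real N * x\<rfloor>)"
  proof (rule integrable_unif_interval_bounded[where B = "\<Sum>j\<in>{0..<int N}. \<bar>h j\<bar>"])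
    show "norm (h \<lfloor>real N * x\<rfloor>) \<le> (\<Sum>j\<in>{0..<int N}. \<bar>h j\<bar>)" if "0 \<le> x" "x < 1" for x
      unfolding real_norm_def by (rule member_le_sum[OF fl[OF that]]) auto
  qed (rule measurable_unif_interval[OF m])
  have "(LINT x|unif_interval. (if \<lfloor>real N * x\<rfloor> = j then h \<lfloor>real N * x\<rfloor> else 0)) = h j / real N"
    if j: "j \<in> {0..<int N}" for j
  proof -
    have "(LINT x|unif_interval. (if \<lfloor>real N * x\<rfloor> = j then h \<lfloor>real N * x\<rfloor> else 0)) =
      (LINT x|unif_interval. (if \<lfloor>real N * x\<rfloor> = j then h j else 0))"
      by (intro Bochner_Integration.integral_cong) auto
    also have "\<dots> = h j / real N"
      unfolding integral_cell[OF j] set_lebesgue_integral_def by simp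
    finally show ?thesis .
  qed
  then show "(LINT x|unif_interval. h \<lfloor>real N * x\<rfloor>) = (\<Sum>j\<in>{0..<int N}. h j) / real N"
    unfolding integral_cells[OF N int] by (simp add: sum_divide_distrib)
qed

subsection \<open>One-sided Lipschitz functions on the circle\<close>

lemma set_integrable_bounded:
  fixes f :: "real \<Rightarrow> real"
  assumes "f \<in> borel_measurable borel" "\<And>x. \<bar>f x\<bar> \<le> B"
  shows "set_integrable lborel {0..<c} f"
  unfolding set_integrable_def
proof (rule Bochner_Integration.integrable_bound)
  show "integrable lborel (\<lambda>x. B * indicator {0..<c} x)"
    by (cases "0 \<le> c") auto
  have "B \<ge> 0" using assms(2)[of 0] by linarith
  then show "AE x in lborel. norm (indicator {0..<c} x *\<^sub>R f x) \<le> norm (B * indicator {0..<c} x)"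
    using assms(2) by (auto simp: indicator_def)
qed (use assms in measurable)

lemma set_integral_const:
  fixes c :: real
  assumes "N > 0"
  shows "(LINT t:{0..<1 / real N}|lborel. c) = c / real N"
  using assms by (simp add: set_lebesgue_integral_def)

lemma norm_cis_diff_le: "cmod (cis a - cis b) \<le> \<bar>a - b\<bar>"
proof -
  have "cmod (cis a - cis b) = cmod (cis b) * cmod (cis (a - b) - 1)"
    unfolding norm_mult[symmetric] right_diff_distrib cis_mult by simp
  also have "\<dots> = cmod (exp (\<i> * of_real (a - b)) - 1)"
    by (simp add: cis_conv_exp)
  also have "\<dots> \<le> \<bar>a - b\<bar>"
    using iexp_approx1[of "a - b" 0] by simp
  finally show ?thesis .
qed

text \<open>The properties of the periodic extension of D on which the grid argument rests. Such a
  function may jump up anywhere but falls at rate at most 1, so it stays large to the right of a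
  large value and small to the left of a small one.\<close>

locale sawtooth =
  fixes D :: "real \<Rightarrow> real"
  assumes meas: "D \<in> borel_measurable borel"
    and bounded: "\<bar>D x\<bar> \<le> 1"
    and periodic: "D (x + of_int m) = D x"
    and one_sided: "0 \<le> h \<Longrightarrow> D x - h \<le> D (x + h)"
begin

definition mean :: real where
  "mean = (LINT x|unif_interval. D x)"

definition coeff :: "int \<Rightarrow> complex" where
  "coeff k = (LINT x|unif_interval. D x *\<^sub>R cis (- (2 * pi * of_int k * x)))"

definition cell_avg :: "nat \<Rightarrow> int \<Rightarrow> real" where
  "cell_avg N j = real N * (LINT t:{0..<1 / real N}|lborel. D (of_int j / real N + t))"

lemma meas_shift: "(\<lambda>t. D (a + t)) \<in> borel_measurable borel"
  by (rule measurable_compose[OF _ meas]) simp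

lemma cell_integrable: "set_integrable lborel {0..<c} (\<lambda>t. D (a + t))"
  by (rule set_integrable_bounded[OF meas_shift bounded])

lemma integrable_D: "integrable unif_interval D"
  by (rule integrable_unif_interval_bounded[where B = 1]) 
    (use bounded in \<open>auto intro: measurable_unif_interval[OF meas]\<close>)

lemma cell_avg_ge:
  assumes N: "N > 0" and f: "set_integrable lborel {0..<1 / real N} f"
    and le: "\<And>t. 0 \<le> t \<Longrightarrow> t < 1 / real N \<Longrightarrow> f t \<le> D (of_int j / real N + t)"
  shows "real N * (LINT t:{0..<1 / real N}|lborel. f t) \<le> cell_avg N j"
  unfolding cell_avg_def using N
  by (intro mult_left_mono set_integral_mono f cell_integrable le) auto

lemma cell_avg_le:
  assumes N: "N > 0" and f: "set_integrable lborel {0..<1 / real N} f"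
    and le: "\<And>t. 0 \<le> t \<Longrightarrow> t < 1 / real N \<Longrightarrow> D (of_int j / real N + t) \<le> f t"
  shows "cell_avg N j \<le> real N * (LINT t:{0..<1 / real N}|lborel. f t)"
  unfolding cell_avg_def using N
  by (intro mult_left_mono set_integral_mono f cell_integrable le) auto

lemma cell_avg_mono: "N > 0 \<Longrightarrow> cell_avg N j - 1 / real N \<le> cell_avg N (j + 1)"
proof -
  assume N: "N > 0"
  have i: "set_integrable lborel {0..<1 / real N} (\<lambda>t. 1 / real N)"
    by (rule set_integrable_bounded[where B = "1 / real N"]) auto
  have "real N * (LINT t:{0..<1 / real N}|lborel. D (of_int j / real N + t) - 1 / real N) \<le> cell_avg N (j + 1)"
  proof (rule cell_avg_ge[OF N])
    show "set_integrable lborel {0..<1 / real N} (\<lambda>t. D (of_int j / real N + t) - 1 / real N)"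
      by (intro set_integral_diff cell_integrable i)
    show "D (of_int j / real N + t) - 1 / real N \<le> D (of_int (j + 1) / real N + t)" for t
      using one_sided[of "1 / real N" "of_int j / real N + t"] N
      by (simp add: add_divide_distrib algebra_simps)
  qed
  also have "real N * (LINT t:{0..<1 / real N}|lborel. D (of_int j / real N + t) - 1 / real N)
     = cell_avg N j - 1 / real N"
    using N by (simp add: set_integral_diff(2)[OF cell_integrable i] set_integral_const
      cell_avg_def right_diff_distrib)
  finally show ?thesis .
qed

lemma cell_avg_periodic: "N > 0 \<Longrightarrow> cell_avg N (j mod int N) = cell_avg N j"
proof -
  assume N: "N > 0"
  have "real_of_int j = of_int (j mod int N) + of_int (j div int N) * real N"
    by (metis mod_mult_div_eq mult.commute of_int_add of_int_mult of_int_of_nat_eq)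
  then have "of_int j / real N = of_int (j mod int N) / real N + of_int (j div int N)"
    using N by (simp add: add_divide_distrib)
  then have "D (of_int j / real N + t) = D (of_int (j mod int N) / real N + t)" for t
    using periodic[of "of_int (j mod int N) / real N + t" "j div int N"] by (simp add: ac_simps)
  then show ?thesis by (simp add: cell_avg_def)
qed

text \<open>Every point of the next cell lies to the right of x, and every point of the previous
  cell to its left, at distance at most 2 / N. This is the return from averages to D itself, jumps
  included.\<close>

lemma pointwise_cell_avg:
  assumes N: "N > 0" and j: "\<lfloor>real N * x\<rfloor> = j"
  shows "D x \<le> cell_avg N (j + 1) + 2 / real N" "cell_avg N (j - 1) - 2 / real N \<le> D x"
proof -
  have x: "of_int j / real N \<le> x" "x < of_int j / real N + 1 / real N"
    using j N by (auto simp: floor_eq_iff field_simps)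
  have e: "of_int (j + 1) / real N = of_int j / real N + 1 / real N"
    "of_int (j - 1) / real N = of_int j / real N - 1 / real N"
    by (simp_all add: add_divide_distrib diff_divide_distrib)
  have n1: "1 / real N + 1 / real N = 2 / real N" by simp
  have i: "set_integrable lborel {0..<1 / real N} (\<lambda>t. c)" for c :: real
    by (rule set_integrable_bounded[where B = "\<bar>c\<bar>"]) auto
  have "real N * (LINT t:{0..<1 / real N}|lborel. D x - 2 / real N) \<le> cell_avg N (j + 1)"
  proof (rule cell_avg_ge[OF N i])
    fix t :: real assume t: "0 \<le> t" "t < 1 / real N"
    define h where "h = of_int (j + 1) / real N + t - x"
    have h: "0 \<le> h" "h \<le> 2 / real N" using t x e(1) n1 unfolding h_def by linarith+
    then show "D x - 2 / real N \<le> D (of_int (j + 1) / real N + t)"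
      using one_sided[of h x] by (simp add: h_def)
  qed
  then show "D x \<le> cell_avg N (j + 1) + 2 / real N"
    using N by (simp add: set_integral_const[OF N])
  have "cell_avg N (j - 1) \<le> real N * (LINT t:{0..<1 / real N}|lborel. D x + 2 / real N)"
  proof (rule cell_avg_le[OF N i])
    fix t :: real assume t: "0 \<le> t" "t < 1 / real N"
    define y where "y = of_int (j - 1) / real N + t"
    have h: "0 \<le> x - y" "x - y \<le> 2 / real N" using t x e(2) n1 unfolding y_def by linarith+
    then show "D (of_int (j - 1) / real N + t) \<le> D x + 2 / real N"
      using one_sided[of "x - y" y] by (simp add: y_def)
  qed
  then show "cell_avg N (j - 1) - 2 / real N \<le> D x"
    using N by (simp add: set_integral_const[OF N])
qed

lemma integral_cell_D:
  assumes "j \<in> {0..<int N}"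
  shows "(LINT x|unif_interval. (if \<lfloor>real N * x\<rfloor> = j then D x else 0)) = cell_avg N j / real N"
  using assms unfolding integral_cell[OF assms] cell_avg_def by simp

lemma sum_cell_avg: "N > 0 \<Longrightarrow> (\<Sum>j\<in>{0..<int N}. cell_avg N j) = real N * mean"
  unfolding mean_def integral_cells[OF _ integrable_D]
  by (simp add: integral_cell_D sum_divide_distrib[symmetric])

lemma discrete_fourier_cell_avg_0:
  assumes "N > 0" shows "discrete_fourier N (\<lambda>j. cell_avg N j - mean) 0 = 0"
proof -
  have "(\<Sum>j\<in>{0..<int N}. complex_of_real (cell_avg N j - mean)) =
    complex_of_real ((\<Sum>j\<in>{0..<int N}. cell_avg N j) - real N * mean)"
    by (simp add: sum_subtractf)
  then show ?thesis using assms by (simp add: discrete_fourier_def sum_cell_avg)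
qed

text \<open>The discrete coefficient is the integral of D against the character frozen at the left
  end of each cell, and freezing changes the phase by at most 2 pi k / N. The mean is invisible at
  frequencies not divisible by N.\<close>

lemma discrete_fourier_cell_avg:
  assumes N: "N > 0" and k: "0 < k" "k < int N"
  shows "cmod (discrete_fourier N (\<lambda>j. cell_avg N j - mean) k) \<le> cmod (coeff k) + 2 * pi * of_int k / real N"
proof -
  let ?I = "{0..<int N}"
  have int1: "integrable unif_interval (\<lambda>x. D x *\<^sub>R unity_root N (- (k * \<lfloor>real N * x\<rfloor>)))"
  proof (rule integrable_unif_interval_bounded[where B = 1])
    have "(\<lambda>x. unity_root N (- (k * \<lfloor>real N * x\<rfloor>))) \<in> borel_measurable borel"
      by (rule measurable_compose[OF floor_mult_measurable]) simp
    then show "(\<lambda>x. D x *\<^sub>R unity_root N (- (k * \<lfloor>real N * x\<rfloor>))) \<in> borel_measurable unif_interval"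
      by (intro measurable_unif_interval borel_measurable_scaleR meas)
  qed (use bounded in simp)
  have "\<not> int N dvd (- k)" using k zdvd_not_zless by auto
  then have "(\<Sum>j\<in>?I. unity_root N (- (k * j))) = 0"
    using sum_unity_root[OF N, of "- k"] unfolding sum_atLeast0LessThan_int
    by (simp add: mult.commute)
  then have "discrete_fourier N (\<lambda>j. cell_avg N j - mean) k
    = (\<Sum>j\<in>?I. of_real (cell_avg N j) * unity_root N (- (k * j))) / of_nat N"
    unfolding discrete_fourier_def
    by (simp add: left_diff_distrib sum_subtractf sum_distrib_left[symmetric])
  also have "\<dots> = (\<Sum>j\<in>?I. of_real (cell_avg N j / real N) * unity_root N (- (k * j)))"
    by (simp add: sum_divide_distrib)
  also have "\<dots> = (\<Sum>j\<in>?I. LINT x|unif_interval. (if \<lfloor>real N * x\<rfloor> = j then D x *\<^sub>R unity_root N (- (k * \<lfloor>real N * x\<rfloor>)) else 0))"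
  proof (rule sum.cong[OF refl])
    fix j assume j: "j \<in> ?I"
    let ?u = "unity_root N (- (k * j))"
    have "of_real (cell_avg N j / real N) * ?u = (LINT t:{0..<1 / real N}|lborel. D (of_int j / real N + t)) *\<^sub>R ?u"
      using N by (simp add: cell_avg_def scaleR_conv_of_real)
    also have "\<dots> = (LINT t:{0..<1 / real N}|lborel. D (of_int j / real N + t) *\<^sub>R ?u)"
      using cell_integrable[of "1 / real N" "of_int j / real N"]
      by (simp add: set_lebesgue_integral_def set_integrable_def flip: integral_scaleR_left)
    also have "\<dots> = (LINT x|unif_interval. (if \<lfloor>real N * x\<rfloor> = j then D x *\<^sub>R ?u else 0))"
      by (rule integral_cell[OF j, symmetric])
    also have "\<dots> = (LINT x|unif_interval. (if \<lfloor>real N * x\<rfloor> = j then D x *\<^sub>R unity_root N (- (k * \<lfloor>real N * x\<rfloor>)) else 0))"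
      by (rule Bochner_Integration.integral_cong) auto
    finally show "of_real (cell_avg N j / real N) * unity_root N (- (k * j)) =
      (LINT x|unif_interval. (if \<lfloor>real N * x\<rfloor> = j then D x *\<^sub>R unity_root N (- (k * \<lfloor>real N * x\<rfloor>)) else 0))" .
  qed
  also have "\<dots> = (LINT x|unif_interval. D x *\<^sub>R unity_root N (- (k * \<lfloor>real N * x\<rfloor>)))"
    by (rule integral_cells[OF N int1, symmetric])
  finally have eq: "discrete_fourier N (\<lambda>j. cell_avg N j - mean) k
     = (LINT x|unif_interval. D x *\<^sub>R unity_root N (- (k * \<lfloor>real N * x\<rfloor>)))" .
  have int2: "integrable unif_interval (\<lambda>x. D x *\<^sub>R cis (- (2 * pi * of_int k * x)))"
  proof (rule integrable_unif_interval_bounded[where B = 1])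
    have "(\<lambda>x. cis (- (2 * pi * of_int k * x))) \<in> borel_measurable borel"
      by (intro borel_measurable_continuous_onI continuous_intros)
    then show "(\<lambda>x. D x *\<^sub>R cis (- (2 * pi * of_int k * x))) \<in> borel_measurable unif_interval"
      by (intro measurable_unif_interval borel_measurable_scaleR meas)
  qed (use bounded in simp)
  have "cmod (discrete_fourier N (\<lambda>j. cell_avg N j - mean) k - coeff k)
    = cmod (LINT x|unif_interval. D x *\<^sub>R unity_root N (- (k * \<lfloor>real N * x\<rfloor>)) - D x *\<^sub>R cis (- (2 * pi * of_int k * x)))"
    unfolding eq coeff_def Bochner_Integration.integral_diff[OF int1 int2] ..
  also have "\<dots> \<le> (LINT x|unif_interval. 2 * pi * of_int k / real N)"
  proof (rule Bochner_Integration.integral_norm_bound_integral)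
    interpret prob_space unif_interval by (rule prob_space_unif_interval)
    show "integrable unif_interval (\<lambda>x. 2 * pi * of_int k / real N)" by simp
    fix x
    have fl: "\<bar>of_int \<lfloor>real N * x\<rfloor> - real N * x\<bar> \<le> 1" by linarith
    have "cmod (unity_root N (- (k * \<lfloor>real N * x\<rfloor>)) - cis (- (2 * pi * of_int k * x)))
      \<le> \<bar>2 * pi * of_int (- (k * \<lfloor>real N * x\<rfloor>)) / real N - (- (2 * pi * of_int k * x))\<bar>"
      unfolding unity_root_def by (rule norm_cis_diff_le)
    also have "2 * pi * of_int (- (k * \<lfloor>real N * x\<rfloor>)) / real N - (- (2 * pi * of_int k * x))
      = - (2 * pi * of_int k / real N * (of_int \<lfloor>real N * x\<rfloor> - real N * x))"
      using N by (simp add: field_simps)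
    also have "\<bar>\<dots>\<bar> = 2 * pi * of_int k / real N * \<bar>of_int \<lfloor>real N * x\<rfloor> - real N * x\<bar>"
      using k by (simp add: abs_mult)
    also have "\<dots> \<le> 2 * pi * of_int k / real N * 1"
      using k by (intro mult_left_mono fl) auto
    finally have "cmod (unity_root N (- (k * \<lfloor>real N * x\<rfloor>)) - cis (- (2 * pi * of_int k * x)))
      \<le> 2 * pi * of_int k / real N" by simp
    then have "\<bar>D x\<bar> * cmod (unity_root N (- (k * \<lfloor>real N * x\<rfloor>)) - cis (- (2 * pi * of_int k * x)))
      \<le> 1 * (2 * pi * of_int k / real N)"
      using bounded by (intro mult_mono) auto
    then show "cmod (D x *\<^sub>R unity_root N (- (k * \<lfloor>real N * x\<rfloor>)) - D x *\<^sub>R cis (- (2 * pi * of_int k * x)))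
      \<le> 2 * pi * of_int k / real N"
      by (simp flip: scaleR_diff_right)
  qed (use int1 int2 in auto)
  also have "\<dots> = 2 * pi * of_int k / real N"
    using prob_space.prob_space[OF prob_space_unif_interval] by simp
  finally show ?thesis
    using norm_triangle_sub[of "discrete_fourier N (\<lambda>j. cell_avg N j - mean) k" "coeff k"] by linarith
qed

end

section \<open>Letting the grid become fine, and the pairing with D minus its mean\<close>

context sawtooth
begin

text \<open>M tends to infinity with n fixed. The powers are continuous even where a coefficient is
  0, because the exponents are positive and the bases nonnegative.\<close>

lemma limit_cells:
  assumes n: "n > 0" and q: "1 \<le> q"
    and le: "\<And>M. M > 1 \<Longrightarrow> X \<le> 6 * (288 * (1 / real n +
      (\<Sum>k\<in>{1..<n}. (cmod (coeff (int k)) + 2 * pi * real k / real (n * M)) powr q) powr (1 / q))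
       + 2 / real (n * M))"
  shows "X \<le> 1728 * (1 / real n + (\<Sum>k\<in>{1..<n}. cmod (coeff (int k)) powr q) powr (1 / q))"
proof -
  have t: "(\<lambda>M. c / real (n * M)) \<longlonglongrightarrow> 0" for c :: real
  proof -
    have "(\<lambda>M. (c / real n) * inverse (real M)) \<longlonglongrightarrow> (c / real n) * 0"
      by (intro tendsto_intros lim_inverse_n)
    then show ?thesis by (simp add: divide_inverse mult_ac)
  qed
  have "(\<lambda>M. \<Sum>k\<in>{1..<n}. (cmod (coeff (int k)) + 2 * pi * real k / real (n * M)) powr q)
      \<longlonglongrightarrow> (\<Sum>k\<in>{1..<n}. (cmod (coeff (int k)) + 0) powr q)"
  proof (intro tendsto_sum tendsto_powr' tendsto_add tendsto_const t)
    fix k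
    show "cmod (coeff (int k)) + 0 \<noteq> 0 \<or> 0 < q \<and>
      (\<forall>\<^sub>F M in sequentially. 0 \<le> cmod (coeff (int k)) + 2 * pi * real k / real (n * M))"
      using q by (intro disjI2 conjI always_eventually allI) auto
  qed
  then have "(\<lambda>M. (\<Sum>k\<in>{1..<n}. (cmod (coeff (int k)) + 2 * pi * real k / real (n * M)) powr q) powr (1 / q))
      \<longlonglongrightarrow> (\<Sum>k\<in>{1..<n}. (cmod (coeff (int k)) + 0) powr q) powr (1 / q)"
    using q by (intro tendsto_powr' tendsto_const) (auto intro!: always_eventually sum_nonneg)
  then have "(\<lambda>M. 6 * (288 * (1 / real n +
      (\<Sum>k\<in>{1..<n}. (cmod (coeff (int k)) + 2 * pi * real k / real (n * M)) powr q) powr (1 / q))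
       + 2 / real (n * M))) \<longlonglongrightarrow>
      6 * (288 * (1 / real n + (\<Sum>k\<in>{1..<n}. (cmod (coeff (int k)) + 0) powr q) powr (1 / q)) + 0)"
    by (intro tendsto_mult tendsto_add tendsto_const t)
  then have "X \<le> 6 * (288 * (1 / real n + (\<Sum>k\<in>{1..<n}. (cmod (coeff (int k)) + 0) powr q) powr (1 / q)) + 0)"
    by (rule LIMSEQ_le_const) (use le in \<open>auto intro!: exI[of _ 2]\<close>)
  then show ?thesis by (simp add: distrib_left)
qed

lemma sum_cell_fourier_le:
  assumes n: "n > 0" "M > 1" and q: "1 \<le> q"
  shows "(\<Sum>k\<in>{1..<n}. cmod (discrete_fourier (n * M) (\<lambda>j. cell_avg (n * M) j - mean) (int k)) powr q) powr (1 / q)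
    \<le> (\<Sum>k\<in>{1..<n}. (cmod (coeff (int k)) + 2 * pi * real k / real (n * M)) powr q) powr (1 / q)"
proof (intro powr_mono2 sum_mono)
  fix k assume k: "k \<in> {1..<n}"
  have "k < n * M" using k n by (auto intro: less_le_trans)
  then have "int k < int (n * M)" by (simp only: of_nat_less_iff)
  then show "cmod (discrete_fourier (n * M) (\<lambda>j. cell_avg (n * M) j - mean) (int k))
    \<le> cmod (coeff (int k)) + 2 * pi * real k / real (n * M)"
    using discrete_fourier_cell_avg[of "n * M" "int k"] k n by simp
qed (use q in \<open>auto intro!: sum_nonneg\<close>)

text \<open>Dominates the deviation of D from its mean on cell j from above and from below. It
  depends on x only through the cell of x, so its p-th mean is a finite sum.\<close>

definition cell_bound :: "nat \<Rightarrow> int \<Rightarrow> real" where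
  "cell_bound N j = \<bar>cell_avg N (j + 1) - mean\<bar> + \<bar>cell_avg N (j - 1) - mean\<bar> + 2 / real N"

lemma deviation_le_cell_bound: "N > 0 \<Longrightarrow> \<bar>D x - mean\<bar> \<le> cell_bound N \<lfloor>real N * x\<rfloor>"
  using pointwise_cell_avg[of N x, OF _ refl] unfolding cell_bound_def by fastforce

lemma deviation_integrable:
  assumes "integrable unif_interval g"
  shows "integrable unif_interval (\<lambda>x. g x * (D x - mean))"
proof (rule Bochner_Integration.integrable_bound)
  show "integrable unif_interval (\<lambda>x. (1 + \<bar>mean\<bar>) * g x)" using assms by simp
  show "(\<lambda>x. g x * (D x - mean)) \<in> borel_measurable unif_interval"
    using assms measurable_unif_interval[OF meas] by simp
  have "\<bar>g x\<bar> * \<bar>D x - mean\<bar> \<le> \<bar>g x\<bar> * (1 + \<bar>mean\<bar>)" for x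
    using bounded[of x] by (intro mult_left_mono) auto
  then show "AE x in unif_interval. norm (g x * (D x - mean)) \<le> norm ((1 + \<bar>mean\<bar>) * g x)"
    by (auto simp: abs_mult mult.commute)
qed

text \<open>The majorant h is left open: it is a multiple of |g| when q = 1, and the right side of
  Young's inequality when q > 1.\<close>

lemma deviation_norm_le:
  assumes N: "N > 0" and g: "integrable unif_interval g" and h: "integrable unif_interval h"
    and le: "\<And>x. 0 \<le> x \<Longrightarrow> x < 1 \<Longrightarrow> \<bar>g x\<bar> * cell_bound N \<lfloor>real N * x\<rfloor> \<le> h x"
  shows "\<bar>LINT x|unif_interval. g x * (D x - mean)\<bar> \<le> (LINT x|unif_interval. h x)"
  unfolding real_norm_def[symmetric]
proof (rule Bochner_Integration.integral_norm_bound_integral)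
  fix x assume "x \<in> space unif_interval"
  then have x: "0 \<le> x" "x < 1" by (auto simp: space_unif_interval)
  have "norm (g x * (D x - mean)) = \<bar>g x\<bar> * \<bar>D x - mean\<bar>" by (simp add: abs_mult)
  also have "\<dots> \<le> \<bar>g x\<bar> * cell_bound N \<lfloor>real N * x\<rfloor>"
    by (intro mult_left_mono deviation_le_cell_bound N) auto
  also have "\<dots> \<le> h x" using le x by simp
  finally show "norm (g x * (D x - mean)) \<le> h x" .
qed (use g h deviation_integrable in auto)

lemma cell_bound_nonneg: "0 \<le> cell_bound N j"
  by (simp add: cell_bound_def)

text \<open>The case p = \<infinity>, where the grid inequality is a uniform bound and can be taken
  out of the integral. The exponents 1 are written out in the proof to match
  \<open>limit_cells\<close>.\<close>

theorem deviation_L1: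
  assumes n: "n > 0" and g: "integrable unif_interval g" "(LINT x|unif_interval. \<bar>g x\<bar>) \<le> 1"
  shows "\<bar>LINT x|unif_interval. g x * (D x - mean)\<bar> \<le>
    1728 * (1 / real n + (\<Sum>k\<in>{1..<n}. cmod (coeff (int k))))"
proof -
  have "\<bar>LINT x|unif_interval. g x * (D x - mean)\<bar> \<le>
    1728 * (1 / real n + (\<Sum>k\<in>{1..<n}. cmod (coeff (int k)) powr 1) powr (1 / 1))"
  proof (rule limit_cells[OF n order_refl])
    fix M :: nat assume M: "M > 1"
    define N where "N = n * M"
    define S where "S = (\<Sum>k\<in>{1..<n}. (cmod (coeff (int k)) + 2 * pi * real k / real (n * M)) powr 1) powr (1 / 1)"
    define W where "W = 6 * (288 * (1 / real n + S) + 2 / real N)"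
    have N: "N > 0" using n M by (simp add: N_def)
    have S: "S \<ge> 0" by (simp add: S_def)
    have d: "\<bar>cell_avg N j - mean\<bar> \<le> 288 * (1 / real n + S)" for j
    proof -
      have "\<bar>cell_avg N j - mean\<bar> \<le> 288 * (1 / real n +
          (\<Sum>k\<in>{1..<n}. cmod (discrete_fourier N (\<lambda>j. cell_avg N j - mean) (int k))))"
        unfolding N_def
      proof (rule discrete_erdos_turan[where d = "\<lambda>j. cell_avg (n * M) j - mean", OF n M])
        show "cell_avg (n * M) (j + 1) - mean \<ge> cell_avg (n * M) j - mean - 1 / real (n * M)" for j
          using cell_avg_mono[of N j] N unfolding N_def by linarith
      qed (use N discrete_fourier_cell_avg_0 in \<open>auto simp: N_def cell_avg_periodic[of "n * M", simplified]\<close>)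
      also have "\<dots> \<le> 288 * (1 / real n + S)"
        using sum_cell_fourier_le[OF n M, of 1] by (simp add: S_def N_def sum_nonneg)
      finally show ?thesis .
    qed
    have "\<bar>LINT x|unif_interval. g x * (D x - mean)\<bar> \<le> (LINT x|unif_interval. W * \<bar>g x\<bar>)"
    proof (rule deviation_norm_le[OF N g(1)])
      fix x
      \<comment> \<open>The factor 6 is generous here; it is the one that finite p produces, so that
        both cases share \<open>limit_cells\<close>.\<close>
      have arith: "a + b + v \<le> 6 * (288 * (u + S) + v)"
        if "a \<le> 288 * (u + S)" "b \<le> 288 * (u + S)" "0 \<le> u" "0 \<le> v" for a b u v :: real
        using that S by (simp add: algebra_simps)
      have "cell_bound N \<lfloor>real N * x\<rfloor> \<le> W"
        unfolding cell_bound_def W_def by (rule arith[OF d d]) simp_all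
      then show "\<bar>g x\<bar> * cell_bound N \<lfloor>real N * x\<rfloor> \<le> W * \<bar>g x\<bar>"
        by (subst mult.commute[of W]) (rule mult_left_mono, auto)
    qed (use g in simp)
    also have "\<dots> \<le> W * 1"
      unfolding integral_mult_right_zero using g S by (intro mult_left_mono) (auto simp: W_def)
    finally show "\<bar>LINT x|unif_interval. g x * (D x - mean)\<bar> \<le> 6 * (288 * (1 / real n + 
      (\<Sum>k\<in>{1..<n}. (cmod (coeff (int k)) + 2 * pi * real k / real (n * M)) powr 1) powr (1 / 1)) + 2 / real (n * M))"
      by (simp add: W_def S_def N_def)
  qed
  then show ?thesis by (simp add: sum_nonneg)
qed

text \<open>Hoelder's inequality in normalised form: |g|^q has integral at most 1,
  \<open>cell_bound\<close> divided by W has p-th mean at most 1, and so Young's inequality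
  integrates to 1 / q + 1 / p = 1.\<close>

theorem deviation_Lp:
  assumes n: "n > 0" and p: "2 \<le> p" "1 / p + 1 / q = 1"
    and g: "integrable unif_interval g" "integrable unif_interval (\<lambda>x. \<bar>g x\<bar> powr q)" "(LINT x|unif_interval. \<bar>g x\<bar> powr q) \<le> 1"
  shows "\<bar>LINT x|unif_interval. g x * (D x - mean)\<bar> \<le>
    1728 * (1 / real n + (\<Sum>k\<in>{1..<n}. cmod (coeff (int k)) powr q) powr (1 / q))"
proof (rule limit_cells[OF n])
  note q = conjugate_exponent(2,3)[OF p]
  show "1 \<le> q" using q by simp
  fix M :: nat assume M: "M > 1"
  define N where "N = n * M"
  define S where "S = (\<Sum>k\<in>{1..<n}. (cmod (coeff (int k)) + 2 * pi * real k / real (n * M)) powr q) powr (1 / q)"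
  define B where "B = 288 * (1 / real n + S)"
  \<comment> \<open>The three terms of \<open>cell_bound\<close> cost 3^p, and the two that are
    bounded by B^p cost 2 \<le> 2^p; together this is 6^p. The term 2 / N keeps W positive for the
    division.\<close>
  define W where "W = 6 * (B + 2 / real N)"
  have N: "N > 0" using n M by (simp add: N_def)
  have B: "B \<ge> 0" by (simp add: B_def S_def)
  have W: "W > 0" using B N by (simp add: W_def add_nonneg_pos)
  let ?d = "\<lambda>j. cell_avg N j - mean" and ?I = "{0..<int N}"
  have per: "?d (j mod int N) = ?d j" for j by (simp add: cell_avg_periodic[OF N])
  have sd: "(\<Sum>j\<in>?I. \<bar>?d j\<bar> powr p) \<le> real N * B powr p"
  proof -
    have "(\<Sum>j\<in>?I. \<bar>?d j\<bar> powr p) / real N \<le> (288 * (1 / real n +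
        (\<Sum>k\<in>{1..<n}. cmod (discrete_fourier N ?d (int k)) powr q) powr (1 / q))) powr p"
      unfolding N_def
    proof (rule discrete_erdos_turan_Lp[where d = "\<lambda>j. cell_avg (n * M) j - mean", OF n M _ _ _ p])
      show "cell_avg (n * M) (j + 1) - mean \<ge> cell_avg (n * M) j - mean - 1 / real (n * M)" for j
        using cell_avg_mono[of N j] N unfolding N_def by linarith
      show "cell_avg (n * M) (j mod int (n * M)) - mean = cell_avg (n * M) j - mean" for j
        using per by (simp only: N_def)
      show "discrete_fourier (n * M) (\<lambda>j. cell_avg (n * M) j - mean) 0 = 0"
        using discrete_fourier_cell_avg_0[OF N] by (simp only: N_def)
    qed
    also have "\<dots> \<le> B powr p"
      unfolding B_def S_def N_def using p q
      by (intro powr_mono2 mult_left_mono add_left_mono sum_cell_fourier_le n M) auto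
    finally show ?thesis using N by (simp add: field_simps)
  qed
  have sb: "(\<Sum>j\<in>?I. (cell_bound N j / W) powr p) \<le> real N"
  proof -
    have "(\<Sum>j\<in>?I. cell_bound N j powr p) \<le> (\<Sum>j\<in>?I. 3 powr p * (\<bar>?d (j + 1)\<bar> powr p + \<bar>?d (j + -1)\<bar> powr p + (2 / real N) powr p))"
      unfolding cell_bound_def using p by (intro sum_mono) (auto intro!: powr_add3_le)
    also have "\<dots> = 3 powr p * ((\<Sum>j\<in>?I. \<bar>?d (j + 1)\<bar> powr p) + (\<Sum>j\<in>?I. \<bar>?d (j + -1)\<bar> powr p) + real N * (2 / real N) powr p)"
      by (simp add: sum_distrib_left[symmetric] sum.distrib)
    also have "(\<Sum>j\<in>?I. \<bar>?d (j + 1)\<bar> powr p) = (\<Sum>j\<in>?I. \<bar>?d j\<bar> powr p)"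
      by (rule sum_periodic_shift[OF N, where g = "\<lambda>j. \<bar>?d j\<bar> powr p"]) (simp only: per)
    also have "(\<Sum>j\<in>?I. \<bar>?d (j + -1)\<bar> powr p) = (\<Sum>j\<in>?I. \<bar>?d j\<bar> powr p)"
      by (rule sum_periodic_shift[OF N, where g = "\<lambda>j. \<bar>?d j\<bar> powr p"]) (simp only: per)
    also have "3 powr p * ((\<Sum>j\<in>?I. \<bar>?d j\<bar> powr p) + (\<Sum>j\<in>?I. \<bar>?d j\<bar> powr p) + real N * (2 / real N) powr p)
      \<le> 3 powr p * (real N * B powr p + real N * B powr p + real N * (2 / real N) powr p)"
      by (intro mult_left_mono add_mono sd) auto
    also have "\<dots> = real N * (3 powr p * (2 * B powr p + 1 * (2 / real N) powr p))"
      by (simp add: algebra_simps)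
    also have "\<dots> \<le> real N * (3 powr p * (2 powr p * B powr p + 2 powr p * (2 / real N) powr p))"
    proof -
      have "2 powr 1 \<le> (2::real) powr p" by (rule powr_mono) (use p in auto)
      then have "2 \<le> (2::real) powr p" by simp
      then show ?thesis
        by (intro mult_left_mono add_mono mult_right_mono) auto
    qed
    also have "\<dots> = real N * ((3 * 2) powr p * (B powr p + (2 / real N) powr p))"
      by (simp only: powr_mult distrib_left mult_ac)
    also have "\<dots> \<le> real N * ((3 * 2) powr p * (B + 2 / real N) powr p)"
      using B p by (intro mult_left_mono powr_superadditive) auto
    also have "\<dots> = real N * W powr p"
      by (simp only: W_def powr_mult[symmetric]) simp
    finally have "(\<Sum>j\<in>?I. cell_bound N j powr p) / W powr p \<le> real N"
      using W by (simp add: field_simps)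
    then show ?thesis using W
      by (simp add: powr_divide cell_bound_nonneg sum_divide_distrib)
  qed
  have "\<bar>LINT x|unif_interval. g x * (D x - mean)\<bar> \<le>
     (LINT x|unif_interval. W * (\<bar>g x\<bar> powr q / q + (cell_bound N \<lfloor>real N * x\<rfloor> / W) powr p / p))"
  proof (rule deviation_norm_le[OF N g(1)])
    show "integrable unif_interval (\<lambda>x. W * (\<bar>g x\<bar> powr q / q + (cell_bound N \<lfloor>real N * x\<rfloor> / W) powr p / p))"
      using g(2) integral_cell_step(2)[OF N, of "\<lambda>j. (cell_bound N j / W) powr p"] by simp
    fix x
    have "\<bar>g x\<bar> * (cell_bound N \<lfloor>real N * x\<rfloor> / W)
        \<le> \<bar>g x\<bar> powr q / q + (cell_bound N \<lfloor>real N * x\<rfloor> / W) powr p / p"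
      using q p W by (intro Youngs_inequality) (auto simp: cell_bound_nonneg add.commute)
    then have "W * (\<bar>g x\<bar> * (cell_bound N \<lfloor>real N * x\<rfloor> / W))
        \<le> W * (\<bar>g x\<bar> powr q / q + (cell_bound N \<lfloor>real N * x\<rfloor> / W) powr p / p)"
      using W by (intro mult_left_mono) auto
    then show "\<bar>g x\<bar> * cell_bound N \<lfloor>real N * x\<rfloor>
        \<le> W * (\<bar>g x\<bar> powr q / q + (cell_bound N \<lfloor>real N * x\<rfloor> / W) powr p / p)"
      using W by simp
  qed
  also have "\<dots> = W * ((LINT x|unif_interval. \<bar>g x\<bar> powr q) / q +
      ((\<Sum>j\<in>?I. (cell_bound N j / W) powr p) / real N) / p)"
    using g(2) integral_cell_step[OF N, of "\<lambda>j. (cell_bound N j / W) powr p"] by simp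
  also have "\<dots> \<le> W * (1 / q + 1 / p)"
    using W q p g(3) sb N by (intro mult_left_mono add_mono divide_right_mono) auto
  also have "\<dots> = W" using p by (simp add: add.commute)
  finally show "\<bar>LINT x|unif_interval. g x * (D x - mean)\<bar> \<le> 6 * (288 * (1 / real n +
      (\<Sum>k\<in>{1..<n}. (cmod (coeff (int k)) + 2 * pi * real k / real (n * M)) powr q) powr (1 / q))
       + 2 / real (n * M))"
    by (simp add: W_def B_def S_def N_def)
qed

end

subsection \<open>Smooth test functions and weak derivatives\<close>

text \<open>Coinduction: a class of functions closed under differentiation consists of smooth
  functions. Each closure property below then amounts to finding a suitable class.\<close>

lemma smooth_coinduct:
  assumes "P f" and step: "\<And>f. P f \<Longrightarrow> \<exists>f'. (\<forall>x. (f has_field_derivative f' x) (at x)) \<and> P f'"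
  shows "smooth f"
  unfolding smooth_def
proof (intro allI)
  fix n x
  have deriv: "P (deriv f)" if f: "P f" for f
  proof -
    obtain f' where f': "\<And>x. (f has_field_derivative f' x) (at x)" "P f'" using step[OF f] by blast
    then have "deriv f = f'" by (intro ext DERIV_imp_deriv)
    then show ?thesis using f' by simp
  qed
  have "P ((deriv ^^ n) f)" by (induction n) (auto simp: assms(1) deriv)
  then show "(deriv ^^ n) f field_differentiable at x"
    using step field_differentiable_def by blast
qed

lemma smooth_has_derivative: "smooth f \<Longrightarrow> (f has_field_derivative deriv f x) (at x)"
  unfolding smooth_def using field_differentiable_derivI by (metis funpow_0)

lemma smooth_deriv: "smooth f \<Longrightarrow> smooth (deriv f)"
  unfolding smooth_def by (metis comp_apply funpow_Suc_right)

lemma smooth_continuous: "smooth f \<Longrightarrow> continuous_on A f"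
  using smooth_has_derivative DERIV_continuous_on has_field_derivative_at_within by blast

lemma smooth_const: "smooth (\<lambda>x. c)"
  by (rule smooth_coinduct[where P = "\<lambda>f. \<exists>c. f = (\<lambda>x. c)"])
    (auto intro!: exI[of _ "\<lambda>x. 0"] derivative_eq_intros)

lemma smooth_antiderivative:
  assumes "\<And>x. (F has_field_derivative f x) (at x)" "smooth f"
  shows "smooth F"
proof (rule smooth_coinduct[where P = "\<lambda>g. g = F \<or> smooth g"])
  fix g assume "g = F \<or> smooth g"
  then show "\<exists>g'. (\<forall>x. (g has_field_derivative g' x) (at x)) \<and> (g' = F \<or> smooth g')"
    using assms smooth_has_derivative smooth_deriv by blast
qed simp

lemma smooth_affine:
  assumes "smooth f" shows "smooth (\<lambda>x. k * f (c * x + d))"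
proof (rule smooth_coinduct[where P = "\<lambda>g. \<exists>f k. smooth f \<and> g = (\<lambda>x. k * f (c * x + d))"])
  fix g assume "\<exists>f k. smooth f \<and> g = (\<lambda>x. k * f (c * x + d))"
  then obtain f k where f: "smooth f" and g: "g = (\<lambda>x. k * f (c * x + d))" by blast
  have "(g has_field_derivative (k * c) * deriv f (c * x + d)) (at x)" for x
    unfolding g by (auto intro!: derivative_eq_intros DERIV_chain2[OF smooth_has_derivative[OF f]])
  then show "\<exists>g'. (\<forall>x. (g has_field_derivative g' x) (at x)) \<and> (\<exists>f k. smooth f \<and> g' = (\<lambda>x. k * f (c * x + d)))"
    using smooth_deriv[OF f] by (intro exI[of _ "\<lambda>x. (k * c) * deriv f (c * x + d)"]) blast
qed (use assms in blast)

lemma smooth_add: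
  assumes "smooth f" "smooth g" shows "smooth (\<lambda>x. f x + g x)"
proof (rule smooth_coinduct[where P = "\<lambda>h. \<exists>f g. smooth f \<and> smooth g \<and> h = (\<lambda>x. f x + g x)"])
  fix h assume "\<exists>f g. smooth f \<and> smooth g \<and> h = (\<lambda>x. f x + g x)"
  then obtain f g where f: "smooth f" "smooth g" and h: "h = (\<lambda>x. f x + g x)" by blast
  have "(h has_field_derivative deriv f x + deriv g x) (at x)" for x
    unfolding h by (intro DERIV_add smooth_has_derivative f)
  then show "\<exists>h'. (\<forall>x. (h has_field_derivative h' x) (at x)) \<and>
      (\<exists>f g. smooth f \<and> smooth g \<and> h' = (\<lambda>x. f x + g x))"
    using f smooth_deriv by (intro exI[of _ "\<lambda>x. deriv f x + deriv g x"]) blast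
qed (use assms in blast)

text \<open>Unlike the products of two smooth functions, their finite sums are closed under
  differentiation.\<close>

inductive sum_of_products :: "(real \<Rightarrow> real) \<Rightarrow> bool" where
  prod: "smooth f \<Longrightarrow> smooth g \<Longrightarrow> sum_of_products (\<lambda>x. f x * g x)"
| add: "sum_of_products f \<Longrightarrow> sum_of_products g \<Longrightarrow> sum_of_products (\<lambda>x. f x + g x)"

lemma smooth_mult:
  assumes "smooth f" "smooth g" shows "smooth (\<lambda>x. f x * g x)"
proof (rule smooth_coinduct[where P = sum_of_products])
  fix h assume "sum_of_products h"
  then show "\<exists>h'. (\<forall>x. (h has_field_derivative h' x) (at x)) \<and> sum_of_products h'"
  proof induction
    case (prod f g)
    have "((\<lambda>x. f x * g x) has_field_derivative deriv f x * g x + f x * deriv g x) (at x)" for x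
      by (auto intro!: derivative_eq_intros smooth_has_derivative prod)
    moreover have "sum_of_products (\<lambda>x. deriv f x * g x + f x * deriv g x)"
      by (intro sum_of_products.intros smooth_deriv prod)
    ultimately show ?case by (intro exI[of _ "\<lambda>x. deriv f x * g x + f x * deriv g x"]) simp
  next
    case (add f g)
    then obtain f' g' where "\<And>x. (f has_field_derivative f' x) (at x)" "sum_of_products f'"
      "\<And>x. (g has_field_derivative g' x) (at x)" "sum_of_products g'" by blast
    then show ?case
      by (intro exI[of _ "\<lambda>x. f' x + g' x"]) (auto intro: DERIV_add sum_of_products.add)
  qed
qed (intro sum_of_products.prod assms)

text \<open>The classical flat function exp(-1/x), with a polynomial in 1/x in front to make the
  family closed under differentiation.\<close>

definition flat_exp :: "real poly \<Rightarrow> real \<Rightarrow> real" where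
  "flat_exp p x = (if x > 0 then poly p (1 / x) * exp (- (1 / x)) else 0)"

lemma poly_times_exp_minus_tendsto_0: "((\<lambda>y. poly p y * exp (- y)) \<longlongrightarrow> (0::real)) at_top"
proof -
  have "((\<lambda>y. \<Sum>i\<le>degree p. coeff p i * (y ^ i / exp y)) \<longlongrightarrow> (\<Sum>i\<le>degree p. coeff p i * 0)) at_top"
    by (intro tendsto_intros tendsto_power_div_exp_0)
  then show ?thesis
    by (simp add: poly_altdef exp_minus divide_inverse sum_distrib_right mult.assoc)
qed

text \<open>With y = 1/x, differentiating p(y) exp(-y) in x gives y^2 (p - p')(y) exp(-y). At 0 the
  difference quotient tends to 0 because the exponential beats every polynomial.\<close>

lemma flat_exp_has_derivative:
  "(flat_exp p has_field_derivative flat_exp ([:0, 0, 1:] * (p - pderiv p)) x) (at x)"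
proof -
  consider "x > 0" | "x < 0" | "x = 0" by linarith
  then show ?thesis
  proof cases
    case 1
    have "((\<lambda>x. poly p (1 / x) * exp (- (1 / x))) has_field_derivative
        flat_exp ([:0, 0, 1:] * (p - pderiv p)) x) (at x)"
      using 1 by (auto intro!: derivative_eq_intros DERIV_chain2[OF poly_DERIV]
        simp: flat_exp_def field_simps power2_eq_square)
    then show ?thesis
      by (rule has_field_derivative_transform_within_open[where S = "{0<..}"])
        (use 1 in \<open>auto simp: flat_exp_def\<close>)
  next
    case 2
    have "((\<lambda>x. 0) has_field_derivative flat_exp ([:0, 0, 1:] * (p - pderiv p)) x) (at x)"
      using 2 by (simp add: flat_exp_def)
    then show ?thesis
      by (rule has_field_derivative_transform_within_open[where S = "{..<0}"])
        (use 2 in \<open>auto simp: flat_exp_def\<close>)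
  next
    case 3
    have l: "((\<lambda>y. flat_exp p y / y) \<longlongrightarrow> 0) (at_left 0)"
      by (rule tendsto_eventually) (auto simp: eventually_at_filter flat_exp_def)
    \<comment> \<open>Dividing \<open>flat_exp p\<close> by its argument multiplies the polynomial
      by its variable, which is \<open>pCons 0 p\<close>.\<close>
    have "((\<lambda>y. poly (pCons 0 p) (inverse y) * exp (- inverse y)) \<longlongrightarrow> 0) (at_right 0)"
      using filterlim_compose[OF poly_times_exp_minus_tendsto_0 filterlim_inverse_at_top_right] .
    then have r: "((\<lambda>y. flat_exp p y / y) \<longlongrightarrow> 0) (at_right 0)"
      by (rule Lim_transform_eventually)
        (auto simp: eventually_at_filter flat_exp_def divide_inverse)
    have "((\<lambda>y. flat_exp p y / y) \<longlongrightarrow> 0) (at 0)"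
      using l r by (simp add: filterlim_at_split)
    then show ?thesis
      by (simp add: 3 has_field_derivative_iff) (simp add: flat_exp_def)
  qed
qed

lemma smooth_flat_exp: "smooth (flat_exp p)"
  by (rule smooth_coinduct[where P = "\<lambda>f. \<exists>p. f = flat_exp p"]) (use flat_exp_has_derivative in blast)+

text \<open>The step is the normalised primitive of a bump on (0,1), the product of a flat function
  at 0 and its mirror image at 1.\<close>

lemma smooth_step_exists:
  obtains S :: "real \<Rightarrow> real" where "smooth S" "\<And>x. x \<le> 0 \<Longrightarrow> S x = 0" "\<And>x. 1 \<le> x \<Longrightarrow> S x = 1"
    "\<And>x. 0 \<le> S x" "\<And>x. S x \<le> 1" "\<And>x. x \<notin> {0<..<1} \<Longrightarrow> deriv S x = 0"
proof -
  define b where "b = (\<lambda>x. flat_exp 1 x * (1 * flat_exp 1 ((-1) * x + 1)))"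
  have b: "smooth b" unfolding b_def by (intro smooth_mult smooth_affine smooth_flat_exp)
  have b_out: "b x = 0" if "x \<notin> {0<..<1}" for x using that by (auto simp: b_def flat_exp_def)
  have b_in: "b x > 0" if "0 < x" "x < 1" for x using that by (auto simp: b_def flat_exp_def)
  have b_nonneg: "b x \<ge> 0" for x using b_out[of x] b_in[of x] by (cases "x \<in> {0<..<1}") auto
  \<comment> \<open>Starting at -1 leaves room to the left of 0 for a two-sided derivative there.
    For x < -1 the interval is empty and F is 0, as it should be.\<close>
  define F where "F = (\<lambda>x. integral {-1..x} b)"
  have F0: "F x = 0" if "x \<le> 0" for x
  proof -
    have "integral {-1..x} b = integral {-1..x} (\<lambda>x. 0)"
      by (rule Henstock_Kurzweil_Integration.integral_cong) (use that b_out in auto)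
    then show ?thesis by (simp add: F_def)
  qed
  have dF: "(F has_field_derivative b t) (at t)" for t
  proof (cases "t < 0")
    case True
    have "((\<lambda>x. 0) has_field_derivative b t) (at t)" using True by (simp add: b_out)
    then show ?thesis
      by (rule has_field_derivative_transform_within_open[where S = "{..<0}"])
        (use True F0 in auto)
  next
    case False
    have "(F has_field_derivative b t) (at t within {-1..t + 1})"
      unfolding F_def using False by (intro integral_has_real_derivative smooth_continuous b) auto
    then show ?thesis using False by (simp add: at_within_Icc_at)
  qed
  have "\<exists>z>0. z < 1 \<and> F 1 - F 0 = (1 - 0) * b z" by (rule MVT2) (auto intro: dF)
  then obtain z where z: "0 < z" "z < 1" "F 1 - F 0 = (1 - 0) * b z" by blast
  then have F1: "F 1 > 0" using b_in[of z] F0[of 0] by simp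
  have F_ge1: "F x = F 1" if "1 \<le> x" for x
  proof (cases "x = 1")
    case False
    have "\<exists>z>1. z < x \<and> F x - F 1 = (x - 1) * b z"
      by (rule MVT2) (use False that in \<open>auto intro: dF\<close>)
    then obtain z where "1 < z" "F x - F 1 = (x - 1) * b z" by blast
    then show ?thesis using b_out[of z] by simp
  qed simp
  have F_mono: "F x \<le> F y" if "x \<le> y" for x y
    using that by (rule DERIV_nonneg_imp_nondecreasing) (use dF b_nonneg in blast)
  define S where "S = (\<lambda>x. F x / F 1)"
  have dS: "(S has_field_derivative b x / F 1) (at x)" for x
    unfolding S_def by (intro DERIV_cdivide dF)
  then have derS: "deriv S x = b x / F 1" for x by (rule DERIV_imp_deriv)
  show thesis
  proof (rule that[of S])
    have "smooth (\<lambda>x. 1 / F 1 * b (1 * x + 0))" by (rule smooth_affine[OF b])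
    then show "smooth S" by (intro smooth_antiderivative[OF dS]) simp
    show "S x = 0" if "x \<le> 0" for x using that F0 by (simp add: S_def)
    show "S x = 1" if "1 \<le> x" for x using that F_ge1[of x] F1 by (simp add: S_def)
    show "0 \<le> S x" for x
      using F_mono[of "min x 0" x] F0[of "min x 0"] F1 by (simp add: S_def)
    show "S x \<le> 1" for x
      using F_mono[of x "max x 1"] F_ge1[of "max x 1"] F1 by (simp add: S_def)
    show "deriv S x = 0" if "x \<notin> {0<..<1}" for x using b_out[OF that] by (simp add: derS)
  qed
qed

text \<open>Substituting x = a + t / m turns the integral into one with the fixed weight s, to which
  dominated convergence applies. As s lives on (0,1), only values to the right of a are seen, so a
  may be the left end of the interval.\<close>

lemma approximate_identity:
  fixes f s :: "real \<Rightarrow> real"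
  assumes cd: "c \<le> a" "a < d" and f: "continuous_on {c..d} f"
    and s: "continuous_on UNIV s" "\<And>x. x \<notin> {0<..<1} \<Longrightarrow> s x = 0" "(LINT x|lborel. s x) = 1"
  shows "(\<lambda>m. LINT x|lborel. indicator {c..d} x * f x * (real m * s (real m * (x - a)))) \<longlonglongrightarrow> f a"
    and "integrable lborel (\<lambda>x. indicator {c..d} x * f x * (k * s (l * (x - a))))"
proof -
  let ?g = "\<lambda>x. indicator {c..d} x * f x"
  have g_meas: "?g \<in> borel_measurable borel"
    using borel_measurable_continuous_on_indicator[OF _ f] by simp
  have s_meas: "s \<in> borel_measurable borel" using s by (intro borel_measurable_continuous_onI)
  have "bounded (f ` {c..d})"
    by (intro compact_imp_bounded compact_continuous_image f compact_Icc)
  then obtain B where B: "\<And>x. x \<in> {c..d} \<Longrightarrow> \<bar>f x\<bar> \<le> B"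
    unfolding bounded_iff by fastforce
  have "B \<ge> 0" using B[of a] cd by force
  have gB: "\<bar>?g x\<bar> \<le> B" for x using B[of x] \<open>B \<ge> 0\<close> by (auto simp: indicator_def)
  have "integrable lborel (\<lambda>x. indicator {0..1} x *\<^sub>R s x)"
    by (intro borel_integrable_compact continuous_on_subset[OF s(1)]) auto
  also have "(\<lambda>x. indicator {0..1} x *\<^sub>R s x) = s"
  proof (rule ext)
    show "indicator {0..1} x *\<^sub>R s x = s x" for x
      using s(2)[of x] by (cases "x \<in> {0..1}") auto
  qed
  finally have s_int: "integrable lborel s" .
  have lim: "(\<lambda>m. LINT t|lborel. ?g (a + 1 / real m * t) * s t) \<longlonglongrightarrow> (LINT t|lborel. f a * s t)"
  proof (rule integral_dominated_convergence[where w = "\<lambda>t. B * \<bar>s t\<bar>"])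
    show "integrable lborel (\<lambda>t. B * \<bar>s t\<bar>)" using s_int by simp
    show "(\<lambda>t. ?g (a + 1 / real m * t) * s t) \<in> borel_measurable lborel" for m
      using s_meas by (auto intro!: borel_measurable_times measurable_compose[OF _ g_meas])
    show "AE t in lborel. norm (?g (a + 1 / real m * t) * s t) \<le> B * \<bar>s t\<bar>" for m
      using gB by (auto simp: abs_mult intro!: mult_right_mono)
    show "AE t in lborel. (\<lambda>m. ?g (a + 1 / real m * t) * s t) \<longlonglongrightarrow> f a * s t"
    proof (rule AE_I2)
      fix t :: real
      show "(\<lambda>m. ?g (a + 1 / real m * t) * s t) \<longlonglongrightarrow> f a * s t"
      proof (cases "t \<in> {0<..<1}")
        case True
        have "(\<lambda>m. a + 1 / real m * t) \<longlonglongrightarrow> a + 0 * t" by (intro tendsto_intros lim_1_over_n)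
        then have l: "(\<lambda>m. a + 1 / real m * t) \<longlonglongrightarrow> a" by simp
        have ev: "eventually (\<lambda>m. a + 1 / real m * t \<in> {c..d}) sequentially"
          using order_tendstoD(2)[OF l cd(2)]
        proof eventually_elim
          case (elim m)
          have "0 \<le> 1 / real m * t" using True by simp
          then show ?case using elim cd unfolding atLeastAtMost_iff by linarith
        qed
        have "(\<lambda>m. f (a + 1 / real m * t)) \<longlonglongrightarrow> f a"
          using continuous_on_tendsto_compose[OF f l _ ev] cd by simp
        then have "(\<lambda>m. ?g (a + 1 / real m * t)) \<longlonglongrightarrow> f a"
          by (rule Lim_transform_eventually) (use ev in eventually_elim, simp)
        then show ?thesis by (intro tendsto_intros)
      qed (simp add: s(2))
    qed
  qed (use s_meas in simp)
  have scaled: "(LINT x|lborel. ?g x * (real m * s (real m * (x - a))))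
      = (LINT t|lborel. ?g (a + 1 / real m * t) * s t)" if "m > 0" for m
  proof -
    have "(LINT x|lborel. ?g x * (real m * s (real m * (x - a)))) =
      \<bar>1 / real m\<bar> *\<^sub>R (LINT t|lborel. ?g (a + 1 / real m * t) * (real m * s (real m * ((a + 1 / real m * t) - a))))"
      using that by (intro lborel_integral_real_affine) simp
    also have "\<dots> = (LINT t|lborel. (1 / real m) * (?g (a + 1 / real m * t) * (real m * s (real m * ((a + 1 / real m * t) - a)))))"
    proof -
      have "\<bar>1 / real m\<bar> = 1 / real m" by simp
      then show ?thesis by (simp only: real_scaleR_def integral_mult_right_zero)
    qed
    also have "\<dots> = (LINT t|lborel. ?g (a + 1 / real m * t) * s t)"
      using that by (intro Bochner_Integration.integral_cong refl) simp
    finally show ?thesis .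
  qed
  have "eventually (\<lambda>m. (LINT t|lborel. ?g (a + 1 / real m * t) * s t) =
      (LINT x|lborel. ?g x * (real m * s (real m * (x - a))))) sequentially"
    by (rule eventually_mono[OF eventually_gt_at_top[of 0]]) (simp only: scaled)
  from Lim_transform_eventually[OF lim this]
  show "(\<lambda>m. LINT x|lborel. ?g x * (real m * s (real m * (x - a)))) \<longlonglongrightarrow> f a"
    by (simp add: s(3))
  have "continuous_on {c..d} (\<lambda>x. f x * (k * s (l * (x - a))))"
    by (intro continuous_intros f continuous_on_compose2[OF s(1)]) auto
  then have "integrable lborel (\<lambda>x. indicator {c..d} x *\<^sub>R (f x * (k * s (l * (x - a)))))"
    by (intro borel_integrable_compact) auto
  then show "integrable lborel (\<lambda>x. indicator {c..d} x * f x * (k * s (l * (x - a))))"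
    by (simp add: mult.assoc)
qed

text \<open>The test functions are smoothed indicators of (a, b]. Their derivatives tend to a point
  mass at a minus one at b, which gives f(a) - f(b) by continuity; the functions themselves stay
  bounded by 1 and converge pointwise, so the side with f' converges by domination.\<close>

lemma weak_deriv_interval_increment:
  assumes w: "weak_deriv_interval f f'" and f: "continuous_on {0<..<1} f" and f': "integrable unif_interval f'"
    and ab: "0 < a" "a < b" "b < 1"
  shows "f b - f a = (LINT x|unif_interval. indicator {a<..b} x * f' x)"
proof -
  obtain S where S: "smooth S" "\<And>x. x \<le> 0 \<Longrightarrow> S x = 0" "\<And>x. 1 \<le> x \<Longrightarrow> S x = 1"
    "\<And>x. 0 \<le> S x" "\<And>x. S x \<le> 1" "\<And>x. x \<notin> {0<..<1} \<Longrightarrow> deriv S x = 0"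
    using smooth_step_exists by metis
  define s where "s = deriv S"
  have s: "continuous_on UNIV s" "\<And>x. x \<notin> {0<..<1} \<Longrightarrow> s x = 0"
    unfolding s_def using smooth_continuous[OF smooth_deriv[OF S(1)]] S(6) by auto
  have "(LINT x|lborel. s x * indicator {0..1} x) = S 1 - S 0"
    using s(1) smooth_has_derivative[OF S(1)] unfolding s_def
    by (intro integral_FTC_Icc_real) (auto simp: continuous_on_eq_continuous_at)
  also have "(\<lambda>x. s x * indicator {0..1} x) = s"
  proof (rule ext)
    show "s x * indicator {0..1} x = s x" for x
      using s(2)[of x] by (cases "x \<in> {0..1}") auto
  qed
  finally have s1: "(LINT x|lborel. s x) = 1" by (simp add: S)
  \<comment> \<open>Room to the right of b: the second step has width 1 / m and has to end before
    1.\<close>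
  define d where "d = (b + 1) / 2"
  have d: "b < d" "d < 1" using ab by (auto simp: d_def)
  have fc: "continuous_on {a..d} f" by (rule continuous_on_subset[OF f]) (use ab d in auto)
  define \<phi> where "\<phi> = (\<lambda>m x. S (real m * x + (- real m * a)) + (-1) * S (real m * x + (- real m * b)))"
  have sm: "smooth (\<phi> m)" for m
    using smooth_add[OF smooth_affine[OF S(1), of 1 "real m" "- real m * a"]
      smooth_affine[OF S(1), of "-1" "real m" "- real m * b"]] by (simp only: \<phi>_def mult_1)
  have der: "deriv (\<phi> m) x = real m * s (real m * (x - a)) - real m * s (real m * (x - b))" for m x
  proof (rule DERIV_imp_deriv)
    show "(\<phi> m has_field_derivative real m * s (real m * (x - a)) - real m * s (real m * (x - b))) (at x)"
      unfolding \<phi>_def s_def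
      by (auto intro!: derivative_eq_intros DERIV_chain2[OF smooth_has_derivative[OF S(1)]]
          simp: algebra_simps)
  qed
  define A where "A = (\<lambda>c m. LINT x|lborel. indicator {a..d} x * f x * (real m * s (real m * (x - c))))"
  have A: "A c \<longlonglongrightarrow> f c" if "a \<le> c" "c < d" for c
    unfolding A_def using approximate_identity(1)[OF that fc s s1] .
  have "(\<lambda>m. 1 / real m) \<longlonglongrightarrow> 0" by (rule lim_1_over_n)
  then have ev: "eventually (\<lambda>m. 1 / real m < d - b) sequentially"
    using d by (intro order_tendstoD) auto
  have eq: "eventually (\<lambda>m. A a m - A b m = - (LINT x|unif_interval. f' x * \<phi> m x)) sequentially"
    using ev eventually_gt_at_top[of 0]
  proof eventually_elim
    case (elim m)
    have m: "real m > 0" using elim by simp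
    have zero: "\<phi> m x = 0" if "x \<notin> {a..d}" for x
    proof (cases "x < a")
      case True
      then have "real m * x \<le> real m * a" "real m * x \<le> real m * b" using ab m by auto
      then show ?thesis by (simp add: \<phi>_def S)
    next
      case False
      then have "x > d" using that by auto
      then have "1 / real m < x - b" "1 / real m < x - a" using elim ab by auto
      then have "1 \<le> real m * (x - b)" "1 \<le> real m * (x - a)" using m by (auto simp: field_simps)
      then show ?thesis by (simp add: \<phi>_def S algebra_simps)
    qed
    have "(LINT x|unif_interval. f x * deriv (\<phi> m) x) = - (LINT x|unif_interval. f' x * \<phi> m x)"
      using w zero sm[of m] ab d unfolding weak_deriv_interval_def by blast
    moreover have "(LINT x|unif_interval. f x * deriv (\<phi> m) x) = A a m - A b m"
    proof -
      have dz: "deriv (\<phi> m) x = 0" if "x \<notin> {a..d}" for x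
      proof -
        have "((\<lambda>x. 0) has_field_derivative 0) (at x)" by simp
        then have "(\<phi> m has_field_derivative 0) (at x)"
          by (rule has_field_derivative_transform_within_open[where S = "- {a..d}"])
            (use that zero in \<open>auto intro: open_Compl\<close>)
        then show ?thesis by (rule DERIV_imp_deriv)
      qed
      have "A a m - A b m = (LINT x|lborel. indicator {a..d} x * f x * (real m * s (real m * (x - a)))
         - indicator {a..d} x * f x * (real m * s (real m * (x - b))))"
        unfolding A_def
        by (intro Bochner_Integration.integral_diff[symmetric] approximate_identity(2)[of a _ d, OF _ _ fc s s1]) (use ab d in auto)
      also have "\<dots> = (LINT x|lborel. indicator {0..<1} x *\<^sub>R (f x * deriv (\<phi> m) x))"
      proof (rule Bochner_Integration.integral_cong[OF refl])
        fix x
        show "indicator {a..d} x * f x * (real m * s (real m * (x - a)))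
         - indicator {a..d} x * f x * (real m * s (real m * (x - b))) =
          indicator {0..<1} x *\<^sub>R (f x * deriv (\<phi> m) x)"
        proof (cases "x \<in> {a..d}")
          case True
          then have "x \<in> {0..<1}" using ab d by auto
          then show ?thesis using True by (simp add: der algebra_simps)
        next
          case False
          then show ?thesis by (simp add: dz)
        qed
      qed
      finally show ?thesis by (simp add: integral_unif_interval)
    qed
    ultimately show ?case by simp
  qed
  have "(\<lambda>m. LINT x|unif_interval. f' x * \<phi> m x) \<longlonglongrightarrow> (LINT x|unif_interval. indicator {a<..b} x * f' x)"
  proof (rule integral_dominated_convergence[where w = "\<lambda>x. \<bar>f' x\<bar>"])
    show "(\<lambda>x. indicator {a<..b} x * f' x) \<in> borel_measurable unif_interval"
      by (rule borel_measurable_times[OF measurable_unif_interval borel_measurable_integrable[OF f']]) simp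
    show "(\<lambda>x. f' x * \<phi> m x) \<in> borel_measurable unif_interval" for m
      by (intro borel_measurable_times[OF borel_measurable_integrable[OF f']] measurable_unif_interval
        borel_measurable_continuous_onI smooth_continuous sm)
    have "\<bar>\<phi> m x\<bar> \<le> 1" for m x
      using S(4,5)[of "real m * x + (- real m * a)"] S(4,5)[of "real m * x + (- real m * b)"]
      unfolding \<phi>_def by (simp add: abs_le_iff)
    then show "AE x in unif_interval. norm (f' x * \<phi> m x) \<le> \<bar>f' x\<bar>" for m
      by (auto simp: abs_mult mult_left_le)
    show "AE x in unif_interval. (\<lambda>m. f' x * \<phi> m x) \<longlonglongrightarrow> indicator {a<..b} x * f' x"
    proof (rule AE_I2)
      fix x
      \<comment> \<open>S(0) = 0, so the limit at x = c is 0; this is what makes the limiting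
        interval half-open.\<close>
      have step: "(\<lambda>m. S (real m * x + (- real m * c))) \<longlonglongrightarrow> (if x > c then 1 else 0)" for c
      proof (rule tendsto_eventually)
        show "eventually (\<lambda>m. S (real m * x + (- real m * c)) = (if x > c then 1 else 0)) sequentially"
        proof (cases "x > c")
          case True
          have "eventually (\<lambda>m. 1 / real m < x - c) sequentially"
            using True lim_1_over_n by (intro order_tendstoD) auto
          then show ?thesis using eventually_gt_at_top[of 0]
          proof eventually_elim
            case (elim m)
            then have "1 \<le> real m * x + (- real m * c)" by (simp add: field_simps)
            then show ?case using True S(3) by simp
          qed
        next
          case False
          then have "real m * x \<le> real m * c" for m by (simp add: mult_left_mono)
          then show ?thesis using False S(2) by simp
        qed
      qed
      have "(\<lambda>m. f' x * \<phi> m x) \<longlonglongrightarrow> f' x * ((if x > a then 1 else 0) + (-1) * (if x > b then 1 else 0))"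
        unfolding \<phi>_def by (intro tendsto_intros step)
      moreover have "f' x * ((if x > a then 1 else 0) + (-1) * (if x > b then 1 else 0)) = indicator {a<..b} x * f' x"
        using ab by (auto simp: indicator_def)
      ultimately show "(\<lambda>m. f' x * \<phi> m x) \<longlonglongrightarrow> indicator {a<..b} x * f' x" by (simp only:)
    qed
  qed (use f' in auto)
  then have "(\<lambda>m. - (LINT x|unif_interval. f' x * \<phi> m x)) \<longlonglongrightarrow> - (LINT x|unif_interval. indicator {a<..b} x * f' x)"
    by (rule tendsto_minus)
  moreover have "(\<lambda>m. A a m - A b m) \<longlonglongrightarrow> f a - f b"
    using ab d by (intro tendsto_diff A) auto
  then have "(\<lambda>m. - (LINT x|unif_interval. f' x * \<phi> m x)) \<longlonglongrightarrow> f a - f b"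
    by (rule Lim_transform_eventually) (rule eq)
  ultimately have "- (LINT x|unif_interval. indicator {a<..b} x * f' x) = f a - f b"
    by (rule LIMSEQ_unique)
  then show ?thesis by simp
qed

lemma weak_deriv_interval_primitive:
  assumes w: "weak_deriv_interval f f'" and f: "continuous_on {0..<1} f" and f': "integrable unif_interval f'"
    and x: "0 \<le> x" "x < 1"
  shows "f x = f 0 + (LINT t|unif_interval. indicator {0<..x} t * f' t)"
proof (cases "x = 0")
  case False
  \<comment> \<open>The offset 2 makes every term strictly smaller than x. The terms tend to 0,
    where f is continuous from the right.\<close>
  define a where "a = (\<lambda>m. x / real (m + 2))"
  have a: "0 < a m" "a m < x" "a m < 1" for m
    using x False by (auto simp: a_def field_simps add_pos_nonneg)
  have "(\<lambda>m. x * (1 / real (m + 2))) \<longlonglongrightarrow> x * 0"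
    by (intro tendsto_intros LIMSEQ_ignore_initial_segment[OF lim_1_over_n])
  then have a0: "a \<longlonglongrightarrow> 0" by (simp add: a_def)
  have "(\<lambda>m. f (a m)) \<longlonglongrightarrow> f 0"
    using continuous_on_tendsto_compose[OF f a0] a by (simp add: less_imp_le always_eventually)
  then have "(\<lambda>m. f x - f (a m)) \<longlonglongrightarrow> f x - f 0" by (intro tendsto_intros)
  also have "(\<lambda>m. f x - f (a m)) = (\<lambda>m. LINT t|unif_interval. indicator {a m<..x} t * f' t)"
  proof -
    have "continuous_on {0<..<1} f" by (rule continuous_on_subset[OF f]) auto
    from weak_deriv_interval_increment[OF w this f' a(1,2) x(2)] show ?thesis by simp
  qed
  finally have "(\<lambda>m. LINT t|unif_interval. indicator {a m<..x} t * f' t) \<longlonglongrightarrow> f x - f 0" .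
  moreover have "(\<lambda>m. LINT t|unif_interval. indicator {a m<..x} t * f' t) \<longlonglongrightarrow> (LINT t|unif_interval. indicator {0<..x} t * f' t)"
  proof (rule integral_dominated_convergence[where w = "\<lambda>x. \<bar>f' x\<bar>"])
    show "AE t in unif_interval. (\<lambda>m. indicator {a m<..x} t * f' t) \<longlonglongrightarrow> indicator {0<..x} t * f' t"
    proof (rule AE_I2)
      fix t
      have "eventually (\<lambda>m. indicator {a m<..x} t * f' t = indicator {0<..x} t * f' t) sequentially"
      proof (cases "t > 0")
        case True
        from order_tendstoD(2)[OF a0 True] show ?thesis
          by eventually_elim (use True in \<open>auto simp: indicator_def\<close>)
      next
        case False
        then show ?thesis using a(1) by (intro always_eventually) (auto simp: indicator_def, meson less_trans)
      qed
      then show "(\<lambda>m. indicator {a m<..x} t * f' t) \<longlonglongrightarrow> indicator {0<..x} t * f' t"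
        by (rule tendsto_eventually)
    qed
    show "(\<lambda>t. indicator {0<..x} t * f' t) \<in> borel_measurable unif_interval"
      "(\<lambda>t. indicator {a m<..x} t * f' t) \<in> borel_measurable unif_interval" for m
      by (rule borel_measurable_times[OF measurable_unif_interval borel_measurable_integrable[OF f']], simp)+
    show "AE t in unif_interval. norm (indicator {a m<..x} t * f' t) \<le> \<bar>f' t\<bar>" for m
      by (auto simp: indicator_def)
  qed (use f' in auto)
  ultimately have "f x - f 0 = (LINT t|unif_interval. indicator {0<..x} t * f' t)"
    by (rule LIMSEQ_unique)
  then show ?thesis by simp
qed simp

subsection \<open>Discrepancy functions\<close>

lemma AE_unif_interval_positive: "AE t in unif_interval. 0 < t \<and> t < 1"
proof -
  have "AE t in lborel. t \<noteq> (0::real)" by (rule AE_lborel_singleton)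
  then have "AE t in lborel. t \<in> {0..<1} \<longrightarrow> 0 < t \<and> t < (1::real)"
    by eventually_elim auto
  then show ?thesis unfolding unif_interval_def
    by (subst AE_restrict_space_iff) auto
qed

locale interval_prob = prob_space \<mu> for \<mu> :: "real measure" +
  assumes sets_mu: "sets \<mu> = sets (restrict_space borel {0..<1})"
begin

lemma space_mu: "space \<mu> = {0..<1}"
  using sets_eq_imp_space_eq[OF sets_mu] by (simp add: space_restrict_space)

lemma measurable_mu: "f \<in> borel_measurable borel \<Longrightarrow> f \<in> borel_measurable \<mu>"
  unfolding measurable_cong_sets[OF sets_mu refl] by (rule measurable_restrict_space1)

lemma sets_muI: "A \<in> sets borel \<Longrightarrow> A \<inter> {0..<1} \<in> sets \<mu>"
  unfolding sets_mu sets_restrict_space by blast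

text \<open>The intersection keeps the set inside the space of \<mu>. Without it the value for y > 1
  would be the default 0, and monotonicity on the whole line would fail.\<close>

definition cdf_mu :: "real \<Rightarrow> real" where
  "cdf_mu y = measure \<mu> ({0..<y} \<inter> {0..<1})"

definition saw :: "real \<Rightarrow> real" where
  "saw x = cdf_mu (frac x) - frac x"

lemma cdf_mu_mono: "x \<le> y \<Longrightarrow> cdf_mu x \<le> cdf_mu y"
  unfolding cdf_mu_def by (intro finite_measure_mono sets_muI) auto

lemma cdf_mu_bounds: "0 \<le> cdf_mu x" "cdf_mu x \<le> 1"
  unfolding cdf_mu_def by (auto intro: prob_le_1)

lemma saw_eq_discrepancy: "0 \<le> x \<Longrightarrow> x < 1 \<Longrightarrow> saw x = discrepancy \<mu> x"
proof -
  assume x: "0 \<le> x" "x < 1"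
  then have "frac x = x" by (simp add: frac_eq)
  moreover have "{0..<x} \<inter> {0..<1} = {0..<x}" using x by auto
  ultimately show "saw x = discrepancy \<mu> x" by (simp add: saw_def discrepancy_def cdf_mu_def)
qed

sublocale sawtooth saw
proof
  have "cdf_mu \<in> borel_measurable borel"
    by (intro borel_measurable_mono monoI cdf_mu_mono)
  moreover have "frac \<in> borel_measurable (borel :: real measure)"
    unfolding frac_def by measurable
  ultimately show "saw \<in> borel_measurable borel"
    unfolding saw_def by (intro borel_measurable_diff measurable_compose[of frac borel borel cdf_mu])
  show "\<bar>saw x\<bar> \<le> 1" for x
    using cdf_mu_bounds[of "frac x"] frac_ge_0[of x] frac_lt_1[of x] unfolding saw_def by linarith
  show "saw (x + of_int m) = saw x" for x m
    by (simp add: saw_def frac_def)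
  show "saw x - h \<le> saw (x + h)" if h: "0 \<le> h" for x h
  proof (cases "\<lfloor>x + h\<rfloor> = \<lfloor>x\<rfloor>")
    case True
    then have "frac (x + h) = frac x + h" by (simp add: frac_def)
    then show ?thesis using cdf_mu_mono[of "frac x" "frac (x + h)"] h by (simp add: saw_def)
  next
    case False
    \<comment> \<open>When an integer is crossed, saw x \<le> 1 - frac x and saw (x + h) \<ge> -
      frac (x + h), while h is at least 1 + frac (x + h) - frac x.\<close>
    then have "\<lfloor>x\<rfloor> + 1 \<le> \<lfloor>x + h\<rfloor>" using floor_mono[of x "x + h"] h by linarith
    then have "real_of_int \<lfloor>x\<rfloor> + 1 \<le> real_of_int \<lfloor>x + h\<rfloor>" by linarith
    then show ?thesis
      using cdf_mu_bounds[of "frac x"] cdf_mu_bounds[of "frac (x + h)"]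
      unfolding saw_def frac_def by linarith
  qed
qed

lemma mean_eq: "mean = mean_discrepancy \<mu>"
  unfolding mean_def mean_discrepancy_def
  by (intro Bochner_Integration.integral_cong refl) (auto simp: space_unif_interval saw_eq_discrepancy)

text \<open>Fubini on the region t \<le> x: integrating the indicator over x gives the mass of
  [t,1), which is 1 minus that of [0,t). Banach space values let the formula serve both real test
  functions and complex characters.\<close>

lemma integral_primitive:
  fixes g :: "real \<Rightarrow> 'b::{banach, second_countable_topology}"
  assumes g: "integrable unif_interval g"
  shows "(LINT x|\<mu>. (LINT t|unif_interval. indicator {0<..x} t *\<^sub>R g t)) = (LINT t|unif_interval. (1 - cdf_mu t) *\<^sub>R g t)"
    and "integrable \<mu> (\<lambda>x. LINT t|unif_interval. indicator {0<..x} t *\<^sub>R g t)"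
proof -
  interpret L: prob_space unif_interval by (rule prob_space_unif_interval)
  interpret P: pair_prob_space \<mu> unif_interval ..
  have gm: "g \<in> borel_measurable unif_interval" using g by simp
  have fst_b: "fst \<in> borel_measurable (\<mu> \<Otimes>\<^sub>M unif_interval)" and snd_b: "snd \<in> borel_measurable (\<mu> \<Otimes>\<^sub>M unif_interval)"
    by (intro measurable_compose[OF measurable_fst measurable_mu]
      measurable_compose[OF measurable_snd measurable_unif_interval]; simp)+
  have meas_ind: "(\<lambda>z. indicator {0<..fst z} (snd z) :: real) \<in> borel_measurable (\<mu> \<Otimes>\<^sub>M unif_interval)"
  proof -
    have eq: "(\<lambda>z::real \<times> real. indicator {0<..fst z} (snd z) :: real)
        = (\<lambda>z. if 0 < snd z \<and> snd z \<le> fst z then 1 else 0)"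
      by (auto simp: indicator_def fun_eq_iff)
    show ?thesis
      unfolding eq
      by (intro measurable_If sets.sets_Collect_conj borel_measurable_less borel_measurable_le
          borel_measurable_const fst_b snd_b)
  qed
  have gs: "integrable (\<mu> \<Otimes>\<^sub>M unif_interval) (\<lambda>z. g (snd z))"
  proof (rule integrableI_bounded)
    show "(\<lambda>z. g (snd z)) \<in> borel_measurable (\<mu> \<Otimes>\<^sub>M unif_interval)"
      by (rule measurable_compose[OF measurable_snd gm])
    have "(\<integral>\<^sup>+ z. ennreal (norm (g (snd z))) \<partial>(\<mu> \<Otimes>\<^sub>M unif_interval)) = (\<integral>\<^sup>+ x. \<integral>\<^sup>+ t. ennreal (norm (g t)) \<partial>unif_interval \<partial>\<mu>)"
      using gm by (subst L.nn_integral_fst[symmetric]) auto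
    also have "\<dots> = (\<integral>\<^sup>+ t. ennreal (norm (g t)) \<partial>unif_interval)" by (simp add: emeasure_space_1)
    also have "\<dots> < \<infinity>" using g by (simp add: integrable_iff_bounded)
    finally show "(\<integral>\<^sup>+ z. ennreal (norm (g (snd z))) \<partial>(\<mu> \<Otimes>\<^sub>M unif_interval)) < \<infinity>" .
  qed
  have int: "integrable (\<mu> \<Otimes>\<^sub>M unif_interval) (\<lambda>(x, t). indicator {0<..x} t *\<^sub>R g t)"
  proof (rule Bochner_Integration.integrable_bound[OF gs])
    show "(\<lambda>(x, t). indicator {0<..x} t *\<^sub>R g t) \<in> borel_measurable (\<mu> \<Otimes>\<^sub>M unif_interval)"
      unfolding case_prod_beta
      by (intro borel_measurable_scaleR meas_ind measurable_compose[OF measurable_snd gm])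
    show "AE z in \<mu> \<Otimes>\<^sub>M unif_interval. norm (case z of (x, t) \<Rightarrow> indicator {0<..x} t *\<^sub>R g t) \<le> norm (g (snd z))"
      by (auto simp: indicator_def)
  qed
  show "integrable \<mu> (\<lambda>x. LINT t|unif_interval. indicator {0<..x} t *\<^sub>R g t)"
    using P.integrable_fst'[OF int] by simp
  have "(LINT x|\<mu>. (LINT t|unif_interval. indicator {0<..x} t *\<^sub>R g t)) = (LINT t|unif_interval. (LINT x|\<mu>. indicator {0<..x} t *\<^sub>R g t))"
    by (rule P.Fubini_integral[OF int, symmetric])
  also have "\<dots> = (LINT t|unif_interval. (1 - cdf_mu t) *\<^sub>R g t)"
  proof (rule integral_cong_AE)
    show "(\<lambda>t. LINT x|\<mu>. indicator {0<..x} t *\<^sub>R g t) \<in> borel_measurable unif_interval"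
      using P.integrable_snd[OF int] by simp
    show "(\<lambda>t. (1 - cdf_mu t) *\<^sub>R g t) \<in> borel_measurable unif_interval"
      by (intro borel_measurable_scaleR gm measurable_unif_interval borel_measurable_diff
          borel_measurable_const borel_measurable_mono monoI cdf_mu_mono)
    \<comment> \<open>The two sides agree only for t > 0: at t = 0 the indicator vanishes, whereas
      the weight 1 - \<open>cdf_mu 0\<close> is 1.\<close>
    show "AE t in unif_interval. (LINT x|\<mu>. indicator {0<..x} t *\<^sub>R g t) = (1 - cdf_mu t) *\<^sub>R g t"
      using AE_unif_interval_positive
    proof eventually_elim
      case (elim t)
      let ?A = "{0..<t} \<inter> {0..<1}"
      have A: "?A \<in> sets \<mu>" by (intro sets_muI) simp
      have "(LINT x|\<mu>. indicator {0<..x} t *\<^sub>R g t) = (LINT x|\<mu>. indicator (space \<mu> - ?A) x *\<^sub>R g t)"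
        using elim by (intro Bochner_Integration.integral_cong refl) (auto simp: indicator_def space_mu)
      also have "\<dots> = measure \<mu> (space \<mu> - ?A) *\<^sub>R g t"
        using A by (subst integral_scaleR_left) (auto simp: emeasure_eq_measure)
      also have "measure \<mu> (space \<mu> - ?A) = 1 - cdf_mu t"
        unfolding cdf_mu_def by (rule prob_compl[OF A])
      finally show ?case .
    qed
  qed
  finally show "(LINT x|\<mu>. (LINT t|unif_interval. indicator {0<..x} t *\<^sub>R g t)) = (LINT t|unif_interval. (1 - cdf_mu t) *\<^sub>R g t)" .
qed

end

lemma unif_interval_prob: "interval_prob unif_interval"
  by (intro interval_prob.intro prob_space_unif_interval interval_prob_axioms.intro)
    (simp add: unif_interval_def sets_restrict_space)

lemma cdf_unif: "0 \<le> t \<Longrightarrow> t < 1 \<Longrightarrow> interval_prob.cdf_mu unif_interval t = t"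
proof -
  assume t: "0 \<le> t" "t < 1"
  interpret I: interval_prob unif_interval by (rule unif_interval_prob)
  have "measure unif_interval ({0..<t} \<inter> {0..<1}) = measure lborel {0..<t}"
    unfolding unif_interval_def using t by (subst measure_restrict_space) (auto simp: Int_absorb2)
  then show "interval_prob.cdf_mu unif_interval t = t" using t by (simp add: I.cdf_mu_def)
qed

context interval_prob
begin

text \<open>Integration by parts through Fubini: the primitive formula is applied to \<mu> and to
  the uniform measure, whose distribution function is t, and the two weights differ by -
  \<open>saw t\<close>.\<close>

lemma integral_primitive_difference:
  fixes g :: "real \<Rightarrow> 'b::{banach, second_countable_topology}"
  assumes g: "integrable unif_interval g"
    and G: "\<And>x. 0 \<le> x \<Longrightarrow> x < 1 \<Longrightarrow> G x = c + (LINT t|unif_interval. indicator {0<..x} t *\<^sub>R g t)"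
  shows "(LINT x|\<mu>. G x) - (LINT x|unif_interval. G x) = - (LINT t|unif_interval. saw t *\<^sub>R g t)"
proof -
  interpret I: interval_prob unif_interval by (rule unif_interval_prob)
  let ?H = "\<lambda>x. LINT t|unif_interval. indicator {0<..x} t *\<^sub>R g t"
  have gm: "g \<in> borel_measurable unif_interval" using g by simp
  have bnd: "integrable unif_interval (\<lambda>t. k t *\<^sub>R g t)"
    if "k \<in> borel_measurable unif_interval" "\<And>t. 0 \<le> t \<Longrightarrow> t < 1 \<Longrightarrow> \<bar>k t\<bar> \<le> 1" for k :: "real \<Rightarrow> real"
  proof (rule Bochner_Integration.integrable_bound[OF g])
    show "(\<lambda>t. k t *\<^sub>R g t) \<in> borel_measurable unif_interval" using that gm by (intro borel_measurable_scaleR)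
    show "AE t in unif_interval. norm (k t *\<^sub>R g t) \<le> norm (g t)"
      using that(2) by (intro AE_I2) (auto simp: space_unif_interval mult_left_le_one_le)
  qed
  have cm: "(\<lambda>t. 1 - cdf_mu t) \<in> borel_measurable unif_interval"
    by (intro measurable_unif_interval borel_measurable_diff
          borel_measurable_const borel_measurable_mono monoI cdf_mu_mono)
  have i1: "integrable unif_interval (\<lambda>t. (1 - cdf_mu t) *\<^sub>R g t)"
    using cdf_mu_bounds by (intro bnd cm) (auto simp: abs_le_iff add_increasing)
  have i2: "integrable unif_interval (\<lambda>t. (1 - t) *\<^sub>R g t)"
    by (intro bnd measurable_unif_interval) auto
  have "(LINT x|\<mu>. G x) = (LINT x|\<mu>. c + ?H x)"
    by (intro Bochner_Integration.integral_cong refl G) (auto simp: space_mu)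
  also have "\<dots> = c + (LINT t|unif_interval. (1 - cdf_mu t) *\<^sub>R g t)"
    using integral_primitive[OF g] by (simp add: prob_space)
  finally have e1: "(LINT x|\<mu>. G x) = c + (LINT t|unif_interval. (1 - cdf_mu t) *\<^sub>R g t)" .
  have "(LINT x|unif_interval. G x) = (LINT x|unif_interval. c + ?H x)"
    by (intro Bochner_Integration.integral_cong refl G) (auto simp: space_unif_interval)
  also have "\<dots> = c + (LINT t|unif_interval. (1 - I.cdf_mu t) *\<^sub>R g t)"
    using I.integral_primitive[OF g] by (simp add: I.prob_space)
  also have "(LINT t|unif_interval. (1 - I.cdf_mu t) *\<^sub>R g t) = (LINT t|unif_interval. (1 - t) *\<^sub>R g t)"
    by (intro Bochner_Integration.integral_cong refl) (auto simp: space_unif_interval cdf_unif)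
  finally have e2: "(LINT x|unif_interval. G x) = c + (LINT t|unif_interval. (1 - t) *\<^sub>R g t)" .
  have "(LINT x|\<mu>. G x) - (LINT x|unif_interval. G x) = (LINT t|unif_interval. (1 - cdf_mu t) *\<^sub>R g t - (1 - t) *\<^sub>R g t)"
    unfolding e1 e2 using i1 i2 by simp
  also have "\<dots> = (LINT t|unif_interval. - (saw t *\<^sub>R g t))"
    by (intro Bochner_Integration.integral_cong refl)
      (auto simp: space_unif_interval saw_def frac_eq algebra_simps)
  finally show ?thesis by simp
qed

text \<open>The character is, up to a constant, a primitive of w times itself, and its uniform
  integral is 0. Integration by parts therefore gives the Fourier coefficient of \<mu> as -w times
  \<open>coeff\<close>, with |w| = 2 pi k \<ge> k.\<close>

lemma fourier_coeff_bound:
  assumes k: "k > 0"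
  shows "cmod (coeff (int k)) \<le> cmod (fourier_interval \<mu> (int k)) / real k"
proof -
  define w where "w = - 2 * complex_of_real pi * \<i> * of_int (int k)"
  define e where "e = (\<lambda>x. exp (w * complex_of_real x))"
  have cis_e: "cis (- (2 * pi * of_int (int k) * x)) = e x" for x
    by (simp add: e_def w_def cis_conv_exp mult_ac)
  have w0: "w \<noteq> 0" using k by (simp add: w_def)
  have dE: "(e has_vector_derivative w * e x) (at x within A)" for x A
    unfolding e_def
    by (rule has_vector_derivative_real_field[where f = "\<lambda>z. exp (w * z)"])
      (auto intro!: derivative_eq_intros)
  have ec: "continuous_on A e" for A unfolding e_def by (intro continuous_intros)
  have FTC: "(LINT t|lborel. indicator {a..b} t *\<^sub>R (w * e t)) = e b - e a" if "a \<le> b" for a b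
    by (rule integral_FTC_Icc[OF that dE]) (intro continuous_intros ec)
  have "integrable unif_interval (\<lambda>t. w * e t)"
  proof (rule integrable_unif_interval_bounded[where B = "cmod w"])
    show "(\<lambda>t. w * e t) \<in> borel_measurable unif_interval"
      by (intro measurable_unif_interval borel_measurable_continuous_onI continuous_intros ec)
    show "norm (w * e x) \<le> cmod w" for x by (simp add: norm_mult flip: cis_e)
  qed
  moreover have "e x = 1 + (LINT t|unif_interval. indicator {0<..x} t *\<^sub>R (w * e t))" if x: "0 \<le> x" "x < 1" for x
  proof -
    have "(LINT t|unif_interval. indicator {0<..x} t *\<^sub>R (w * e t)) = (LINT t|lborel. indicator {0..<1} t *\<^sub>R indicator {0<..x} t *\<^sub>R (w * e t))"
      by (rule integral_unif_interval)
    also have "\<dots> = (LINT t|lborel. indicator {0..x} t *\<^sub>R (w * e t))"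
    proof (rule integral_cong_AE)
      show "AE t in lborel. indicator {0..<1} t *\<^sub>R indicator {0<..x} t *\<^sub>R (w * e t) = indicator {0..x} t *\<^sub>R (w * e t)"
        using AE_lborel_singleton[of 0] by eventually_elim (use x in \<open>auto simp: indicator_def\<close>)
      have "e \<in> borel_measurable borel" by (intro borel_measurable_continuous_onI ec)
      then show "(\<lambda>t. indicator {0..<1} t *\<^sub>R indicator {0<..x} t *\<^sub>R (w * e t)) \<in> borel_measurable lborel"
        "(\<lambda>t. indicator {0..x} t *\<^sub>R (w * e t)) \<in> borel_measurable lborel" by auto
    qed
    also have "\<dots> = e x - e 0" by (rule FTC[OF x(1)])
    finally show ?thesis by (simp add: e_def)
  qed
  ultimately have "(LINT x|\<mu>. e x) - (LINT x|unif_interval. e x) = - (LINT t|unif_interval. saw t *\<^sub>R (w * e t))"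
    by (rule integral_primitive_difference)
  moreover have "(LINT x|unif_interval. e x) = 0"
  proof -
    have "w * (LINT x|unif_interval. e x) = (LINT t|lborel. indicator {0..<1} t *\<^sub>R (w * e t))"
      unfolding integral_unif_interval by (simp flip: integral_mult_right_zero)
    also have "\<dots> = (LINT t|lborel. indicator {0..1} t *\<^sub>R (w * e t))"
    proof (rule integral_cong_AE)
      show "AE t in lborel. indicator {0..<1} t *\<^sub>R (w * e t) = indicator {0..1} t *\<^sub>R (w * e t)"
        using AE_lborel_singleton[of 1] by eventually_elim (auto simp: indicator_def)
      have "e \<in> borel_measurable borel" by (intro borel_measurable_continuous_onI ec)
      then show "(\<lambda>t. indicator {0..<1} t *\<^sub>R (w * e t)) \<in> borel_measurable lborel"
        "(\<lambda>t. indicator {0..1} t *\<^sub>R (w * e t)) \<in> borel_measurable lborel" by auto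
    qed
    also have "\<dots> = e 1 - e 0" by (rule FTC) simp
    also have "e 1 = 1"
      using cis_multiple_2pi[of "- of_int (int k)"] cis_e[of 1] by (simp add: mult.commute mult.left_commute)
    finally show ?thesis using w0 by (simp add: e_def)
  qed
  moreover have "fourier_interval \<mu> (int k) = (LINT x|\<mu>. e x)"
    by (simp add: fourier_interval_def e_def w_def)
  moreover have "(LINT t|unif_interval. saw t *\<^sub>R (w * e t)) = w * coeff (int k)"
    unfolding coeff_def cis_e by (simp flip: integral_mult_right_zero)
  ultimately have "fourier_interval \<mu> (int k) = - (w * coeff (int k))" by simp
  then have "cmod (fourier_interval \<mu> (int k)) = 2 * pi * real k * cmod (coeff (int k))"
    by (simp add: w_def norm_mult)
  moreover have "1 * real k * cmod (coeff (int k)) \<le> 2 * pi * real k * cmod (coeff (int k))"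
    using pi_gt3 by (intro mult_right_mono) auto
  ultimately show ?thesis using k by (simp add: field_simps)
qed

end

subsection \<open>Duality\<close>

text \<open>A finite p is the witness r, and p = \<infinity> forces q = 1. The two cases select
  \<open>deviation_Lp\<close> and \<open>deviation_L1\<close>.\<close>

lemma holder_conjugate_real:
  assumes p: "2 \<le> p" and hc: "holder_conjugate p (ennreal q)"
  shows "1 \<le> q" "q = 1 \<or> (\<exists>r. 2 \<le> r \<and> 1 / r + 1 / q = 1)"
proof -
  show q: "1 \<le> q" using hc by (simp add: holder_conjugate_def)
  have inv: "1 / ennreal x = ennreal (1 / x)" if "1 \<le> x" for x
    using that divide_ennreal[of 1 x] by simp
  show "q = 1 \<or> (\<exists>r. 2 \<le> r \<and> 1 / r + 1 / q = 1)"
  proof (cases p)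
    case (real r)
    then have r: "2 \<le> r" using p by (simp flip: ennreal_numeral)
    have "ennreal (1 / r + 1 / q) = 1"
      using hc q r real by (simp add: holder_conjugate_def inv ennreal_plus[symmetric] del: ennreal_plus)
    then have "1 / r + 1 / q = 1" by simp
    then show ?thesis using r by blast
  next
    case top
    then have "ennreal (1 / q) = 1" using hc q by (simp add: holder_conjugate_def inv)
    then show ?thesis using q by simp
  qed
qed

text \<open>The suprema quantify over the conjugate exponent, and uniqueness ties it to the given q.
  An infinite q' would force 1 / p = 1, which p \<ge> 2 excludes; the finite summand 1 / p can then
  be cancelled.\<close>

lemma holder_conjugate_unique:
  assumes p: "2 \<le> p" and hc: "holder_conjugate p (ennreal q)" and hc': "holder_conjugate p q'"
  shows "q' = ennreal q"
proof -
  have inv: "1 / ennreal x = ennreal (1 / x)" if "1 \<le> x" for x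
    using that divide_ennreal[of 1 x] by simp
  have "1 / p \<noteq> 1"
  proof (cases p)
    case (real r)
    then have "2 \<le> r" using p by (simp flip: ennreal_numeral)
    then show ?thesis using real by (simp add: inv)
  qed simp
  then have "q' \<noteq> top" using hc' by (auto simp: holder_conjugate_def)
  then obtain s where s: "q' = ennreal s" "0 \<le> s" by (cases q') auto
  then have hs: "holder_conjugate p (ennreal s)" using hc' by simp
  have "1 / p + ennreal (1 / s) = 1 / p + ennreal (1 / q)"
    using holder_conjugate_real(1)[OF p hs] holder_conjugate_real(1)[OF p hc] hs hc
    by (simp add: holder_conjugate_def inv)
  moreover have "1 / p \<noteq> top"
    using hc by (auto simp: holder_conjugate_def)
  ultimately have "ennreal (1 / s) = ennreal (1 / q)" by (simp add: ennreal_add_left_cancel)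
  then show ?thesis
    using s holder_conjugate_real(1)[OF p hs] holder_conjugate_real(1)[OF p hc] by simp
qed

text \<open>Integrability is given only on compact subintervals of (0,1), so f' is obtained as a
  limit along an exhaustion.\<close>

lemma weak_deriv_interval_measurable:
  assumes "weak_deriv_interval f f'"
  shows "f' \<in> borel_measurable unif_interval"
proof -
  let ?I = "\<lambda>m::nat. {1 / real (m + 2)..1 - 1 / real (m + 2)}"
  have "(\<lambda>x. indicator {0<..<1} x *\<^sub>R f' x) \<in> borel_measurable lborel"
  proof (rule borel_measurable_LIMSEQ_real)
    show "(\<lambda>x. indicator (?I m) x *\<^sub>R f' x) \<in> borel_measurable lborel" for m
    proof -
      have "set_integrable lborel (?I m) f'"
        using assms unfolding weak_deriv_interval_def by simp
      then show ?thesis unfolding set_integrable_def by (rule borel_measurable_integrable)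
    qed
    fix x :: real
    have l: "(\<lambda>m. 1 / real (m + 2)) \<longlonglongrightarrow> 0"
      by (rule LIMSEQ_ignore_initial_segment[OF lim_1_over_n])
    have "eventually (\<lambda>m. indicator (?I m) x *\<^sub>R f' x = indicator {0<..<1} x *\<^sub>R f' x) sequentially"
    proof (cases "x \<in> {0<..<1}")
      case True
      then have "eventually (\<lambda>m. 1 / real (m + 2) < x) sequentially"
        "eventually (\<lambda>m. 1 / real (m + 2) < 1 - x) sequentially"
        by (intro order_tendstoD[OF l]; simp)+
      then show ?thesis by eventually_elim (use True in \<open>auto simp: indicator_def\<close>)
    next
      case False
      have "x \<notin> ?I m" for m
      proof
        assume "x \<in> ?I m"
        moreover have "0 < 1 / real (m + 2)" by simp
        ultimately have "0 < x \<and> x < 1" unfolding atLeastAtMost_iff by linarith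
        then show False using False by simp
      qed
      then show ?thesis using False by (intro always_eventually) simp
    qed
    then show "(\<lambda>m. indicator (?I m) x *\<^sub>R f' x) \<longlonglongrightarrow> indicator {0<..<1} x *\<^sub>R f' x"
      by (rule tendsto_eventually)
  qed
  \<comment> \<open>The point 0 belongs to [0,1) but to no set of the exhaustion; its arbitrary
    value is put in by hand.\<close>
  then have "(\<lambda>x. indicator {0<..<1} x *\<^sub>R f' x + f' 0 * indicator {0} x) \<in> borel_measurable borel"
    by simp
  then have "(\<lambda>x. indicator {0<..<1} x *\<^sub>R f' x + f' 0 * indicator {0} x) \<in> borel_measurable unif_interval"
    by (rule measurable_unif_interval)
  then show ?thesis
    by (rule measurable_cong[THEN iffD1, rotated]) (auto simp: space_unif_interval indicator_def)
qed

text \<open>Young's inequality against the constant 1 gives |g| \<le> |g|^q / q + (1 - 1 / q), from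
  which both the integrability of g and the bound on its mean follow.\<close>

lemma Lq_norm_le_1:
  assumes g: "g \<in> borel_measurable unif_interval" and q: "1 \<le> q" and le: "Lq_norm unif_interval (ennreal q) g \<le> 1"
  shows "integrable unif_interval (\<lambda>x. \<bar>g x\<bar> powr q)" "(LINT x|unif_interval. \<bar>g x\<bar> powr q) \<le> 1"
    "integrable unif_interval g" "\<bar>LINT x|unif_interval. g x\<bar> \<le> 1" "q = 1 \<Longrightarrow> (LINT x|unif_interval. \<bar>g x\<bar>) \<le> 1"
proof -
  interpret prob_space unif_interval by (rule prob_space_unif_interval)
  define J where "J = (\<integral>\<^sup>+x. ennreal (\<bar>g x\<bar> powr q) \<partial>unif_interval)"
  have gq: "(\<lambda>x. \<bar>g x\<bar> powr q) \<in> borel_measurable unif_interval" using g by simp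
  have J: "J \<noteq> \<infinity>" "ennreal (enn2real J powr (1 / q)) \<le> 1"
    using le q by (auto simp: Lq_norm_def J_def Let_def top_unique split: if_splits)
  show int: "integrable unif_interval (\<lambda>x. \<bar>g x\<bar> powr q)"
    using J(1) gq by (simp add: integrable_iff_bounded J_def top.not_eq_extremum)
  have J_eq: "J = ennreal (LINT x|unif_interval. \<bar>g x\<bar> powr q)"
    unfolding J_def by (rule nn_integral_eq_integral[OF int]) simp
  have nonneg: "0 \<le> (LINT x|unif_interval. \<bar>g x\<bar> powr q)" by simp
  have "(LINT x|unif_interval. \<bar>g x\<bar> powr q) powr (1 / q) \<le> 1"
    using J(2) nonneg unfolding J_eq by simp
  then have "((LINT x|unif_interval. \<bar>g x\<bar> powr q) powr (1 / q)) powr q \<le> 1 powr q"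
    using q by (intro powr_mono2) auto
  then show le1: "(LINT x|unif_interval. \<bar>g x\<bar> powr q) \<le> 1"
    using q nonneg by (simp add: powr_powr)
  have young: "\<bar>y\<bar> \<le> \<bar>y\<bar> powr q / q + (1 - 1 / q)" for y :: real
  proof (cases "q = 1")
    case False
    define p where "p = q / (q - 1)"
    have "p > 1" "1 / q + 1 / p = 1" using q False by (auto simp: p_def field_simps)
    then show ?thesis using Youngs_inequality[of q p "\<bar>y\<bar>" 1] q False by simp
  qed simp
  have int2: "integrable unif_interval (\<lambda>x. \<bar>g x\<bar> powr q / q + (1 - 1 / q))" using int by simp
  show intg: "integrable unif_interval g"
  proof (rule Bochner_Integration.integrable_bound[OF int2 g])
    show "AE x in unif_interval. norm (g x) \<le> norm (\<bar>g x\<bar> powr q / q + (1 - 1 / q))"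
      using young by (auto intro: order.trans[OF _ abs_ge_self])
  qed
  have "\<bar>LINT x|unif_interval. g x\<bar> \<le> (LINT x|unif_interval. \<bar>g x\<bar> powr q / q + (1 - 1 / q))"
    unfolding real_norm_def[symmetric]
    by (rule Bochner_Integration.integral_norm_bound_integral[OF intg]) (use int2 young in auto)
  also have "\<dots> = (LINT x|unif_interval. \<bar>g x\<bar> powr q) / q + (1 - 1 / q)"
    using int by (simp add: prob_space)
  also have "\<dots> \<le> 1 / q + (1 - 1 / q)"
    using le1 q by (intro add_mono divide_right_mono) auto
  finally show "\<bar>LINT x|unif_interval. g x\<bar> \<le> 1" by simp
  show "(LINT x|unif_interval. \<bar>g x\<bar>) \<le> 1" if "q = 1" using le1 that by simp
qed

context interval_prob
begin

text \<open>The integral of f' is kept as a factor of the mean: on the interval it is merely bounded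
  by 1, which produces the extra term there, and on the circle it is 0.\<close>

lemma dual_pairing_bound:
  assumes n: "1 \<le> n" and p: "2 \<le> p" and hc: "holder_conjugate p (ennreal q)"
    and f: "continuous_on {0..<1} f" and w: "weak_deriv_interval f f'"
    and norm: "Lq_norm unif_interval (ennreal q) f' \<le> 1"
  shows "(LINT x|\<mu>. f x) - (LINT x|unif_interval. f x) \<le>
    1728 * (1 / real n + (\<Sum>k\<in>{1..<n}. cmod (fourier_interval \<mu> (int k)) powr q / real k powr q) powr (1 / q))
      + \<bar>mean\<bar> * \<bar>LINT x|unif_interval. f' x\<bar>"
    and "\<bar>LINT x|unif_interval. f' x\<bar> \<le> 1"
proof -
  note q = holder_conjugate_real[OF p hc]
  note f' = Lq_norm_le_1[OF weak_deriv_interval_measurable[OF w] q(1) norm]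
  show "\<bar>LINT x|unif_interval. f' x\<bar> \<le> 1" by (rule f'(4))
  have n0: "n > 0" using n by simp
  have i1: "integrable unif_interval (\<lambda>x. f' x * (saw x - mean))" by (rule deviation_integrable[OF f'(3)])
  have primitive: "f x = f 0 + (LINT t|unif_interval. indicator {0<..x} t *\<^sub>R f' t)" if "0 \<le> x" "x < 1" for x
    unfolding real_scaleR_def by (rule weak_deriv_interval_primitive[OF w f f'(3) that])
  have "(LINT x|\<mu>. f x) - (LINT x|unif_interval. f x) = - (LINT t|unif_interval. saw t *\<^sub>R f' t)"
    by (rule integral_primitive_difference[OF f'(3) primitive])
  also have "(LINT t|unif_interval. saw t *\<^sub>R f' t) = (LINT t|unif_interval. f' t * (saw t - mean) + mean * f' t)"
    by (intro Bochner_Integration.integral_cong refl) (simp add: algebra_simps)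
  also have "\<dots> = (LINT t|unif_interval. f' t * (saw t - mean)) + mean * (LINT t|unif_interval. f' t)"
    using i1 f'(3) by simp
  also have "- \<dots> \<le> \<bar>LINT t|unif_interval. f' t * (saw t - mean)\<bar> + \<bar>mean\<bar> * \<bar>LINT t|unif_interval. f' t\<bar>"
    unfolding abs_mult[symmetric] by linarith
  also have "\<bar>LINT t|unif_interval. f' t * (saw t - mean)\<bar> \<le>
     1728 * (1 / real n + (\<Sum>k\<in>{1..<n}. cmod (coeff (int k)) powr q) powr (1 / q))"
    using q(2)
  proof
    assume "q = 1"
    then show ?thesis using deviation_L1[OF n0 f'(3) f'(5)] by (simp add: sum_nonneg)
  next
    assume "\<exists>r. 2 \<le> r \<and> 1 / r + 1 / q = 1"
    then show ?thesis using deviation_Lp[OF n0 _ _ f'(3,1,2)] by blast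
  qed
  also have "(\<Sum>k\<in>{1..<n}. cmod (coeff (int k)) powr q) powr (1 / q) \<le>
      (\<Sum>k\<in>{1..<n}. cmod (fourier_interval \<mu> (int k)) powr q / real k powr q) powr (1 / q)"
  proof (intro powr_mono2 sum_mono)
    fix k assume "k \<in> {1..<n}"
    then have "cmod (coeff (int k)) powr q \<le> (cmod (fourier_interval \<mu> (int k)) / real k) powr q"
      using fourier_coeff_bound[of k] q by (intro powr_mono2) auto
    then show "cmod (coeff (int k)) powr q \<le> cmod (fourier_interval \<mu> (int k)) powr q / real k powr q"
      by (simp add: powr_divide)
  qed (use q in \<open>auto intro!: sum_nonneg\<close>)
  finally show "(LINT x|\<mu>. f x) - (LINT x|unif_interval. f x) \<le>
    1728 * (1 / real n + (\<Sum>k\<in>{1..<n}. cmod (fourier_interval \<mu> (int k)) powr q / real k powr q) powr (1 / q))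
      + \<bar>mean\<bar> * \<bar>LINT x|unif_interval. f' x\<bar>"
    by simp
qed

end

lemma neg_sobolev_interval_bound:
  assumes n: "1 \<le> n" and p: "2 \<le> p" and hc: "holder_conjugate p (ennreal q)"
    and \<mu>: "prob_space \<mu>" "sets \<mu> = sets (restrict_space borel {0..<1})"
  shows "neg_sobolev_interval p \<mu> \<le> ereal (1729 / real n + 1729 *
      ((\<Sum>k\<in>{1..<n}. cmod (fourier_interval \<mu> (int k)) powr q / real k powr q)
        + \<bar>mean_discrepancy \<mu>\<bar> powr q) powr (1 / q))"
  unfolding neg_sobolev_interval_def
proof (rule SUP_least)
  interpret interval_prob \<mu> by (intro interval_prob.intro interval_prob_axioms.intro \<mu>)
  fix f assume "f \<in> {f. continuous_on {0..<1} f \<and> (\<exists>q f'. holder_conjugate p q \<and>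
    weak_deriv_interval f f' \<and> Lq_norm unif_interval q f' \<le> 1)}"
  then obtain f' where f: "continuous_on {0..<1} f" "weak_deriv_interval f f'" "Lq_norm unif_interval (ennreal q) f' \<le> 1"
    using holder_conjugate_unique[OF p hc] by blast
  let ?A = "\<Sum>k\<in>{1..<n}. cmod (fourier_interval \<mu> (int k)) powr q / real k powr q"
  let ?T = "(?A + \<bar>mean\<bar> powr q) powr (1 / q)"
  note q = holder_conjugate_real(1)[OF p hc]
  note b = dual_pairing_bound[OF n p hc f]
  have A: "0 \<le> ?A" by (intro sum_nonneg) auto
  have "?A powr (1 / q) \<le> ?T" using q A by (intro powr_mono2) auto
  moreover have "\<bar>mean\<bar> * \<bar>LINT x|unif_interval. f' x\<bar> \<le> ?T"
  proof -
    have "\<bar>mean\<bar> * \<bar>LINT x|unif_interval. f' x\<bar> \<le> \<bar>mean\<bar> * 1" by (intro mult_left_mono b(2)) simp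
    also have "\<dots> = (\<bar>mean\<bar> powr q) powr (1 / q)" using q by (simp add: powr_powr)
    also have "\<dots> \<le> ?T" using q A by (intro powr_mono2) auto
    finally show ?thesis .
  qed
  \<comment> \<open>The mean adds 1 to the factor 1728 = 6 * 288; hence 1729.\<close>
  ultimately have "(LINT x|\<mu>. f x) - (LINT x|unif_interval. f x) \<le> 1728 * (1 / real n + ?T) + ?T"
    using b(1) by simp
  also have "\<dots> = 1728 / real n + 1729 * ?T" by simp
  also have "\<dots> \<le> 1729 / real n + 1729 * ?T"
    by (intro add_right_mono divide_right_mono) auto
  finally show "ereal ((LINT x|\<mu>. f x) - (LINT x|unif_interval. f x)) \<le> ereal (1729 / real n + 1729 *
      (?A + \<bar>mean_discrepancy \<mu>\<bar> powr q) powr (1 / q))"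
    by (simp add: mean_eq)
qed

subsection \<open>Lifting from the circle to the interval\<close>

text \<open>\<open>rep_circle\<close> picks a representative that is arbitrary up to an integer;
  \<open>frac\<close> turns it into the inverse of \<open>to_circle\<close> on [0,1).\<close>

definition circle_frac :: "circle \<Rightarrow> real" where
  "circle_frac z = frac (rep_circle z)"

lemma frac_eq_iff: "frac x = frac y \<longleftrightarrow> x - y \<in> \<int>" for x y :: real
proof
  assume "frac x = frac y"
  then have "x - y = of_int (\<lfloor>x\<rfloor> - \<lfloor>y\<rfloor>)" by (simp add: frac_def)
  then show "x - y \<in> \<int>" by (metis Ints_of_int)
next
  assume "x - y \<in> \<int>"
  then obtain m where "x - y = of_int m" by (elim Ints_cases)
  then have "x = y + of_int m" by simp
  then show "frac x = frac y" by (simp add: frac_def)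
qed

lemma to_circle_eq_iff: "to_circle x = to_circle y \<longleftrightarrow> x - y \<in> \<int>"
  by (rule circle.abs_eq_iff)

lemma to_circle_rep: "to_circle (rep_circle z) = z"
  by (rule Quotient_abs_rep[OF Quotient_circle])

lemma circle_frac_to_circle: "circle_frac (to_circle x) = frac x"
  unfolding circle_frac_def frac_eq_iff to_circle_eq_iff[symmetric] by (rule to_circle_rep)

lemma to_circle_frac: "to_circle (frac x) = to_circle x"
  unfolding to_circle_eq_iff by (simp add: frac_def)

lemma to_circle_circle_frac: "to_circle (circle_frac z) = z"
  by (simp add: circle_frac_def to_circle_frac to_circle_rep)

lemma circle_frac_bounds: "0 \<le> circle_frac z" "circle_frac z < 1"
  by (simp_all add: circle_frac_def frac_ge_0 frac_lt_1)

text \<open>The map is lower semicontinuous, since its only jump is at the class of 0, where it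
  takes its least value; so its superlevel sets are open.\<close>

lemma circle_frac_measurable: "circle_frac \<in> borel_measurable borel"
  unfolding borel_measurable_iff_greater
proof
  fix a :: real
  have "open {z. a < circle_frac z}"
  proof (cases "a < 0")
    case True
    then have "a < circle_frac z" for z using circle_frac_bounds(1)[of z] by linarith
    then have "{z. a < circle_frac z} = UNIV" by simp
    then show ?thesis by simp
  next
    case False
    have "to_circle -` {z. a < circle_frac z} = (\<Union>m::int. {of_int m + a<..<of_int m + 1})"
    proof (intro equalityI subsetI)
      fix x assume "x \<in> to_circle -` {z. a < circle_frac z}"
      then have "a < frac x" by (simp add: circle_frac_to_circle)
      then have "x \<in> {of_int \<lfloor>x\<rfloor> + a<..<of_int \<lfloor>x\<rfloor> + 1}"
        unfolding frac_def greaterThanLessThan_iff by linarith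
      then show "x \<in> (\<Union>m::int. {of_int m + a<..<of_int m + 1})" by blast
    next
      fix x assume "x \<in> (\<Union>m::int. {of_int m + a<..<of_int m + 1})"
      then obtain m :: int where m: "of_int m + a < x" "x < of_int m + 1" by auto
      then have "\<lfloor>x\<rfloor> = m" using False by (simp add: floor_eq_iff)
      then have "a < frac x" using m by (simp add: frac_def)
      then show "x \<in> to_circle -` {z. a < circle_frac z}" by (simp add: circle_frac_to_circle)
    qed
    then show ?thesis by (simp add: open_circle_def open_UN)
  qed
  then show "{w \<in> space borel. a < circle_frac w} \<in> sets borel" by simp
qed

lemma continuous_on_circleI:
  assumes "continuous_on UNIV (g \<circ> to_circle)" shows "continuous_on UNIV g"
  using assms by (simp add: continuous_on_open_vimage open_circle_def vimage_comp comp_def)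

lemma to_circle_measurable_U: "to_circle \<in> measurable unif_interval borel"
  unfolding unif_interval_def by (rule measurable_restrict_space1) simp

lemma integral_unif_circle:
  fixes g :: "circle \<Rightarrow> real"
  assumes "g \<in> borel_measurable borel"
  shows "(LINT z|unif_circle. g z) = (LINT x|unif_interval. g (to_circle x))"
  unfolding unif_circle_def by (rule integral_distr[OF to_circle_measurable_U assms])

lemma sets_unif_circle: "sets unif_circle = sets borel"
  by (simp add: unif_circle_def)

lemma has_derivative_vanish_outside:
  assumes "\<And>x. x \<notin> {a..b} \<Longrightarrow> \<phi> x = 0" "x \<notin> {a..b}"
  shows "(\<phi> has_field_derivative (0::real)) (at (x::real))"
  by (rule has_field_derivative_transform_within_open[where S = "- {a..b}" and f = "\<lambda>x. 0"])
    (use assms in \<open>auto intro: open_Compl\<close>)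

text \<open>Away from the integers \<open>frac\<close> is locally a translation; near them the
  composite vanishes because the support of \<phi> stays away from 0 and 1.\<close>

lemma frac_comp_has_derivative:
  fixes \<phi> :: "real \<Rightarrow> real"
  assumes ab: "0 < a" "b < 1" and \<phi>: "smooth \<phi>" "\<And>x. x \<notin> {a..b} \<Longrightarrow> \<phi> x = 0"
  shows "((\<phi> \<circ> frac) has_field_derivative deriv \<phi> (frac x)) (at x)"
proof (cases "frac x = 0")
  case False
  let ?m = "\<lfloor>x\<rfloor>"
  have "((\<lambda>y. \<phi> (y - of_int ?m)) has_field_derivative deriv \<phi> (frac x)) (at x)"
    unfolding frac_def
    by (rule DERIV_chain2[OF smooth_has_derivative[OF \<phi>(1)], THEN DERIV_cong])
      (auto intro!: derivative_eq_intros)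
  moreover have "x \<in> {of_int ?m<..<of_int ?m + 1}"
    using False frac_ge_0[of x] unfolding frac_def greaterThanLessThan_iff by linarith
  ultimately show ?thesis
  proof (rule has_field_derivative_transform_within_open[OF _ open_greaterThanLessThan])
    fix y assume "y \<in> {of_int ?m<..<of_int ?m + 1 :: real}"
    then have "\<lfloor>y\<rfloor> = ?m" by (intro floor_unique) auto
    then show "\<phi> (y - of_int ?m) = (\<phi> \<circ> frac) y" by (simp add: frac_def)
  qed
next
  case True
  let ?m = "\<lfloor>x\<rfloor>"
  \<comment> \<open>Within this radius \<open>frac\<close> is below a to the right of the integer
    and above b to its left.\<close>
  define e where "e = min 1 (min a (1 - b))"
  have e: "0 < e" "e \<le> 1" "e \<le> a" "e \<le> 1 - b" using ab by (auto simp: e_def)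
  have x: "x = of_int ?m" using True by (simp add: frac_def)
  have d0: "deriv \<phi> 0 = 0"
    by (rule DERIV_imp_deriv, rule has_derivative_vanish_outside[OF \<phi>(2)]) (use ab in auto)
  have "((\<lambda>y. 0) has_field_derivative deriv \<phi> (frac x)) (at x)" unfolding True d0 by simp
  then show ?thesis
  proof (rule has_field_derivative_transform_within_open)
    show "open {x - e<..<x + e}" "x \<in> {x - e<..<x + e}" using e by auto
    fix y assume y: "y \<in> {x - e<..<x + e}"
    show "0 = (\<phi> \<circ> frac) y"
    proof (cases "y \<ge> x")
      case True
      have "\<lfloor>y\<rfloor> = ?m" using True y e x by (intro floor_unique) auto
      then have "frac y < a" using y e x by (simp add: frac_def)
      then show ?thesis using \<phi>(2) by simp
    next
      case False
      have "\<lfloor>y\<rfloor> = ?m - 1" using False y x e by (intro floor_unique) auto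
      then have "frac y > b" using y e x by (simp add: frac_def)
      then show ?thesis using \<phi>(2) by simp
    qed
  qed
qed

lemma smooth_frac_comp:
  assumes ab: "0 < a" "b < 1" and \<phi>: "smooth \<phi>" "\<And>x. x \<notin> {a..b} \<Longrightarrow> \<phi> x = 0"
  shows "smooth (\<phi> \<circ> frac)"
proof (rule smooth_coinduct[where P = "\<lambda>g. \<exists>\<phi>. smooth \<phi> \<and> (\<forall>x. x \<notin> {a..b} \<longrightarrow> \<phi> x = 0) \<and> g = \<phi> \<circ> frac"])
  fix g assume "\<exists>\<phi>. smooth \<phi> \<and> (\<forall>x. x \<notin> {a..b} \<longrightarrow> \<phi> x = 0) \<and> g = \<phi> \<circ> frac"
  then obtain \<phi> where \<phi>: "smooth \<phi>" "\<And>x. x \<notin> {a..b} \<Longrightarrow> \<phi> x = 0" and g: "g = \<phi> \<circ> frac" by blast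
  have "(g has_field_derivative (deriv \<phi> \<circ> frac) x) (at x)" for x
    unfolding g using frac_comp_has_derivative[OF ab \<phi>] by simp
  moreover have "deriv \<phi> x = 0" if "x \<notin> {a..b}" for x
    by (rule DERIV_imp_deriv, rule has_derivative_vanish_outside[OF \<phi>(2) that])
  ultimately show "\<exists>g'. (\<forall>x. (g has_field_derivative g' x) (at x)) \<and>
      (\<exists>\<phi>. smooth \<phi> \<and> (\<forall>x. x \<notin> {a..b} \<longrightarrow> \<phi> x = 0) \<and> g' = \<phi> \<circ> frac)"
    using smooth_deriv[OF \<phi>(1)] by blast
qed (use \<phi> in blast)

text \<open>Test functions on the interval have compact support in (0,1), so their periodic
  extensions are smooth on the circle. The constant 1 is a test function on the circle as well, and
  it forces f' to have mean 0.\<close>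

lemma weak_deriv_circle_lift:
  assumes f: "continuous_on UNIV f" and w: "weak_deriv_circle f f'"
  shows "weak_deriv_interval (f \<circ> to_circle) (f' \<circ> to_circle)"
    and "(LINT x|unif_interval. f' (to_circle x)) = 0"
proof -
  have fm: "f \<in> borel_measurable borel" using f by (rule borel_measurable_continuous_onI)
  have f'm: "f' \<in> borel_measurable borel"
    using w measurable_cong_sets[OF sets_unif_circle refl] borel_measurable_integrable
    unfolding weak_deriv_circle_def by blast
  have intU: "integrable unif_interval (\<lambda>x. g (to_circle x))" if "integrable unif_circle g" for g :: "circle \<Rightarrow> real"
    using that unfolding unif_circle_def by (rule integrable_distr[OF to_circle_measurable_U])
  have set_int: "set_integrable lborel {a..b} (\<lambda>x. g (to_circle x))"
    if "integrable unif_circle g" "0 < a" "b < 1" for g :: "circle \<Rightarrow> real" and a b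
  proof -
    have "set_integrable lborel {0..<1} (\<lambda>x. g (to_circle x))"
      using intU[OF that(1)] unfolding unif_interval_def set_integrable_def
      by (subst (asm) integrable_restrict_space) auto
    then show ?thesis by (rule set_integrable_subset) (use that in auto)
  qed
  have test: "(LINT x|unif_interval. f (to_circle x) * \<psi>' (to_circle x)) = - (LINT x|unif_interval. f' (to_circle x) * \<psi> (to_circle x))"
    if "smooth (\<psi> \<circ> to_circle)" "\<psi>' \<circ> to_circle = deriv (\<psi> \<circ> to_circle)" for \<psi> \<psi>'
  proof -
    have "\<psi> \<in> borel_measurable borel"
      by (intro borel_measurable_continuous_onI continuous_on_circleI smooth_continuous that)
    moreover have "\<psi>' \<in> borel_measurable borel"
      by (intro borel_measurable_continuous_onI continuous_on_circleI)
        (simp only: that smooth_continuous smooth_deriv)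
    moreover have "(LINT z|unif_circle. f z * \<psi>' z) = - (LINT z|unif_circle. f' z * \<psi> z)"
      using w that unfolding weak_deriv_circle_def by blast
    ultimately show ?thesis
      using fm f'm by (simp add: integral_unif_circle)
  qed
  show "weak_deriv_interval (f \<circ> to_circle) (f' \<circ> to_circle)"
    unfolding weak_deriv_interval_def
  proof (intro conjI allI impI)
    fix a b :: real assume ab: "0 < a \<and> b < 1"
    show "set_integrable lborel {a..b} (f \<circ> to_circle)" "set_integrable lborel {a..b} (f' \<circ> to_circle)"
      using set_int[of f a b] set_int[of f' a b] w ab unfolding weak_deriv_circle_def comp_def by auto
  next
    fix \<phi> :: "real \<Rightarrow> real"
    assume "smooth \<phi> \<and> (\<exists>a b. 0 < a \<and> b < 1 \<and> (\<forall>x. x \<notin> {a..b} \<longrightarrow> \<phi> x = 0))"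
    then obtain a b where ab: "0 < a" "b < 1" and \<phi>: "smooth \<phi>" "\<And>x. x \<notin> {a..b} \<Longrightarrow> \<phi> x = 0" by blast
    let ?\<psi> = "\<phi> \<circ> circle_frac" and ?\<psi>' = "deriv \<phi> \<circ> circle_frac"
    have lift: "(h \<circ> circle_frac) \<circ> to_circle = h \<circ> frac" for h :: "real \<Rightarrow> real"
      by (simp add: fun_eq_iff circle_frac_to_circle)
    have "smooth (?\<psi> \<circ> to_circle)" unfolding lift by (rule smooth_frac_comp[OF ab \<phi>])
    moreover have "?\<psi>' \<circ> to_circle = deriv (?\<psi> \<circ> to_circle)"
      unfolding lift using DERIV_imp_deriv[OF frac_comp_has_derivative[OF ab \<phi>]] by (simp add: fun_eq_iff)
    ultimately have "(LINT x|unif_interval. f (to_circle x) * ?\<psi>' (to_circle x)) = - (LINT x|unif_interval. f' (to_circle x) * ?\<psi> (to_circle x))"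
      by (rule test)
    moreover have "(LINT x|unif_interval. g (to_circle x) * (h \<circ> circle_frac) (to_circle x)) = (LINT x|unif_interval. (g \<circ> to_circle) x * h x)"
      for g :: "circle \<Rightarrow> real" and h :: "real \<Rightarrow> real"
      by (intro Bochner_Integration.integral_cong refl)
        (auto simp: space_unif_interval circle_frac_to_circle frac_eq)
    ultimately show "(LINT x|unif_interval. (f \<circ> to_circle) x * deriv \<phi> x) = - (LINT x|unif_interval. (f' \<circ> to_circle) x * \<phi> x)"
      by simp
  qed
  have "smooth ((\<lambda>z. 1) \<circ> to_circle)" unfolding comp_def by (rule smooth_const)
  moreover have "(\<lambda>z. 0) \<circ> to_circle = deriv ((\<lambda>z. 1) \<circ> to_circle)"
    by (simp add: fun_eq_iff comp_def)
  ultimately show "(LINT x|unif_interval. f' (to_circle x)) = 0"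
    using test[of "\<lambda>z. 1" "\<lambda>z. 0"] by simp
qed

text \<open>The circle is cut open at 0: pushing \<mu> forward to [0,1) by
  \<open>circle_frac\<close> preserves the integrals of functions pulled back along
  \<open>to_circle\<close>, hence the Fourier coefficients and the pairing with f.\<close>

lemma neg_sobolev_circle_bound:
  assumes n: "1 \<le> n" and p: "2 \<le> p" and hc: "holder_conjugate p (ennreal q)"
    and \<mu>: "prob_space \<mu>" "sets \<mu> = sets borel"
  shows "neg_sobolev_circle p \<mu> \<le> ereal (1729 / real n + 1729 *
      (\<Sum>k\<in>{1..<n}. cmod (fourier_circle \<mu> (int k)) powr q / real k powr q) powr (1 / q))"
  unfolding neg_sobolev_circle_def
proof (rule SUP_least)
  let ?R = "restrict_space borel {0..<1} :: real measure"
  define \<nu> where "\<nu> = distr \<mu> ?R circle_frac"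
  have cm: "circle_frac \<in> measurable \<mu> ?R"
    unfolding measurable_cong_sets[OF \<mu>(2) refl]
    by (rule measurable_restrict_space2) (use circle_frac_bounds circle_frac_measurable in auto)
  interpret interval_prob \<nu>
    by (intro interval_prob.intro interval_prob_axioms.intro)
      (auto simp: \<nu>_def intro!: prob_space.prob_space_distr \<mu> cm)
  have push: "(LINT x|\<nu>. h (to_circle x)) = (LINT z|\<mu>. h z)"
    if "h \<in> borel_measurable borel" for h :: "circle \<Rightarrow> 'b::{banach, second_countable_topology}"
  proof -
    have "(\<lambda>x. h (to_circle x)) \<in> borel_measurable ?R"
      by (rule measurable_restrict_space1) (use that in measurable)
    from integral_distr[OF cm this] show ?thesis
      by (simp add: \<nu>_def to_circle_circle_frac)
  qed
  have char_lift: "circle_char k (to_circle x) = exp (- 2 * complex_of_real pi * \<i> * of_int k * complex_of_real x)" for k x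
    by (rule circle_char.abs_eq)
  have fourier: "fourier_interval \<nu> k = fourier_circle \<mu> k" for k
  proof -
    have "continuous_on UNIV (circle_char k \<circ> to_circle)"
      unfolding comp_def char_lift by (intro continuous_intros)
    then have "circle_char k \<in> borel_measurable borel"
      by (intro borel_measurable_continuous_onI continuous_on_circleI)
    from push[OF this] show ?thesis
      by (simp add: fourier_interval_def fourier_circle_def char_lift)
  qed
  fix f assume "f \<in> {f. continuous_on UNIV f \<and> (\<exists>q f'. holder_conjugate p q \<and>
    weak_deriv_circle f f' \<and> Lq_norm unif_circle q f' \<le> 1)}"
  then obtain f' where f: "continuous_on UNIV f" "weak_deriv_circle f f'" "Lq_norm unif_circle (ennreal q) f' \<le> 1"
    using holder_conjugate_unique[OF p hc] by blast
  have fm: "f \<in> borel_measurable borel" using f(1) by (rule borel_measurable_continuous_onI)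
  have f'm: "f' \<in> borel_measurable borel"
    using f(2) measurable_cong_sets[OF sets_unif_circle refl] borel_measurable_integrable
    unfolding weak_deriv_circle_def by blast
  have "Lq_norm unif_interval (ennreal q) (f' \<circ> to_circle) = Lq_norm unif_circle (ennreal q) f'"
    using f'm unfolding Lq_norm_def unif_circle_def
    by (subst nn_integral_distr[OF to_circle_measurable_U]) auto
  then have norm: "Lq_norm unif_interval (ennreal q) (f' \<circ> to_circle) \<le> 1" using f(3) by simp
  have cont: "continuous_on {0..<1} (f \<circ> to_circle)"
    by (rule continuous_on_compose[OF continuous_on_subset[OF continuous_on_to_circle] continuous_on_subset[OF f(1)]]) auto
  let ?S = "(\<Sum>k\<in>{1..<n}. cmod (fourier_circle \<mu> (int k)) powr q / real k powr q) powr (1 / q)"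
  have "(LINT z|\<mu>. f z) - (LINT z|unif_circle. f z) = (LINT x|\<nu>. (f \<circ> to_circle) x) - (LINT x|unif_interval. (f \<circ> to_circle) x)"
    by (simp add: push[OF fm] integral_unif_circle[OF fm])
  \<comment> \<open>The lifted f' has integral 0, which removes the term with the mean; the
    following step passes to 1729 to share the constant of the interval.\<close>
  also have "\<dots> \<le> 1728 * (1 / real n + ?S)"
    using dual_pairing_bound(1)[OF n p hc cont weak_deriv_circle_lift(1)[OF f(1,2)] norm]
      weak_deriv_circle_lift(2)[OF f(1,2)] by (simp add: fourier)
  also have "\<dots> \<le> 1729 / real n + 1729 * ?S"
    unfolding distrib_left by (intro add_mono mult_right_mono) (auto intro: divide_right_mono)
  finally show "ereal ((LINT z|\<mu>. f z) - (LINT z|unif_circle. f z)) \<le> ereal (1729 / real n + 1729 * ?S)"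
    by simp
qed

theorem proposition1p4:
  shows "\<exists>C::real. C > 0 \<and>
    (\<forall>(p::ennreal) (q::real) (n::nat).
       2 \<le> p \<and> holder_conjugate p (ennreal q) \<and> 1 \<le> n \<longrightarrow>
       (\<forall>\<mu> :: circle measure. prob_space \<mu> \<and> sets \<mu> = sets borel \<longrightarrow>
          neg_sobolev_circle p \<mu> \<le>
            ereal (C / real n +
              C * (\<Sum>k\<in>{1..<n}. cmod (fourier_circle \<mu> (int k)) powr q / real k powr q)
                    powr (1 / q))) \<and>
       (\<forall>\<mu> :: real measure. prob_space \<mu> \<and> sets \<mu> = sets (restrict_space borel {0..<1}) \<longrightarrow>
          neg_sobolev_interval p \<mu> \<le>
            ereal (C / real n +
              C * ((\<Sum>k\<in>{1..<n}. cmod (fourier_interval \<mu> (int k)) powr q / real k powr q)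
                     + \<bar>mean_discrepancy \<mu>\<bar> powr q)
                    powr (1 / q))))"
  by (rule exI[of _ 1729]) (auto simp del: One_nat_def intro: neg_sobolev_circle_bound neg_sobolev_interval_bound)

end
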